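(* Let $X$ be any non-zero element of $\mathfrak{su}(2)$. Then there is $S=S_{X,1}\in VN(\mathrm{SU}(2)\times\mathrm{SU}(2))$ such that \[ S(u)=\int_{\mathrm{SU}(2)}\partial_{(X,0)}u(g,g^{-1})\,dg \] for every $u\in\mathcal{D}(\mathrm{SU}(2)\times\mathrm{SU}(2))$.
   Context: $\mathfrak{su}(2)$ is the Lie algebra of $\mathrm{SU}(2)$: the trace-zero skew-Hermitian complex $2\times2$ matrices. Integration is with respect to Haar measure. For a locally compact group $G$, the Fourier algebra $A(G)$ (Eymard) is the Banach algebra of all functions $u(g)=\langle\lambda(g)\xi|\eta\rangle$ with $\xi,\eta\in L^2(G)$, where $\lambda$ is the left regular representation of $G$ on $L^2(G)$; its norm is $\|u\|_A=\inf\{\|\xi\|_2\|\eta\|_2: u=\langle\lambda(\cdot)\xi|\eta\rangle\}$. Its dual is the group von Neumann algebra $VN(G)=\lambda(G)''\subset\mathcal{B}(L^2(G))$ via $T(u)=\langle T\xi|\eta\rangle$ for $u=\langle\lambda(\cdot)\xi|\eta\rangle$. For a Lie group $G$, $\mathcal{D}(G)$ is the space of compactly supported smooth functions on $G$; it is contained in $A(G)$. For $X$ in the Lie algebra of $G$ and $u\in\mathcal{D}(G\times G)$, $\partial_{(X,0)}u(g,h)=\frac{d}{dt}u(g\exp(tX),h)|_{t=0}$. *)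

theory Defs
  imports "HOL-Analysis.Analysis" "HOL-Algebra.Group"
begin

section \<open>Locally compact groups, Haar measure, and the group von Neumann algebra\<close>

text \<open>A locally compact group is given by a group record \<open>G\<close> whose carrier is a subset of a
  topological type and has the subspace topology. For the second countable groups
  considered here a left invariant Borel measure that is finite on compact sets is
  automatically regular, so regularity is not listed.\<close>

definition haar_measure :: "('a::topological_space, 'c) monoid_scheme \<Rightarrow> 'a measure \<Rightarrow> bool" where
  "haar_measure G M \<longleftrightarrow>
     sets M = sets (restrict_space borel (carrier G)) \<and>
     emeasure M (space M) \<noteq> 0 \<and>
     (\<forall>K. compact K \<and> K \<subseteq> carrier G \<longrightarrow> emeasure M K < \<infinity>) \<and>
     (\<forall>g\<in>carrier G. \<forall>A\<in>sets M. emeasure M ((\<lambda>x. g \<otimes>\<^bsub>G\<^esub> x) ` A) = emeasure M A)"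

text \<open>Elements of \<open>L\<^sup>2(M)\<close> are represented by square integrable functions, and identities
  between them are identities almost everywhere. Accordingly an element of the algebra
  of bounded operators on \<open>L\<^sup>2(M)\<close> is represented by a map \<open>T\<close> on square integrable
  functions; linearity and boundedness make \<open>T f\<close> and \<open>T f'\<close> agree almost everywhere
  whenever \<open>f\<close> and \<open>f'\<close> do, so \<open>T\<close> descends to the quotient. Conversely, every bounded operator on the
  quotient is induced by such a map.\<close>

definition L2 :: "'a measure \<Rightarrow> ('a \<Rightarrow> complex) set" where
  "L2 M = {f \<in> borel_measurable M. integrable M (\<lambda>x. (cmod (f x))\<^sup>2)}"

definition L2_inner :: "'a measure \<Rightarrow> ('a \<Rightarrow> complex) \<Rightarrow> ('a \<Rightarrow> complex) \<Rightarrow> complex" where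
  "L2_inner M f g = (LINT x|M. f x * cnj (g x))"

definition L2_norm :: "'a measure \<Rightarrow> ('a \<Rightarrow> complex) \<Rightarrow> real" where
  "L2_norm M f = sqrt (LINT x|M. (cmod (f x))\<^sup>2)"

definition L2_operators :: "'a measure \<Rightarrow> (('a \<Rightarrow> complex) \<Rightarrow> 'a \<Rightarrow> complex) set" where
  "L2_operators M = {T.
     (\<forall>f\<in>L2 M. T f \<in> L2 M) \<and>
     (\<forall>f\<in>L2 M. \<forall>g\<in>L2 M. AE x in M. T (\<lambda>y. f y + g y) x = T f x + T g x) \<and>
     (\<forall>c. \<forall>f\<in>L2 M. AE x in M. T (\<lambda>y. c * f y) x = c * T f x) \<and>
     (\<exists>C. \<forall>f\<in>L2 M. L2_norm M (T f) \<le> C * L2_norm M f)}"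

definition commutant ::
  "'a measure \<Rightarrow> (('a \<Rightarrow> complex) \<Rightarrow> 'a \<Rightarrow> complex) set \<Rightarrow> (('a \<Rightarrow> complex) \<Rightarrow> 'a \<Rightarrow> complex) set"
where
  "commutant M \<A> =
     {T \<in> L2_operators M. \<forall>A\<in>\<A>. \<forall>f\<in>L2 M. AE x in M. T (A f) x = A (T f) x}"

definition left_regular ::
  "('a, 'c) monoid_scheme \<Rightarrow> 'a \<Rightarrow> ('a \<Rightarrow> complex) \<Rightarrow> 'a \<Rightarrow> complex" where
  "left_regular G g f = (\<lambda>x. f (inv\<^bsub>G\<^esub> g \<otimes>\<^bsub>G\<^esub> x))"

definition VN ::
  "('a, 'c) monoid_scheme \<Rightarrow> 'a measure \<Rightarrow> (('a \<Rightarrow> complex) \<Rightarrow> 'a \<Rightarrow> complex) set" where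
  "VN G M = commutant M (commutant M (left_regular G ` carrier G))"

text \<open>The value \<open>T(u)\<close> of \<open>T\<close> in the group von Neumann algebra at an element \<open>u\<close> of the Fourier
  algebra: it is \<open>\<langle>T \<xi> | \<eta>\<rangle>\<close> for any \<open>\<xi>, \<eta>\<close> in \<open>L\<^sup>2\<close> with \<open>u(g) = \<langle>\<lambda>(g) \<xi> | \<eta>\<rangle>\<close>, the Fourier
  algebra being the set of those \<open>u\<close> for which such \<open>\<xi>, \<eta>\<close> exist.\<close>

definition VN_dual ::
  "('a, 'c) monoid_scheme \<Rightarrow> 'a measure \<Rightarrow> (('a \<Rightarrow> complex) \<Rightarrow> 'a \<Rightarrow> complex) \<Rightarrow>
     ('a \<Rightarrow> complex) \<Rightarrow> complex" where
  "VN_dual G M T u =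
     (THE c. \<exists>\<xi>\<in>L2 M. \<exists>\<eta>\<in>L2 M.
        (\<forall>g\<in>carrier G. u g = L2_inner M (left_regular G g \<xi>) \<eta>) \<and> c = L2_inner M (T \<xi>) \<eta>)"


section \<open>Smooth functions\<close>

primrec C_k_on :: "nat \<Rightarrow> ('a::real_normed_vector \<Rightarrow> 'b::real_normed_vector) \<Rightarrow> 'a set \<Rightarrow> bool" where
  "C_k_on 0 f W \<longleftrightarrow> continuous_on W f"
| "C_k_on (Suc k) f W \<longleftrightarrow>
     (\<forall>x\<in>W. f differentiable at x) \<and> (\<forall>v. C_k_on k (\<lambda>x. frechet_derivative f (at x) v) W)"

text \<open>Smooth functions on an embedded submanifold \<open>S\<close> of a Euclidean space are the functions
  that locally extend to smooth functions on open subsets of the ambient space. Only the values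
  on \<open>S\<close> matter.\<close>

definition smooth_fun_on :: "'a::euclidean_space set \<Rightarrow> ('a \<Rightarrow> complex) \<Rightarrow> bool" where
  "smooth_fun_on S u \<longleftrightarrow>
     (\<forall>p\<in>S. \<exists>W F. open W \<and> p \<in> W \<and> (\<forall>k. C_k_on k F W) \<and> (\<forall>x\<in>W \<inter> S. F x = u x))"

definition test_functions :: "'a::euclidean_space set \<Rightarrow> ('a \<Rightarrow> complex) set" where
  "test_functions S =
     {u. smooth_fun_on S u \<and> (\<exists>K. compact K \<and> K \<subseteq> S \<and> (\<forall>x\<in>S - K. u x = 0))}"


section \<open>The group SU(2) and its Lie algebra\<close>

type_synonym mat2 = "complex^2^2"

definition conj_transpose :: "mat2 \<Rightarrow> mat2" where
  "conj_transpose A = map_matrix cnj (transpose A)"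

definition SU2 :: "mat2 monoid" where
  "SU2 = \<lparr>carrier = {A. conj_transpose A ** A = mat 1 \<and> A ** conj_transpose A = mat 1 \<and> det A = 1},
          mult = (**), one = mat 1\<rparr>"

definition su2 :: "mat2 set" where
  "su2 = {X. trace X = 0 \<and> conj_transpose X = - X}"

text \<open>The exponential series. The power is spelled out because \<open>*\<close> and \<open>^\<close> act
  entrywise on the type of matrices.\<close>

definition mat_exp :: "mat2 \<Rightarrow> mat2" where
  "mat_exp A = (\<Sum>n. (1 / fact n) *\<^sub>R (((**) A) ^^ n) (mat 1))"

definition deriv_X0 :: "mat2 \<Rightarrow> (mat2 \<times> mat2 \<Rightarrow> complex) \<Rightarrow> mat2 \<times> mat2 \<Rightarrow> complex" where
  "deriv_X0 X u = (\<lambda>(g, h). vector_derivative (\<lambda>t::real. u (g ** mat_exp (t *\<^sub>R X), h)) (at 0))"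

end

theory Submission
  imports Defs "HOL-Probability.Probability_Measure"
begin

text \<open>On the isotypic component of \<open>\<pi> \<otimes> \<pi>'\<close> the functional
  \<open>u \<mapsto> \<integral> \<partial>\<^bsub>(X,0)\<^esub> u(g, g\<^sup>-\<^sup>1) dg\<close> is the operator \<open>\<integral> \<pi>(g) d\<pi>(X) \<otimes> \<pi>'(g\<^sup>-\<^sup>1) dg\<close>. By Schur
  orthogonality it vanishes unless \<open>\<pi> = \<pi>'\<close>, and then it is the flip composed with
  \<open>d\<pi>(X) / dim \<pi>\<close>. Since the Casimir eigenvalue is \<open>(dim \<pi>)\<^sup>2 - 1\<close>, these operators are bounded
  uniformly in \<open>\<pi>\<close>, so their orthogonal sum \<open>S\<close> is bounded. The irreducible representations enter
  only through their characters \<open>\<chi>\<^sub>d = sin (d \<theta>) / sin \<theta>\<close>, indexed by the dimension \<open>d\<close>: Schur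
  orthogonality is replaced by the functional equation
  \<open>d \<integral> \<chi>\<^sub>d (b h b\<^sup>-\<^sup>1 c) db = \<chi>\<^sub>d(h) \<chi>\<^sub>d(c)\<close>, and completeness by the positivity of the Poisson
  kernel \<open>\<Sum>\<^sub>d d r\<^sup>d \<chi>\<^sub>d\<close>.\<close>

section \<open>Square integrable functions\<close>

text \<open>The group von Neumann algebra is a bicommutant and the pairing a definite description,
  so two things have to be supplied. An operator enters the bicommutant as a strong limit of
  convolution operators: these are weak integrals of left translations and commute with everything
  that commutes with those. Pairing a convolution operator with \<open>\<xi>\<close> and
  \<open>\<eta>\<close> integrates its kernel against the coefficient function, so the value depends
  on \<open>u\<close> alone. Secondly, a smooth function must be shown to lie in the Fourier algebra
  at all; this comes from inverting a power of 1 + Casimir in each variable by a continuous kernel.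
  The functional equation is a form of Archimedes' theorem: the half trace of
  \<open>b h b\<inverse> c\<close> is uniformly distributed on an interval, and d times the
  character is the derivative of cos(d \<theta>) with respect to cos \<theta>. The bound on a single
  block is obtained only after summing over an orthonormal basis of su(2), because the Casimir is
  scalar on a block whereas the square of one \<open>X\<close> is not.\<close>

lemma borel_measurable_cnj [measurable (raw)]:
  "f \<in> borel_measurable M \<Longrightarrow> (\<lambda>x. cnj (f x)) \<in> borel_measurable M"
  by (rule borel_measurable_continuous_on[OF _ , of cnj, unfolded o_def]) (auto intro: continuous_intros)

lemma L2D: 
  assumes "f \<in> L2 M"
  shows L2_measurable: "f \<in> borel_measurable M" and L2_integrable_sq: "integrable M (\<lambda>x. (cmod (f x))\<^sup>2)"
  using assms by (auto simp: L2_def)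

lemma L2_integrable_mult:
  assumes "f \<in> L2 M" "g \<in> L2 M"
  shows "integrable M (\<lambda>x. f x * cnj (g x))"
proof (rule Bochner_Integration.integrable_bound)
  show "integrable M (\<lambda>x. (cmod (f x))\<^sup>2 + (cmod (g x))\<^sup>2)"
    using assms by (auto dest: L2_integrable_sq)
  show "(\<lambda>x. f x * cnj (g x)) \<in> borel_measurable M"
    using assms[THEN L2_measurable] by measurable
  have "cmod (f x * cnj (g x)) \<le> (cmod (f x))\<^sup>2 + (cmod (g x))\<^sup>2" for x
  proof -
    have "0 \<le> cmod (f x) * cmod (g x)" by simp
    thus ?thesis using sum_squares_bound[of "cmod (f x)" "cmod (g x)"]
      unfolding norm_mult complex_mod_cnj by linarith
  qed
  thus "AE x in M. cmod (f x * cnj (g x)) \<le> norm ((cmod (f x))\<^sup>2 + (cmod (g x))\<^sup>2)" by simp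
qed

lemma L2_scale: "f \<in> L2 M \<Longrightarrow> (\<lambda>x. c * f x) \<in> L2 M"
  by (auto simp: L2_def norm_mult power_mult_distrib)

lemma L2_add:
  assumes "f \<in> L2 M" "g \<in> L2 M"
  shows "(\<lambda>x. f x + g x) \<in> L2 M"
proof -
  have m[measurable]: "f \<in> borel_measurable M" "g \<in> borel_measurable M"
    using assms by (auto dest: L2_measurable)
  have "integrable M (\<lambda>x. (cmod (f x + g x))\<^sup>2)"
  proof (rule Bochner_Integration.integrable_bound)
    show "integrable M (\<lambda>x. 2 * (cmod (f x))\<^sup>2 + 2 * (cmod (g x))\<^sup>2)"
      using assms by (intro Bochner_Integration.integrable_add integrable_mult_right) (auto dest: L2_integrable_sq)
    have "(cmod (f x + g x))\<^sup>2 \<le> 2 * (cmod (f x))\<^sup>2 + 2 * (cmod (g x))\<^sup>2" for x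
    proof -
      have "(cmod (f x + g x))\<^sup>2 \<le> (cmod (f x) + cmod (g x))\<^sup>2"
        by (intro power_mono norm_triangle_ineq) auto
      also have "\<dots> \<le> 2 * (cmod (f x))\<^sup>2 + 2 * (cmod (g x))\<^sup>2"
        using sum_squares_bound[of "cmod (f x)" "cmod (g x)"] by (simp add: power2_sum)
      finally show ?thesis .
    qed
    thus "AE x in M. norm ((cmod (f x + g x))\<^sup>2) \<le> norm (2 * (cmod (f x))\<^sup>2 + 2 * (cmod (g x))\<^sup>2)"
      by simp
  qed measurable
  thus ?thesis by (auto simp: L2_def)
qed

lemma L2_diff:
  assumes "f \<in> L2 M" "g \<in> L2 M"
  shows "(\<lambda>x. f x - g x) \<in> L2 M"
  using L2_add[OF assms(1) L2_scale[OF assms(2), of "-1"]] by simp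

lemma L2_zero: "(\<lambda>x. 0) \<in> L2 M" by (auto simp: L2_def)

lemma L2_sum: "(\<And>i. i \<in> I \<Longrightarrow> f i \<in> L2 M) \<Longrightarrow> (\<lambda>x. \<Sum>i\<in>I. f i x) \<in> L2 M"
  by (induction I rule: infinite_finite_induct) (auto simp: L2_zero L2_add)

lemma L2_inner_add_left:
  assumes "f \<in> L2 M" "g \<in> L2 M" "h \<in> L2 M"
  shows "L2_inner M (\<lambda>x. f x + g x) h = L2_inner M f h + L2_inner M g h"
  unfolding L2_inner_def
  using L2_integrable_mult[OF assms(1,3)] L2_integrable_mult[OF assms(2,3)]
  by (simp add: algebra_simps)

lemma L2_inner_scale_left: "L2_inner M (\<lambda>x. c * f x) h = c * L2_inner M f h"
  unfolding L2_inner_def by (simp add: mult.assoc)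

lemma L2_inner_diff_left:
  assumes "f \<in> L2 M" "g \<in> L2 M" "h \<in> L2 M"
  shows "L2_inner M (\<lambda>x. f x - g x) h = L2_inner M f h - L2_inner M g h"
  unfolding L2_inner_def
  using L2_integrable_mult[OF assms(1,3)] L2_integrable_mult[OF assms(2,3)]
  by (simp add: algebra_simps)

lemma L2_inner_cnj: "L2_inner M g f = cnj (L2_inner M f g)"
  unfolding L2_inner_def by (subst Bochner_Integration.integral_cnj[symmetric]) (simp add: mult.commute)

lemma L2_inner_diff_right:
  assumes "f \<in> L2 M" "g \<in> L2 M" "h \<in> L2 M"
  shows "L2_inner M h (\<lambda>x. f x - g x) = L2_inner M h f - L2_inner M h g"
  by (subst (1 2 3) L2_inner_cnj) (simp add: L2_inner_diff_left assms)

lemma L2_inner_scale_right: "L2_inner M h (\<lambda>x. c * f x) = cnj c * L2_inner M h f"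
  by (subst (1 2) L2_inner_cnj) (simp add: L2_inner_scale_left)

lemma L2_inner_sum_left:
  assumes "\<And>i. i \<in> I \<Longrightarrow> f i \<in> L2 M" "h \<in> L2 M"
  shows "L2_inner M (\<lambda>x. \<Sum>i\<in>I. f i x) h = (\<Sum>i\<in>I. L2_inner M (f i) h)"
  using assms(1)
proof (induction I rule: infinite_finite_induct)
  case (insert i I)
  thus ?case by (simp add: L2_inner_add_left L2_sum assms(2))
qed (auto simp: L2_inner_def)

lemma L2_inner_sum_right:
  assumes "\<And>i. i \<in> I \<Longrightarrow> f i \<in> L2 M" "h \<in> L2 M"
  shows "L2_inner M h (\<lambda>x. \<Sum>i\<in>I. f i x) = (\<Sum>i\<in>I. L2_inner M h (f i))"
  by (subst (1 2) L2_inner_cnj) (simp add: L2_inner_sum_left assms)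

lemma L2_norm_nonneg [simp]: "0 \<le> L2_norm M f"
  by (simp add: L2_norm_def)

lemma L2_norm_sq: "(L2_norm M f)\<^sup>2 = (LINT x|M. (cmod (f x))\<^sup>2)"
  by (simp add: L2_norm_def)

lemma L2_inner_self: "L2_inner M f f = of_real ((L2_norm M f)\<^sup>2)"
  unfolding L2_inner_def L2_norm_sq
  by (subst integral_complex_of_real[symmetric]) (simp add: complex_norm_square del: of_real_power)

lemma L2_norm_eq_0_iff:
  assumes "f \<in> L2 M"
  shows "L2_norm M f = 0 \<longleftrightarrow> (AE x in M. f x = 0)"
  unfolding L2_norm_def using L2_integrable_sq[OF assms]
  by (simp add: integral_nonneg_eq_0_iff_AE)

lemma L2_norm_scale: "L2_norm M (\<lambda>x. c * f x) = cmod c * L2_norm M f"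
  by (simp add: L2_norm_def norm_mult power_mult_distrib real_sqrt_mult)

lemma L2_norm_diff_sq:
  assumes "f \<in> L2 M" "g \<in> L2 M"
  shows "(L2_norm M (\<lambda>x. f x - g x))\<^sup>2 = (L2_norm M f)\<^sup>2 - 2 * Re (L2_inner M f g) + (L2_norm M g)\<^sup>2"
proof -
  have "complex_of_real ((L2_norm M (\<lambda>x. f x - g x))\<^sup>2) 
      = L2_inner M (\<lambda>x. f x - g x) (\<lambda>x. f x - g x)"
    by (simp only: L2_inner_self)
  also have "\<dots> = L2_inner M f f - L2_inner M f g - (L2_inner M g f - L2_inner M g g)"
    using assms by (simp add: L2_inner_diff_left L2_inner_diff_right L2_diff)
  also have "\<dots> = of_real ((L2_norm M f)\<^sup>2) - (L2_inner M f g + cnj (L2_inner M f g)) + of_real ((L2_norm M g)\<^sup>2)"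
    by (subst (3) L2_inner_cnj) (simp add: L2_inner_self)
  also have "\<dots> = of_real ((L2_norm M f)\<^sup>2 - 2 * Re (L2_inner M f g) + (L2_norm M g)\<^sup>2)"
    by (simp add: complex_add_cnj)
  finally show ?thesis by (simp only: of_real_eq_iff)
qed

lemma L2_norm_add_sq:
  assumes "f \<in> L2 M" "g \<in> L2 M"
  shows "(L2_norm M (\<lambda>x. f x + g x))\<^sup>2 = (L2_norm M f)\<^sup>2 + 2 * Re (L2_inner M f g) + (L2_norm M g)\<^sup>2"
  using L2_norm_diff_sq[OF assms(1) L2_scale[OF assms(2), of "-1"]] 
    L2_norm_scale[of M "-1" g] L2_inner_scale_right[of M f "-1" g] by simp

lemma L2_inner_AE_zero: "AE x in M. f x = 0 \<Longrightarrow> L2_inner M f g = 0"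
  unfolding L2_inner_def by (rule integral_eq_zero_AE) auto

text \<open>With a = \<open>\<parallel>f\<parallel>\<^sup>2\<close> and c the inner product of
  \<open>g\<close> with \<open>f\<close>, the squared norm of a g - c f equals a times a
  \<open>\<parallel>g\<parallel>\<^sup>2\<close> - \<open>\<bar>c\<bar>\<^sup>2\<close>, so
  nonnegativity is the claim without any division.\<close>

lemma L2_Cauchy_Schwarz:
  assumes f: "f \<in> L2 M" and g: "g \<in> L2 M"
  shows "cmod (L2_inner M f g) \<le> L2_norm M f * L2_norm M g"
proof (cases "L2_norm M f = 0")
  case True
  thus ?thesis using f by (simp add: L2_norm_eq_0_iff L2_inner_AE_zero)
next
  case False
  define a where "a = (L2_norm M f)\<^sup>2"
  define c where "c = L2_inner M g f"
  have a: "a > 0" using False by (simp add: a_def)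
  have "0 \<le> (L2_norm M (\<lambda>x. of_real a * g x - c * f x))\<^sup>2" by simp
  also have "\<dots> = a\<^sup>2 * (L2_norm M g)\<^sup>2 - a * (cmod c)\<^sup>2"
  proof -
    have "Re (of_real a * (cnj c * c)) = a * (cmod c)\<^sup>2"
      by (subst mult.commute[of "cnj c"], subst complex_norm_square[symmetric])
        (simp del: of_real_power)
    thus ?thesis using f g a
      by (subst L2_norm_diff_sq) 
        (auto simp: L2_scale L2_norm_scale L2_inner_scale_left L2_inner_scale_right power_mult_distrib a_def[symmetric] c_def[symmetric] algebra_simps)
  qed
  finally have "a * (cmod c)\<^sup>2 \<le> a * (a * (L2_norm M g)\<^sup>2)" by (simp add: power2_eq_square mult_ac)
  hence "(cmod c)\<^sup>2 \<le> a * (L2_norm M g)\<^sup>2" using a by (metis mult_le_cancel_left_pos)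
  hence "(cmod c)\<^sup>2 \<le> (L2_norm M f * L2_norm M g)\<^sup>2" by (simp add: a_def power_mult_distrib)
  hence "cmod c \<le> L2_norm M f * L2_norm M g" by (rule power2_le_imp_le) simp
  thus ?thesis unfolding c_def by (subst L2_inner_cnj) simp
qed

lemma L2_norm_triangle:
  assumes f: "f \<in> L2 M" and g: "g \<in> L2 M"
  shows "L2_norm M (\<lambda>x. f x + g x) \<le> L2_norm M f + L2_norm M g"
proof (rule power2_le_imp_le)
  have "Re (L2_inner M f g) \<le> L2_norm M f * L2_norm M g"
    using L2_Cauchy_Schwarz[OF f g] complex_Re_le_cmod[of "L2_inner M f g"] by linarith
  thus "(L2_norm M (\<lambda>x. f x + g x))\<^sup>2 \<le> (L2_norm M f + L2_norm M g)\<^sup>2"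
    by (simp add: L2_norm_add_sq f g power2_sum)
qed simp

lemma L2_norm_diff_commute: "L2_norm M (\<lambda>x. f x - g x) = L2_norm M (\<lambda>x. g x - f x)"
  by (simp add: L2_norm_def norm_minus_commute)

lemma L2_norm_cong_AE:
  assumes "f \<in> L2 M" "g \<in> L2 M" "AE x in M. f x = g x"
  shows "L2_norm M f = L2_norm M g"
  unfolding L2_norm_def using assms
  by (intro arg_cong[where f=sqrt] integral_cong_AE) (auto dest: L2_measurable L2_integrable_sq)

lemma L2_inner_cong_AE:
  assumes "f \<in> L2 M" "g \<in> L2 M" "h \<in> L2 M" "AE x in M. f x = g x"
  shows "L2_inner M f h = L2_inner M g h"
  unfolding L2_inner_def using assms
  by (intro integral_cong_AE) (auto dest: L2_measurable[THEN measurable_sets] L2_integrable_mult)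

lemma L2_AE_eqI:
  assumes "f \<in> L2 M" "g \<in> L2 M" "L2_norm M (\<lambda>x. f x - g x) = 0"
  shows "AE x in M. f x = g x"
  using assms L2_norm_eq_0_iff[OF L2_diff[OF assms(1,2)]] by simp

lemma L2_AE_eqI_inner:
  assumes "f \<in> L2 M" "g \<in> L2 M" "\<And>h. h \<in> L2 M \<Longrightarrow> L2_inner M f h = L2_inner M g h"
  shows "AE x in M. f x = g x"
proof (rule L2_AE_eqI[OF assms(1,2)])
  have "complex_of_real ((L2_norm M (\<lambda>x. f x - g x))\<^sup>2) = 0"
    using assms by (simp only: L2_inner_self[symmetric]) (simp add: L2_inner_diff_left L2_diff)
  thus "L2_norm M (\<lambda>x. f x - g x) = 0" by simp
qed

section \<open>Convergence, completeness and representation of functionals in L2\<close>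

definition L2_tendsto :: "'a measure \<Rightarrow> (nat \<Rightarrow> 'a \<Rightarrow> complex) \<Rightarrow> ('a \<Rightarrow> complex) \<Rightarrow> bool" where
  "L2_tendsto M F f \<longleftrightarrow> f \<in> L2 M \<and> (\<lambda>n. L2_norm M (\<lambda>x. F n x - f x)) \<longlonglongrightarrow> 0"

lemma L2_norm_triangle_diff:
  assumes "f \<in> L2 M" "g \<in> L2 M" "h \<in> L2 M"
  shows "L2_norm M (\<lambda>x. f x - h x) \<le> L2_norm M (\<lambda>x. f x - g x) + L2_norm M (\<lambda>x. g x - h x)"
  using L2_norm_triangle[OF L2_diff[OF assms(1,2)] L2_diff[OF assms(2,3)]] by simp

lemma L2_tendsto_unique:
  assumes "L2_tendsto M F f" "L2_tendsto M F g" "\<And>n. F n \<in> L2 M"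
  shows "AE x in M. f x = g x"
proof (rule L2_AE_eqI)
  show fg: "f \<in> L2 M" "g \<in> L2 M" using assms by (auto simp: L2_tendsto_def)
  have "(\<lambda>n. L2_norm M (\<lambda>x. f x - F n x) + L2_norm M (\<lambda>x. F n x - g x)) \<longlonglongrightarrow> 0 + 0"
    using assms by (intro tendsto_add) (auto simp: L2_tendsto_def L2_norm_diff_commute[of M f])
  hence "L2_norm M (\<lambda>x. f x - g x) \<le> 0"
    by (intro LIMSEQ_le_const[of _ 0]) (auto intro!: exI[of _ 0] L2_norm_triangle_diff fg assms)
  thus "L2_norm M (\<lambda>x. f x - g x) = 0" using L2_norm_nonneg[of M "\<lambda>x. f x - g x"] by linarith
qed

lemma L2_tendsto_inner:
  assumes "L2_tendsto M F f" "\<And>n. F n \<in> L2 M" "h \<in> L2 M"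
  shows "(\<lambda>n. L2_inner M (F n) h) \<longlonglongrightarrow> L2_inner M f h"
proof -
  have f: "f \<in> L2 M" using assms by (auto simp: L2_tendsto_def)
  have "(\<lambda>n. L2_inner M (F n) h - L2_inner M f h) \<longlonglongrightarrow> 0"
  proof (rule Lim_null_comparison[where g = "\<lambda>n. L2_norm M (\<lambda>x. F n x - f x) * L2_norm M h"])
    show "\<forall>\<^sub>F n in sequentially. norm (L2_inner M (F n) h - L2_inner M f h) \<le> L2_norm M (\<lambda>x. F n x - f x) * L2_norm M h"
      using L2_Cauchy_Schwarz[OF L2_diff[OF assms(2) f] assms(3)]
      by (auto simp: L2_inner_diff_left assms f)
    show "(\<lambda>n. L2_norm M (\<lambda>x. F n x - f x) * L2_norm M h) \<longlonglongrightarrow> 0"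
      using assms(1) by (auto simp: L2_tendsto_def intro: tendsto_mult_left_zero)
  qed
  thus ?thesis by (simp add: LIM_zero_iff)
qed

lemma L2_tendsto_norm_le:
  assumes "L2_tendsto M F f" "\<And>n. F n \<in> L2 M" "\<And>n. L2_norm M (F n) \<le> B"
  shows "L2_norm M f \<le> B"
proof -
  have f: "f \<in> L2 M" using assms by (auto simp: L2_tendsto_def)
  have "L2_norm M f \<le> B + L2_norm M (\<lambda>x. F n x - f x)" for n
    using L2_norm_triangle[OF assms(2)[of n] L2_diff[OF f assms(2)[of n]]] assms(3)[of n]
    by (simp add: L2_norm_diff_commute[of M f])
  moreover have "(\<lambda>n. B + L2_norm M (\<lambda>x. F n x - f x)) \<longlonglongrightarrow> B + 0"
    using assms by (intro tendsto_add) (auto simp: L2_tendsto_def)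
  ultimately show ?thesis by (intro LIMSEQ_le_const[of _ B]) auto
qed

lemma (in finite_measure) L2_integrable:
  assumes "f \<in> L2 M"
  shows "integrable M f"
proof (rule Bochner_Integration.integrable_bound)
  show "integrable M (\<lambda>x. 1 + (cmod (f x))\<^sup>2)"
    using assms by (auto dest: L2_integrable_sq)
  have "cmod (f x) \<le> 1 + (cmod (f x))\<^sup>2" for x
    using sum_squares_bound[of 1 "cmod (f x)"] norm_ge_zero[of "f x"] by (simp, linarith)
  thus "AE x in M. cmod (f x) \<le> norm (1 + (cmod (f x))\<^sup>2)" by simp
qed (use assms in \<open>auto dest: L2_measurable\<close>)

lemma (in finite_measure) L2_bounded:
  assumes "f \<in> borel_measurable M" "\<And>x. x \<in> space M \<Longrightarrow> cmod (f x) \<le> B"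
  shows "f \<in> L2 M"
proof -
  have "integrable M (\<lambda>x. (cmod (f x))\<^sup>2)"
  proof (rule integrable_const_bound[where B = "B\<^sup>2"])
    show "AE x in M. norm ((cmod (f x))\<^sup>2) \<le> B\<^sup>2"
      using assms(2) by (intro AE_I2) (auto intro!: power_mono)
  qed (use assms(1) in measurable)
  thus ?thesis using assms(1) by (simp add: L2_def)
qed

lemma (in prob_space) L1_le_L2_norm:
  assumes "f \<in> L2 M"
  shows "(LINT x|M. cmod (f x)) \<le> L2_norm M f"
proof -
  have [measurable]: "f \<in> borel_measurable M" using assms by (rule L2_measurable)
  have *: "(\<lambda>x. complex_of_real (cmod (f x))) \<in> L2 M"
    using assms by (auto simp: L2_def)
  have 1: "(\<lambda>x. 1) \<in> L2 M" by (intro L2_bounded[of _ 1]) auto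
  have "cmod (L2_inner M (\<lambda>x. complex_of_real (cmod (f x))) (\<lambda>x. 1)) 
      \<le> L2_norm M (\<lambda>x. complex_of_real (cmod (f x))) * L2_norm M (\<lambda>x. 1)"
    by (rule L2_Cauchy_Schwarz[OF * 1])
  moreover have "L2_inner M (\<lambda>x. complex_of_real (cmod (f x))) (\<lambda>x. 1) = of_real (LINT x|M. cmod (f x))"
    by (simp add: L2_inner_def)
  ultimately show ?thesis by (simp add: L2_norm_def prob_space)
qed

text \<open>Riesz-Fischer. Along a subsequence with successive distances below
  \<open>(1/2)^k\<close> the increments are summable in L1, which the L2 norm dominates on a
  probability space; hence the subsequence converges almost everywhere, and Fatou's lemma turns the
  pointwise limit into an L2 limit of the whole sequence.\<close>

lemma (in prob_space) L2_complete:
  assumes F: "\<And>n. F n \<in> L2 M"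
    and Cauchy: "\<And>e. e > 0 \<Longrightarrow> \<exists>N. \<forall>m\<ge>N. \<forall>n\<ge>N. L2_norm M (\<lambda>x. F m x - F n x) < e"
  shows "\<exists>f. L2_tendsto M F f"
proof -
  have [measurable]: "F n \<in> borel_measurable M" for n using F by (rule L2_measurable)
  have "\<exists>N. \<forall>k. \<forall>m\<ge>N k. \<forall>n\<ge>N k. L2_norm M (\<lambda>x. F m x - F n x) < (1/2)^k"
    using Cauchy by (intro choice allI) auto
  then obtain N where N: "\<And>k m n. m \<ge> N k \<Longrightarrow> n \<ge> N k \<Longrightarrow> L2_norm M (\<lambda>x. F m x - F n x) < (1/2)^k"
    by auto
  \<comment> \<open>Summing the thresholds makes \<open>r\<close> monotone while keeping
    \<open>r k\<close> above \<open>N k\<close>.\<close>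
  define r where "r = (\<lambda>k. \<Sum>i\<le>k. N i)"
  have rN: "r k \<ge> N k" for k unfolding r_def by (rule member_le_sum) auto
  have rmono: "r (Suc k) \<ge> r k" for k by (simp add: r_def)
  have rN': "r (Suc k) \<ge> N k" for k using rN[of k] rmono[of k] by linarith
  define h where "h = (\<lambda>k x. cmod (F (r (Suc k)) x - F (r k) x))"
  have h_meas[measurable]: "h k \<in> borel_measurable M" for k unfolding h_def by measurable
  have h_int: "integrable M (h k)" for k
    unfolding h_def by (intro integrable_norm L2_integrable L2_diff F)
  have h_le: "(LINT x|M. h k x) \<le> (1/2)^k" for k
    unfolding h_def using L1_le_L2_norm[OF L2_diff[OF F F], of "r (Suc k)" "r k"] N[OF rN' rN, of k] by linarith
  have "(\<integral>\<^sup>+x. (\<Sum>k. ennreal (h k x)) \<partial>M) = (\<Sum>k. \<integral>\<^sup>+x. ennreal (h k x) \<partial>M)"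
    by (rule nn_integral_suminf) measurable
  also have "\<dots> = (\<Sum>k. ennreal (LINT x|M. h k x))"
    by (intro suminf_cong nn_integral_eq_integral h_int) (auto simp: h_def)
  also have "\<dots> \<le> (\<Sum>k. ennreal ((1/2)^k))"
    by (intro suminf_le ennreal_leI h_le) auto
  also have "\<dots> = ennreal (\<Sum>k. (1/2)^k)" 
    by (rule suminf_ennreal2) (auto intro: summable_geometric)
  also have "\<dots> < \<infinity>" by simp
  finally have "AE x in M. (\<Sum>k. ennreal (h k x)) \<noteq> \<infinity>"
    by (intro nn_integral_noteq_infinite) auto
  hence AE_conv: "AE x in M. convergent (\<lambda>k. F (r k) x)"
  proof eventually_elim
    case (elim x)
    hence "summable (\<lambda>k. h k x)"
      by (intro summable_suminf_not_top) (auto simp: h_def)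
    hence "summable (\<lambda>k. F (r (Suc k)) x - F (r k) x)"
      unfolding h_def by (rule summable_norm_cancel)
    hence "convergent (\<lambda>n. \<Sum>k<n. F (r (Suc k)) x - F (r k) x)"
      by (simp add: summable_iff_convergent)
    hence "convergent (\<lambda>n. F (r n) x - F (r 0) x)" 
      using sum_lessThan_telescope[of "\<lambda>k. F (r k) x"] by simp
    from convergent_add[OF this convergent_const[of "F (r 0) x"]] show ?case by simp
  qed
  define f where "f = (\<lambda>x. lim (\<lambda>k. F (r k) x))"
  have f_meas[measurable]: "f \<in> borel_measurable M" unfolding f_def by measurable
  have AE_lim: "AE x in M. (\<lambda>k. F (r k) x) \<longlonglongrightarrow> f x"
    using AE_conv unfolding f_def by (simp add: convergent_LIMSEQ_iff)
  have nn_norm: "(\<integral>\<^sup>+x. ennreal ((cmod (g x))\<^sup>2) \<partial>M) = ennreal ((L2_norm M g)\<^sup>2)" if "g \<in> L2 M" for g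
    unfolding L2_norm_sq using that by (intro nn_integral_eq_integral) (auto dest: L2_integrable_sq)
  have bound: "(\<integral>\<^sup>+x. ennreal ((cmod (F n x - f x))\<^sup>2) \<partial>M) \<le> ennreal (((1/2)^k)\<^sup>2)" if "n \<ge> N k" for n k
  proof -
    have "(\<integral>\<^sup>+x. ennreal ((cmod (F n x - f x))\<^sup>2) \<partial>M)
        = (\<integral>\<^sup>+x. liminf (\<lambda>j. ennreal ((cmod (F n x - F (r j) x))\<^sup>2)) \<partial>M)"
    proof (rule nn_integral_cong_AE, use AE_lim in eventually_elim)
      case (elim x)
      hence "(\<lambda>j. (cmod (F n x - F (r j) x))\<^sup>2) \<longlonglongrightarrow> (cmod (F n x - f x))\<^sup>2"
        by (intro tendsto_intros)
      hence "(\<lambda>j. ennreal ((cmod (F n x - F (r j) x))\<^sup>2)) \<longlonglongrightarrow> ennreal ((cmod (F n x - f x))\<^sup>2)"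
        by (rule tendsto_ennrealI)
      thus ?case by (rule lim_imp_Liminf[OF trivial_limit_sequentially, symmetric])
    qed
    also have "\<dots> \<le> liminf (\<lambda>j. \<integral>\<^sup>+x. ennreal ((cmod (F n x - F (r j) x))\<^sup>2) \<partial>M)"
      by (rule nn_integral_liminf) measurable
    also have "\<dots> \<le> liminf (\<lambda>j. ennreal (((1/2)^k)\<^sup>2))"
    proof (rule Liminf_mono, rule eventually_sequentiallyI[of k])
      fix j assume "k \<le> j"
      hence "r k \<le> r j" by (rule lift_Suc_mono_le[of r, OF rmono])
      hence "N k \<le> r j" using rN[of k] by linarith
      hence "L2_norm M (\<lambda>x. F n x - F (r j) x) \<le> (1/2)^k" using N[OF that] by (simp add: less_imp_le)
      thus "(\<integral>\<^sup>+x. ennreal ((cmod (F n x - F (r j) x))\<^sup>2) \<partial>M) \<le> ennreal (((1/2)^k)\<^sup>2)"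
        unfolding nn_norm[OF L2_diff[OF F F]] by (intro ennreal_leI power_mono) auto
    qed
    also have "\<dots> = ennreal (((1/2)^k)\<^sup>2)" by (simp add: Liminf_const)
    finally show ?thesis .
  qed
  have diff: "(\<lambda>x. F n x - f x) \<in> L2 M" if "n \<ge> N k" for n k
  proof -
    have "integrable M (\<lambda>x. (cmod (F n x - f x))\<^sup>2)"
      using le_less_trans[OF bound[OF that] ennreal_less_top] by (intro integrableI_nonneg) auto
    thus ?thesis by (simp add: L2_def)
  qed
  have f: "f \<in> L2 M" using L2_diff[OF F[of "N 0"] diff[of 0 "N 0"]] by simp
  have "(\<lambda>n. L2_norm M (\<lambda>x. F n x - f x)) \<longlonglongrightarrow> 0"
  proof (rule LIMSEQ_I)
    fix e :: real assume "e > 0"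
    then obtain k where k: "(1/2)^k < e" using real_arch_pow_inv[of e "1/2"] by auto
    show "\<exists>no. \<forall>n\<ge>no. norm (L2_norm M (\<lambda>x. F n x - f x) - 0) < e"
    proof (intro exI allI impI)
      fix n assume n: "n \<ge> N k"
      have "ennreal ((L2_norm M (\<lambda>x. F n x - f x))\<^sup>2) \<le> ennreal (((1/2)^k)\<^sup>2)"
        using bound[OF n] nn_norm[OF diff[OF n]] by simp
      hence "(L2_norm M (\<lambda>x. F n x - f x))\<^sup>2 \<le> ((1/2)^k)\<^sup>2" by (subst (asm) ennreal_le_iff) auto
      hence "L2_norm M (\<lambda>x. F n x - f x) \<le> (1/2)^k" by (rule power2_le_imp_le) simp
      thus "norm (L2_norm M (\<lambda>x. F n x - f x) - 0) < e" using k by simp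
    qed
  qed
  thus ?thesis using f by (auto simp: L2_tendsto_def)
qed

text \<open>The representing vector minimizes \<open>\<parallel>f\<parallel>\<^sup>2 - 2 Re (\<phi> f)\<close>.\<close>

lemma (in prob_space) L2_Riesz:
  fixes \<phi> :: "('a \<Rightarrow> complex) \<Rightarrow> complex"
  assumes add: "\<And>f g. f \<in> L2 M \<Longrightarrow> g \<in> L2 M \<Longrightarrow> \<phi> (\<lambda>x. f x + g x) = \<phi> f + \<phi> g"
    and scale: "\<And>c f. f \<in> L2 M \<Longrightarrow> \<phi> (\<lambda>x. c * f x) = c * \<phi> f"
    and bounded: "\<And>f. f \<in> L2 M \<Longrightarrow> cmod (\<phi> f) \<le> C * L2_norm M f"
  shows "\<exists>h\<in>L2 M. \<forall>f\<in>L2 M. \<phi> f = L2_inner M f h"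
proof -
  define J where "J = (\<lambda>f. (L2_norm M f)\<^sup>2 - 2 * Re (\<phi> f))"
  define m where "m = Inf (J ` L2 M)"
  have J_ge: "J f \<ge> - C\<^sup>2" if "f \<in> L2 M" for f
  proof -
    have "Re (\<phi> f) \<le> C * L2_norm M f" using bounded[OF that] complex_Re_le_cmod[of "\<phi> f"] by linarith
    moreover have "0 \<le> (L2_norm M f - C)\<^sup>2" by simp
    ultimately show ?thesis by (simp add: J_def power2_diff mult.commute)
  qed
  have bdd: "bdd_below (J ` L2 M)" using J_ge by (intro bdd_belowI[of _ "- C\<^sup>2"]) auto
  have m_le: "m \<le> J f" if "f \<in> L2 M" for f unfolding m_def using bdd that by (intro cInf_lower) auto
  have "\<exists>f\<in>L2 M. J f < m + 1 / real (Suc n)" for n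
  proof -
    have "Inf (J ` L2 M) < m + 1 / real (Suc n)" by (simp add: m_def)
    thus ?thesis using cInf_less_iff[of "J ` L2 M"] bdd L2_zero[of M] by (auto simp: image_iff)
  qed
  then obtain F where F: "\<And>n. F n \<in> L2 M" and JF: "\<And>n. J (F n) < m + 1 / real (Suc n)"
    by metis
  have scale_real: "Re (\<phi> (\<lambda>x. of_real a * f x)) = a * Re (\<phi> f)" if "f \<in> L2 M" for f a
    using scale[OF that, of "of_real a"] by simp
  \<comment> \<open>The parallelogram law: the midpoint of \<open>f\<close> and \<open>g\<close>
    also has \<open>J\<close> at least \<open>m\<close>, so two almost minimizers are close to each
    other. This makes a minimizing sequence Cauchy.\<close>
  have par: "(L2_norm M (\<lambda>x. f x - g x))\<^sup>2 \<le> 2 * (J f - m) + 2 * (J g - m)" if fg: "f \<in> L2 M" "g \<in> L2 M" for f g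
  proof -
    have "m \<le> J (\<lambda>x. of_real (1/2) * (f x + g x))" by (intro m_le L2_scale L2_add fg)
    also have "\<dots> = (L2_norm M (\<lambda>x. f x + g x))\<^sup>2 / 4 - (Re (\<phi> f) + Re (\<phi> g))"
      unfolding J_def scale_real[OF L2_add[OF fg]] L2_norm_scale add[OF fg]
      by (simp add: power_mult_distrib power2_eq_square) (simp add: field_simps)
    finally have "m \<le> ((L2_norm M f)\<^sup>2 + 2 * Re (L2_inner M f g) + (L2_norm M g)\<^sup>2) / 4 - (Re (\<phi> f) + Re (\<phi> g))"
      by (simp only: L2_norm_add_sq[OF fg])
    moreover have "a - 2 * i + b \<le> 2 * (a - 2 * p - c) + 2 * (b - 2 * q - c)"
      if "c \<le> (a + 2 * i + b) / 4 - (p + q)" for a b c i p q :: real using that by (simp add: field_simps)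
    ultimately show ?thesis unfolding L2_norm_diff_sq[OF fg] J_def by blast
  qed
  have "\<exists>h. L2_tendsto M F h"
  proof (rule L2_complete[OF F])
    fix e :: real assume e: "e > 0"
    then obtain N where N: "1 / real (Suc N) < e\<^sup>2 / 4"
      using reals_Archimedean[of "e\<^sup>2/4"] by (auto simp: inverse_eq_divide)
    show "\<exists>N. \<forall>m\<ge>N. \<forall>n\<ge>N. L2_norm M (\<lambda>x. F m x - F n x) < e"
    proof (intro exI allI impI)
      fix i j assume ij: "i \<ge> N" "j \<ge> N"
      have le: "1 / real (Suc k) \<le> 1 / real (Suc N)" if "k \<ge> N" for k using that by (simp add: frac_le)
      have "(L2_norm M (\<lambda>x. F i x - F j x))\<^sup>2 < e\<^sup>2"
      proof -
        have "J (F i) - m < 1 / real (Suc N)" "J (F j) - m < 1 / real (Suc N)"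
          using JF[of i] JF[of j] le[OF ij(1)] le[OF ij(2)] by simp_all
        hence "2 * (J (F i) - m) + 2 * (J (F j) - m) < e\<^sup>2" using N by simp
        thus ?thesis using par[OF F[of i] F[of j]] by (rule le_less_trans[rotated])
      qed
      thus "L2_norm M (\<lambda>x. F i x - F j x) < e" using e by (simp add: power2_less_imp_less)
    qed
  qed
  then obtain h where h: "L2_tendsto M F h" by blast
  have hL: "h \<in> L2 M" using h by (simp add: L2_tendsto_def)
  have "\<phi> v = L2_inner M v h" if v: "v \<in> L2 M" for v
  proof -
    define d where "d = L2_inner M v h - \<phi> v"
    \<comment> \<open>Moving from the minimizer in the direction \<open>v\<close> by
      \<open>c\<close> cannot decrease \<open>J\<close>; the inequality for \<open>F n\<close> has
      error \<open>1 / real (Suc n)\<close> and passes to the limit.\<close>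
    have key: "0 \<le> 2 * Re (c * d) + (cmod c)\<^sup>2 * (L2_norm M v)\<^sup>2" for c
    proof -
      have "- (1 / real (Suc n)) \<le> 2 * Re (c * (L2_inner M v (F n) - \<phi> v)) + (cmod c)\<^sup>2 * (L2_norm M v)\<^sup>2" for n
      proof -
        have cv: "(\<lambda>x. c * v x) \<in> L2 M" by (intro L2_scale v)
        have eq: "Re (L2_inner M (F n) (\<lambda>x. c * v x)) = Re (c * L2_inner M v (F n))"
          by (subst L2_inner_cnj) (simp add: L2_inner_scale_left)
        have "m \<le> J (\<lambda>x. F n x + c * v x)" by (intro m_le L2_add F cv)
        also have "\<dots> = J (F n) + 2 * Re (c * L2_inner M v (F n)) + (cmod c)\<^sup>2 * (L2_norm M v)\<^sup>2 - 2 * Re (c * \<phi> v)"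
          unfolding J_def L2_norm_add_sq[OF F cv] add[OF F cv] scale[OF v] L2_norm_scale eq
          by (simp add: power_mult_distrib)
        finally show ?thesis using JF[of n] by (simp add: right_diff_distrib)
      qed
      moreover have "(\<lambda>n. L2_inner M v (F n)) \<longlonglongrightarrow> L2_inner M v h"
        using tendsto_cnj[OF L2_tendsto_inner[OF h F v]] by (simp add: L2_inner_cnj[of M v, symmetric])
      hence "(\<lambda>n. 2 * Re (c * (L2_inner M v (F n) - \<phi> v)) + (cmod c)\<^sup>2 * (L2_norm M v)\<^sup>2)
          \<longlonglongrightarrow> 2 * Re (c * d) + (cmod c)\<^sup>2 * (L2_norm M v)\<^sup>2"
        unfolding d_def by (intro tendsto_intros)
      moreover have "(\<lambda>n. - (1 / real (Suc n))) \<longlonglongrightarrow> - 0"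
        by (intro tendsto_minus LIMSEQ_Suc[OF lim_1_over_n])
      ultimately have "- 0 \<le> 2 * Re (c * d) + (cmod c)\<^sup>2 * (L2_norm M v)\<^sup>2"
        by (intro LIMSEQ_le[of "\<lambda>n. - (1 / real (Suc n))" "- 0"]) auto
      thus ?thesis by simp
    qed
    define b where "b = (L2_norm M v)\<^sup>2"
    define a where "a = (cmod d)\<^sup>2"
    have "0 \<le> - 2 * s * a + s\<^sup>2 * a * b" for s :: real
    proof -
      have "Re (of_real (-s) * cnj d * d) = - s * a"
        unfolding a_def cmod_power2 by (simp add: power2_eq_square algebra_simps)
      thus ?thesis using key[of "of_real (-s) * cnj d"]
        by (simp add: norm_mult power_mult_distrib a_def b_def algebra_simps)
    qed
    note key2 = this[of "1 / (1 + b)"]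
    \<comment> \<open>The direction \<open>- s * cnj d\<close> makes the first order term negative.
      The choice of \<open>s\<close> gives \<open>s * b \<le> 1\<close>, so \<open>s * b - 2\<close>
      is at most -1 and \<open>a\<close> must vanish; the 1 in the denominator covers
      \<open>b = 0\<close>.\<close>
    define s where "s = 1 / (1 + b)"
    have ab: "a \<ge> 0" "b \<ge> 0" by (auto simp: a_def b_def)
    hence s: "s > 0" "s * b \<le> 1" by (auto simp: s_def)
    have "0 \<le> a * s * (s * b - 2)" using key2 by (simp add: s_def[symmetric] power2_eq_square algebra_simps)
    also have "\<dots> \<le> a * s * (- 1)" using ab s by (intro mult_left_mono) auto
    finally have "a * s \<le> 0" by simp
    hence "a = 0" using ab(1) s(1) by (simp add: mult_le_0_iff)
    thus ?thesis by (simp add: a_def d_def)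
  qed
  thus ?thesis using hL by blast
qed

section \<open>Bounded operators and orthogonal series\<close>

lemma L2_operatorsD:
  assumes "T \<in> L2_operators M"
  shows "f \<in> L2 M \<Longrightarrow> T f \<in> L2 M"
    and "f \<in> L2 M \<Longrightarrow> g \<in> L2 M \<Longrightarrow> AE x in M. T (\<lambda>y. f y + g y) x = T f x + T g x"
    and "f \<in> L2 M \<Longrightarrow> AE x in M. T (\<lambda>y. c * f y) x = c * T f x"
    and "\<exists>C\<ge>0. \<forall>f\<in>L2 M. L2_norm M (T f) \<le> C * L2_norm M f"
proof -
  from assms obtain C where C: "\<forall>f\<in>L2 M. L2_norm M (T f) \<le> C * L2_norm M f"
    by (auto simp: L2_operators_def)
  have "C * L2_norm M f \<le> \<bar>C\<bar> * L2_norm M f" for f by (intro mult_right_mono) auto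
  hence "\<forall>f\<in>L2 M. L2_norm M (T f) \<le> \<bar>C\<bar> * L2_norm M f" using C by (meson order_trans)
  thus "\<exists>C\<ge>0. \<forall>f\<in>L2 M. L2_norm M (T f) \<le> C * L2_norm M f" by (intro exI[of _ "\<bar>C\<bar>"]) auto
qed (use assms in \<open>auto simp: L2_operators_def\<close>)

text \<open>Only the value of the adjoint at one vector is produced, which suffices to pull an
  operator out of a weak integral.\<close>

lemma (in prob_space) L2_adjoint:
  assumes T: "T \<in> L2_operators M" and \<eta>: "\<eta> \<in> L2 M"
  shows "\<exists>\<zeta>\<in>L2 M. \<forall>\<xi>\<in>L2 M. L2_inner M (T \<xi>) \<eta> = L2_inner M \<xi> \<zeta>"
proof -
  note D = L2_operatorsD[OF T]
  obtain C where C: "\<forall>f\<in>L2 M. L2_norm M (T f) \<le> C * L2_norm M f" using D(4) by blast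
  show ?thesis
  proof (rule L2_Riesz[where C = "C * L2_norm M \<eta>"])
    fix f g assume "f \<in> L2 M" "g \<in> L2 M"
    thus "L2_inner M (T (\<lambda>x. f x + g x)) \<eta> = L2_inner M (T f) \<eta> + L2_inner M (T g) \<eta>"
      by (subst L2_inner_add_left[symmetric]) (intro L2_inner_cong_AE D L2_add \<eta>; assumption)+
  next
    fix c f assume "f \<in> L2 M"
    thus "L2_inner M (T (\<lambda>x. c * f x)) \<eta> = c * L2_inner M (T f) \<eta>"
      by (subst L2_inner_scale_left[symmetric]) (intro L2_inner_cong_AE D L2_scale \<eta>; assumption)
  next
    fix f assume f: "f \<in> L2 M"
    have "cmod (L2_inner M (T f) \<eta>) \<le> L2_norm M (T f) * L2_norm M \<eta>"
      by (intro L2_Cauchy_Schwarz D f \<eta>)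
    also have "\<dots> \<le> C * L2_norm M f * L2_norm M \<eta>" using C f by (intro mult_right_mono) auto
    finally show "cmod (L2_inner M (T f) \<eta>) \<le> C * L2_norm M \<eta> * L2_norm M f" by (simp add: mult_ac)
  qed
qed

lemma L2_norm_sum_orthogonal:
  assumes F: "\<And>n. n \<in> I \<Longrightarrow> F n \<in> L2 M" and "finite I"
    and orth: "\<And>m n. m \<in> I \<Longrightarrow> n \<in> I \<Longrightarrow> m \<noteq> n \<Longrightarrow> L2_inner M (F m) (F n) = 0"
  shows "(L2_norm M (\<lambda>x. \<Sum>n\<in>I. F n x))\<^sup>2 = (\<Sum>n\<in>I. (L2_norm M (F n))\<^sup>2)"
  using assms(2) F orth
proof (induction I)
  case empty
  show ?case by (simp add: L2_norm_def)
next
  case (insert i I)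
  have "L2_inner M (F i) (\<lambda>x. \<Sum>n\<in>I. F n x) = 0"
    using insert by (subst L2_inner_sum_right) (auto intro!: sum.neutral)
  thus ?case using insert by (simp add: L2_norm_add_sq L2_sum)
qed

text \<open>By Pythagoras the tails of the series are tails of a convergent sum of squares. The
  absolute summability in the second claim is what later allows an Abel factor to be removed from
  the character expansion.\<close>

lemma (in prob_space) L2_orthogonal_series:
  assumes F: "\<And>n. F n \<in> L2 M"
    and orth: "\<And>m n. m \<noteq> n \<Longrightarrow> L2_inner M (F m) (F n) = 0"
    and bound: "\<And>N. (\<Sum>n<N. (L2_norm M (F n))\<^sup>2) \<le> B\<^sup>2" and B: "B \<ge> 0"
  shows "\<exists>f. L2_tendsto M (\<lambda>N x. \<Sum>n<N. F n x) f"
    and "h \<in> L2 M \<Longrightarrow> summable (\<lambda>n. cmod (L2_inner M (F n) h))"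
proof -
  have summ: "summable (\<lambda>n. (L2_norm M (F n))\<^sup>2)"
    by (intro bounded_imp_summable[where B = "B\<^sup>2"]) (use bound[of "Suc _"] in \<open>auto simp: lessThan_Suc_atMost\<close>)
  have *: "(L2_norm M (\<lambda>x. (\<Sum>k<n. F k x) - (\<Sum>k<m. F k x)))\<^sup>2 = (\<Sum>k\<in>{m..<n}. (L2_norm M (F k))\<^sup>2)" if "m \<le> n" for m n
  proof -
    have "(\<Sum>k<n. F k x) - (\<Sum>k<m. F k x) = (\<Sum>k\<in>{m..<n}. F k x)" for x
      using that by (simp add: sum_diff_nat_ivl atLeast0LessThan[symmetric])
    thus ?thesis by (simp add: L2_norm_sum_orthogonal F orth)
  qed
  show "\<exists>f. L2_tendsto M (\<lambda>N x. \<Sum>n<N. F n x) f"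
  proof (rule L2_complete)
    fix e :: real assume e: "e > 0"
    with summ obtain N where N: "\<And>m n. m \<ge> N \<Longrightarrow> norm (\<Sum>k\<in>{m..<n}. (L2_norm M (F k))\<^sup>2) < e\<^sup>2"
      by (auto simp: summable_Cauchy dest!: spec[of _ "e\<^sup>2"])
    have le: "L2_norm M (\<lambda>x. (\<Sum>k<n. F k x) - (\<Sum>k<m. F k x)) < e" if "N \<le> m" "m \<le> n" for m n
    proof -
      have "(L2_norm M (\<lambda>x. (\<Sum>k<n. F k x) - (\<Sum>k<m. F k x)))\<^sup>2 < e\<^sup>2"
        using N[OF that(1), of n] *[OF that(2)] by simp
      thus ?thesis using e by (simp add: power2_less_imp_less)
    qed
    show "\<exists>N. \<forall>m\<ge>N. \<forall>n\<ge>N. L2_norm M (\<lambda>x. (\<Sum>k<m. F k x) - (\<Sum>k<n. F k x)) < e"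
    proof (intro exI allI impI)
      fix m n assume "N \<le> m" "N \<le> n"
      thus "L2_norm M (\<lambda>x. (\<Sum>k<m. F k x) - (\<Sum>k<n. F k x)) < e"
        using le[of m n] le[of n m] by (cases "m \<le> n") (auto simp: L2_norm_diff_commute[of M "\<lambda>x. \<Sum>k<m. F k x"])
    qed
  qed (intro L2_sum F)
  assume h: "h \<in> L2 M"
  show "summable (\<lambda>n. cmod (L2_inner M (F n) h))"
  proof (rule summableI_nonneg_bounded[where x = "B * L2_norm M h"])
    fix N
    \<comment> \<open>The phases turn each inner product into its modulus. Multiplying the terms by
      numbers of modulus at most 1 preserves orthogonality and does not increase norms, so
      Cauchy-Schwarz bounds the sum of the moduli.\<close>
    define s where "s = (\<lambda>n. cnj (sgn (L2_inner M (F n) h)))"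
    have s: "cmod (s n) \<le> 1" for n by (simp add: s_def norm_sgn)
    have eq_nn: "cmod (complex_of_real (\<Sum>n<N. cmod (L2_inner M (F n) h))) = (\<Sum>n<N. cmod (L2_inner M (F n) h))"
      unfolding norm_of_real by (simp add: sum_nonneg)
    have "complex_of_real (\<Sum>n<N. cmod (L2_inner M (F n) h)) = L2_inner M (\<lambda>x. \<Sum>n<N. s n * F n x) h"
    proof -
      have "complex_of_real (cmod z) = cnj (sgn z) * z" for z
      proof (cases "z = 0")
        case False
        have "cnj (sgn z) * z = z * cnj z / cmod z" by (simp add: sgn_div_norm scaleR_conv_of_real field_simps)
        also have "\<dots> = cmod z" using False by (simp add: complex_norm_square[symmetric] power2_eq_square)
        finally show ?thesis by simp
      qed simp
      thus ?thesis by (simp add: L2_inner_sum_left L2_scale F h L2_inner_scale_left s_def)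
    qed
    hence "(\<Sum>n<N. cmod (L2_inner M (F n) h)) = cmod (L2_inner M (\<lambda>x. \<Sum>n<N. s n * F n x) h)"
      using eq_nn by simp
    also have "\<dots> \<le> L2_norm M (\<lambda>x. \<Sum>n<N. s n * F n x) * L2_norm M h"
      by (intro L2_Cauchy_Schwarz L2_sum L2_scale F h)
    also have "\<dots> \<le> B * L2_norm M h"
    proof (intro mult_right_mono power2_le_imp_le[OF _ B])
      have "(L2_norm M (\<lambda>x. \<Sum>n<N. s n * F n x))\<^sup>2 = (\<Sum>n<N. (L2_norm M (\<lambda>x. s n * F n x))\<^sup>2)"
        by (intro L2_norm_sum_orthogonal L2_scale F) (auto simp: L2_inner_scale_left L2_inner_scale_right orth)
      also have "\<dots> \<le> (\<Sum>n<N. (L2_norm M (F n))\<^sup>2)"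
        unfolding L2_norm_scale by (intro sum_mono power_mono mult_left_le_one_le s) auto
      finally show "(L2_norm M (\<lambda>x. \<Sum>n<N. s n * F n x))\<^sup>2 \<le> B\<^sup>2" using bound[of N] by linarith
    qed auto
    finally show "(\<Sum>n<N. cmod (L2_inner M (F n) h)) \<le> B * L2_norm M h" .
  qed auto
qed

section \<open>Convolution on a compact group\<close>

lemma L2_tendsto_cong:
  assumes "L2_tendsto M F f" "\<And>n. AE x in M. F n x = H n x" "\<And>n. F n \<in> L2 M" "\<And>n. H n \<in> L2 M"
  shows "L2_tendsto M H f"
proof -
  have f: "f \<in> L2 M" using assms(1) by (simp add: L2_tendsto_def)
  have "L2_norm M (\<lambda>x. H n x - f x) = L2_norm M (\<lambda>x. F n x - f x)" for n
    using assms(2)[of n] by (intro L2_norm_cong_AE L2_diff assms f) auto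
  thus ?thesis using assms(1) by (simp add: L2_tendsto_def)
qed

lemma L2_tendsto_add:
  assumes "L2_tendsto M F f" "L2_tendsto M H h" "\<And>n. F n \<in> L2 M" "\<And>n. H n \<in> L2 M"
  shows "L2_tendsto M (\<lambda>n x. F n x + H n x) (\<lambda>x. f x + h x)"
proof -
  have fh: "f \<in> L2 M" "h \<in> L2 M" using assms(1,2) by (auto simp: L2_tendsto_def)
  have le: "L2_norm M (\<lambda>x. F n x + H n x - (f x + h x)) 
      \<le> L2_norm M (\<lambda>x. F n x - f x) + L2_norm M (\<lambda>x. H n x - h x)" for n
    using L2_norm_triangle[OF L2_diff[OF assms(3)[of n] fh(1)] L2_diff[OF assms(4)[of n] fh(2)]]
    by (simp add: algebra_simps)
  have "(\<lambda>n. L2_norm M (\<lambda>x. F n x - f x) + L2_norm M (\<lambda>x. H n x - h x)) \<longlonglongrightarrow> 0"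
    by (rule tendsto_add_zero) (use assms(1,2) in \<open>auto simp: L2_tendsto_def\<close>)
  hence "(\<lambda>n. L2_norm M (\<lambda>x. F n x + H n x - (f x + h x))) \<longlonglongrightarrow> 0"
    by (rule Lim_null_comparison[OF always_eventually, rotated]) (use le in simp)
  thus ?thesis using fh by (simp add: L2_tendsto_def L2_add)
qed

lemma L2_tendsto_scale:
  assumes "L2_tendsto M F f"
  shows "L2_tendsto M (\<lambda>n x. c * F n x) (\<lambda>x. c * f x)"
proof -
  have "L2_norm M (\<lambda>x. c * F n x - c * f x) = cmod c * L2_norm M (\<lambda>x. F n x - f x)" for n
    by (subst L2_norm_scale[symmetric]) (simp add: algebra_simps)
  thus ?thesis using assms by (auto simp: L2_tendsto_def L2_scale intro: tendsto_mult_right_zero)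
qed

lemma L2_tendsto_operator:
  assumes F: "L2_tendsto M F f" "\<And>n. F n \<in> L2 M" and T: "T \<in> L2_operators M"
  shows "L2_tendsto M (\<lambda>n. T (F n)) (T f)"
proof -
  note D = L2_operatorsD[OF T]
  have f: "f \<in> L2 M" using F(1) by (simp add: L2_tendsto_def)
  obtain C where C: "C \<ge> 0" "\<forall>f\<in>L2 M. L2_norm M (T f) \<le> C * L2_norm M f" using D(4) by blast
  have le: "L2_norm M (\<lambda>x. T (F n) x - T f x) \<le> C * L2_norm M (\<lambda>x. F n x - f x)" for n
  proof -
    have d: "(\<lambda>x. F n x + (-1) * f x) \<in> L2 M" by (intro L2_add L2_scale F f)
    have "AE x in M. T (\<lambda>x. F n x + (-1) * f x) x = T (F n) x + T (\<lambda>x. (-1) * f x) x"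
      by (intro D F L2_scale f)
    moreover have "AE x in M. T (\<lambda>x. (-1) * f x) x = (-1) * T f x" by (intro D f)
    ultimately have "AE x in M. T (\<lambda>x. F n x + (-1) * f x) x = T (F n) x - T f x" by eventually_elim simp
    hence "L2_norm M (\<lambda>x. T (F n) x - T f x) = L2_norm M (T (\<lambda>x. F n x + (-1) * f x))"
      by (intro L2_norm_cong_AE L2_diff D F f d) auto
    also have "\<dots> \<le> C * L2_norm M (\<lambda>x. F n x + (-1) * f x)" using C d by blast
    finally show ?thesis by simp
  qed
  have "(\<lambda>n. C * L2_norm M (\<lambda>x. F n x - f x)) \<longlonglongrightarrow> 0"
    using F(1) by (auto simp: L2_tendsto_def intro: tendsto_mult_right_zero)
  hence "(\<lambda>n. L2_norm M (\<lambda>x. T (F n) x - T f x)) \<longlonglongrightarrow> 0"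
    by (rule Lim_null_comparison[OF always_eventually, rotated]) (use le in simp)
  thus ?thesis using D(1) f by (simp add: L2_tendsto_def)
qed

lemma (in prob_space) Fubini_bounded:
  fixes f :: "'a \<Rightarrow> 'a \<Rightarrow> 'b::{banach, second_countable_topology}"
  assumes [measurable]: "case_prod f \<in> borel_measurable (M \<Otimes>\<^sub>M M)"
    and bound: "\<And>x y. x \<in> space M \<Longrightarrow> y \<in> space M \<Longrightarrow> norm (f x y) \<le> B"
  shows "(LINT x|M. LINT y|M. f x y) = (LINT y|M. LINT x|M. f x y)"
proof -
  interpret P: pair_prob_space M M ..
  have "integrable (M \<Otimes>\<^sub>M M) (case_prod f)"
    using bound by (intro P.integrable_const_bound[where B = B]) (auto simp: space_pair_measure)
  thus ?thesis by (rule P.Fubini_integral[symmetric])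
qed

text \<open>Normalized Haar measure in purely measure theoretic form: measurability of the group
  operations takes the place of a topology, so the product of two instances is an instance again.
  Right and inversion invariance are consequences.\<close>

locale prob_haar = group G + prob_space M
  for G :: "('a, 'c) monoid_scheme" (structure) and M :: "'a measure" +
  assumes space_eq: "space M = carrier G"
    and mult_measurable: "(\<lambda>(x, y). x \<otimes> y) \<in> M \<Otimes>\<^sub>M M \<rightarrow>\<^sub>M M"
    and inv_measurable: "(\<lambda>x. inv x) \<in> M \<rightarrow>\<^sub>M M"
    and distr_left_mult: "\<And>g. g \<in> carrier G \<Longrightarrow> distr M M (\<lambda>x. g \<otimes> x) = M"
begin

lemma measurable_mult [measurable (raw)]:
  assumes "f \<in> N \<rightarrow>\<^sub>M M" "h \<in> N \<rightarrow>\<^sub>M M"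
  shows "(\<lambda>x. f x \<otimes> h x) \<in> N \<rightarrow>\<^sub>M M"
  using measurable_compose[OF measurable_Pair[OF assms] mult_measurable] by simp

lemma measurable_inv [measurable (raw)]:
  assumes "f \<in> N \<rightarrow>\<^sub>M M"
  shows "(\<lambda>x. inv f x) \<in> N \<rightarrow>\<^sub>M M"
  using measurable_compose[OF assms inv_measurable] .

lemma measurable_carrier [measurable]: "g \<in> carrier G \<Longrightarrow> (\<lambda>x. g) \<in> N \<rightarrow>\<^sub>M M"
  by (simp add: space_eq)

lemma nn_integral_left_mult:
  assumes [measurable]: "f \<in> borel_measurable M" "g \<in> carrier G"
  shows "(\<integral>\<^sup>+x. f (g \<otimes> x) \<partial>M) = (\<integral>\<^sup>+x. f x \<partial>M)"
  by (subst (2) distr_left_mult[OF assms(2), symmetric]) (simp add: nn_integral_distr)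

text \<open>Uniqueness of Haar measure and its invariance under inversion both come from evaluating
  the integral of \<open>1\<^sub>A (x\<^sup>-\<^sup>1 y)\<close> in the two possible orders.\<close>

lemma distr_inv_eq:
  assumes N: "prob_haar G N" and sets: "sets N = sets M"
  shows "distr M M (\<lambda>x. inv x) = N"
proof (rule measure_eqI)
  interpret N: prob_haar G N by fact
  interpret P: pair_prob_space M N ..
  note [measurable_cong] = sets
  fix A assume "A \<in> sets (distr M M (\<lambda>x. inv x))"
  hence A[measurable]: "A \<in> sets M" by simp
  have meas: "(\<lambda>(x, y). indicator A (inv x \<otimes> y) :: ennreal) \<in> borel_measurable (M \<Otimes>\<^sub>M N)" by measurable
  have "emeasure N A = (\<integral>\<^sup>+x. \<integral>\<^sup>+y. indicator A (inv x \<otimes> y) \<partial>N \<partial>M)"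
  proof -
    have "(\<integral>\<^sup>+x. \<integral>\<^sup>+y. indicator A (inv x \<otimes> y) \<partial>N \<partial>M) = (\<integral>\<^sup>+x. emeasure N A \<partial>M)"
    proof (rule nn_integral_cong)
      fix x assume "x \<in> space M"
      hence "(\<integral>\<^sup>+y. indicator A (inv x \<otimes> y) \<partial>N) = (\<integral>\<^sup>+y. indicator A y \<partial>N)"
        by (intro N.nn_integral_left_mult) (auto simp: space_eq)
      also have "\<dots> = emeasure N A" using A sets by simp
      finally show "(\<integral>\<^sup>+y. indicator A (inv x \<otimes> y) \<partial>N) = emeasure N A" .
    qed
    thus ?thesis by (simp add: emeasure_space_1)
  qed
  also have "\<dots> = (\<integral>\<^sup>+y. \<integral>\<^sup>+x. indicator A (inv x \<otimes> y) \<partial>M \<partial>N)"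
    using P.Fubini'[OF meas] by simp
  also have "\<dots> = (\<integral>\<^sup>+y. emeasure (distr M M (\<lambda>x. inv x)) A \<partial>N)"
  proof (rule nn_integral_cong)
    fix y assume "y \<in> space N"
    hence y[measurable]: "y \<in> carrier G" by (simp add: N.space_eq)
    \<comment> \<open>Translating \<open>x\<close> by \<open>y\<close> turns
      \<open>inv x \<otimes> y\<close> into \<open>inv x\<close>, so the inner integral no longer
      depends on \<open>y\<close>.\<close>
    have "(\<integral>\<^sup>+x. indicator A (inv x \<otimes> y) \<partial>M) = (\<integral>\<^sup>+x. indicator A (inv (y \<otimes> x) \<otimes> y) \<partial>M)"
      by (rule nn_integral_left_mult[symmetric]) measurable
    also have "\<dots> = (\<integral>\<^sup>+x. indicator A (inv x) \<partial>M)"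
      by (rule nn_integral_cong) (simp add: space_eq y inv_mult_group m_assoc)
    also have "\<dots> = (\<integral>\<^sup>+x. indicator A x \<partial>distr M M (\<lambda>x. inv x))"
      by (subst nn_integral_distr) auto
    also have "\<dots> = emeasure (distr M M (\<lambda>x. inv x)) A" by (subst nn_integral_indicator) auto
    finally show "(\<integral>\<^sup>+x. indicator A (inv x \<otimes> y) \<partial>M) = emeasure (distr M M (\<lambda>x. inv x)) A" .
  qed
  also have "\<dots> = emeasure (distr M M (\<lambda>x. inv x)) A" by (simp add: N.emeasure_space_1)
  finally show "emeasure (distr M M (\<lambda>x. inv x)) A = emeasure N A" ..
qed (simp add: sets)

lemma distr_inv: "distr M M (\<lambda>x. inv x) = M"
  by (rule distr_inv_eq) (unfold_locales, rule refl)

lemma haar_unique: "prob_haar G N \<Longrightarrow> sets N = sets M \<Longrightarrow> N = M"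
  using distr_inv_eq[of N] distr_inv by simp

text \<open>Right multiplication by \<open>g\<close> is left multiplication by \<open>inv g\<close>
  conjugated by inversion.\<close>

lemma distr_right_mult:
  assumes [measurable]: "g \<in> carrier G"
  shows "distr M M (\<lambda>x. x \<otimes> g) = M"
proof -
  have "M = distr (distr (distr M M (\<lambda>x. inv x)) M (\<lambda>x. inv g \<otimes> x)) M (\<lambda>x. inv x)"
    by (simp add: distr_inv distr_left_mult assms)
  also have "\<dots> = distr M M (\<lambda>x. inv (inv g \<otimes> inv x))"
    by (subst distr_distr, measurable, subst distr_distr, measurable) (simp add: comp_def)
  also have "\<dots> = distr M M (\<lambda>x. x \<otimes> g)"
    by (rule distr_cong) (auto simp: space_eq inv_mult_group assms)
  finally show ?thesis ..
qed

context
  fixes f :: "'a \<Rightarrow> 'b::{banach, second_countable_topology}"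
  assumes f [measurable]: "f \<in> borel_measurable M"
begin

lemma integral_left_mult: 
  assumes [measurable]: "g \<in> carrier G"
  shows "(LINT x|M. f (g \<otimes> x)) = (LINT x|M. f x)"
  using integral_distr[of "\<lambda>x. g \<otimes> x" M M f] by (simp add: distr_left_mult assms)

lemma integral_right_mult:
  assumes [measurable]: "g \<in> carrier G"
  shows "(LINT x|M. f (x \<otimes> g)) = (LINT x|M. f x)"
  using integral_distr[of "\<lambda>x. x \<otimes> g" M M f] by (simp add: distr_right_mult assms)

lemma integral_inv: "(LINT x|M. f (inv x)) = (LINT x|M. f x)"
  using integral_distr[of "\<lambda>x. inv x" M M f] by (simp add: distr_inv inv_measurable)

lemma integrable_left_mult:
  assumes [measurable]: "g \<in> carrier G"
  shows "integrable M (\<lambda>x. f (g \<otimes> x)) \<longleftrightarrow> integrable M f"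
  using integrable_distr_eq[of "\<lambda>x. g \<otimes> x" M M f] by (simp add: distr_left_mult assms)

lemma integrable_inv: "integrable M (\<lambda>x. f (inv x)) \<longleftrightarrow> integrable M f"
  using integrable_distr_eq[of "\<lambda>x. inv x" M M f] by (simp add: distr_inv inv_measurable)

end

lemma integral_mult_inv:
  fixes f :: "'a \<Rightarrow> 'b::{banach, second_countable_topology}"
  assumes [measurable]: "f \<in> borel_measurable M" "g \<in> carrier G"
  shows "(LINT x|M. f (g \<otimes> inv x)) = (LINT x|M. f x)"
  using integral_inv[of "\<lambda>x. f (g \<otimes> x)"] integral_left_mult[of f g] assms by simp

lemma integrable_mult_inv:
  fixes f :: "'a \<Rightarrow> 'b::{banach, second_countable_topology}"
  assumes [measurable]: "f \<in> borel_measurable M" "g \<in> carrier G"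
  shows "integrable M (\<lambda>x. f (g \<otimes> inv x)) \<longleftrightarrow> integrable M f"
  using integrable_inv[of "\<lambda>x. f (g \<otimes> x)"] integrable_left_mult[of f g] assms by simp

section \<open>Coefficients of the left regular representation\<close>

lemma left_regular_L2:
  assumes \<xi>: "\<xi> \<in> L2 M" and g: "g \<in> carrier G"
  shows "left_regular G g \<xi> \<in> L2 M"
proof -
  have [measurable]: "\<xi> \<in> borel_measurable M" "g \<in> carrier G" using \<xi> g by (auto dest: L2_measurable)
  have "integrable M (\<lambda>x. (cmod (\<xi> (inv g \<otimes> x)))\<^sup>2)"
    using L2_integrable_sq[OF \<xi>] g integrable_left_mult[of "\<lambda>x. (cmod (\<xi> x))\<^sup>2" "inv g"] by simp
  thus ?thesis by (simp add: L2_def left_regular_def)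
qed

lemma left_regular_norm:
  assumes \<xi>: "\<xi> \<in> L2 M" and g: "g \<in> carrier G"
  shows "L2_norm M (left_regular G g \<xi>) = L2_norm M \<xi>"
proof -
  have [measurable]: "\<xi> \<in> borel_measurable M" using \<xi> by (auto dest: L2_measurable)
  show ?thesis using g integral_left_mult[of "\<lambda>x. (cmod (\<xi> x))\<^sup>2" "inv g"] 
    by (simp add: L2_norm_def left_regular_def)
qed

lemma left_regular_inner:
  assumes \<xi>: "\<xi> \<in> L2 M" and \<eta>: "\<eta> \<in> L2 M" and g: "g \<in> carrier G" and h: "h \<in> carrier G"
  shows "L2_inner M (left_regular G g \<xi>) (left_regular G h \<eta>) = L2_inner M (left_regular G (inv h \<otimes> g) \<xi>) \<eta>"
proof -
  have [measurable]: "\<xi> \<in> borel_measurable M" "\<eta> \<in> borel_measurable M" "g \<in> carrier G" "h \<in> carrier G" 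
    using assms by (auto dest: L2_measurable)
  have "L2_inner M (left_regular G g \<xi>) (left_regular G h \<eta>)
     = (LINT x|M. \<xi> (inv g \<otimes> (h \<otimes> x)) * cnj (\<eta> (inv h \<otimes> (h \<otimes> x))))"
    unfolding L2_inner_def left_regular_def
    by (subst integral_left_mult[of _ h, symmetric]) (use h in auto)
  also have "\<dots> = L2_inner M (left_regular G (inv h \<otimes> g) \<xi>) \<eta>"
    unfolding L2_inner_def left_regular_def using g h
    by (intro Bochner_Integration.integral_cong) (auto simp: space_eq inv_mult_group m_assoc[symmetric])
  finally show ?thesis .
qed

lemma coefficient_measurable:
  assumes \<xi>: "\<xi> \<in> L2 M" and \<eta>: "\<eta> \<in> L2 M"
  shows "(\<lambda>g. L2_inner M (left_regular G g \<xi>) \<eta>) \<in> borel_measurable M"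
proof -
  have [measurable]: "\<xi> \<in> borel_measurable M" "\<eta> \<in> borel_measurable M"
    using assms by (auto dest: L2_measurable)
  show ?thesis unfolding L2_inner_def left_regular_def by measurable
qed

lemma coefficient_bound:
  assumes \<xi>: "\<xi> \<in> L2 M" and \<eta>: "\<eta> \<in> L2 M" and g: "g \<in> carrier G"
  shows "cmod (L2_inner M (left_regular G g \<xi>) \<eta>) \<le> L2_norm M \<xi> * L2_norm M \<eta>"
  using L2_Cauchy_Schwarz[OF left_regular_L2[OF \<xi> g] \<eta>] by (simp add: left_regular_norm \<xi> g)

section \<open>Convolution operators with bounded kernels\<close>

definition kernel :: "('a \<Rightarrow> complex) \<Rightarrow> bool" where
  "kernel \<kappa> \<longleftrightarrow> \<kappa> \<in> borel_measurable M \<and> (\<exists>B. \<forall>x\<in>carrier G. cmod (\<kappa> x) \<le> B)"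

definition conv :: "('a \<Rightarrow> complex) \<Rightarrow> ('a \<Rightarrow> complex) \<Rightarrow> 'a \<Rightarrow> complex" where
  "conv \<kappa> \<xi> = (\<lambda>x. LINT z|M. \<kappa> (x \<otimes> inv z) * \<xi> z)"

lemma kernel_measurable: "kernel \<kappa> \<Longrightarrow> \<kappa> \<in> borel_measurable M"
  by (simp add: kernel_def)

lemma kernel_boundE:
  assumes "kernel \<kappa>"
  obtains B where "B \<ge> 0" "\<And>x. x \<in> carrier G \<Longrightarrow> cmod (\<kappa> x) \<le> B"
proof -
  from assms obtain B where B: "\<And>x. x \<in> carrier G \<Longrightarrow> cmod (\<kappa> x) \<le> B" by (auto simp: kernel_def)
  show ?thesis using B[OF one_closed] norm_ge_zero[of "\<kappa> \<one>"] by (intro that[OF _ B]) linarith+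
qed

lemma conv_integrable:
  assumes \<kappa>: "kernel \<kappa>" and \<xi>: "\<xi> \<in> L2 M" and x: "x \<in> carrier G"
  shows "integrable M (\<lambda>z. \<kappa> (x \<otimes> inv z) * \<xi> z)"
proof -
  have [measurable]: "\<kappa> \<in> borel_measurable M" "\<xi> \<in> borel_measurable M" "x \<in> carrier G"
    using assms by (auto simp: kernel_measurable L2_measurable)
  obtain B where B: "B \<ge> 0" "\<And>x. x \<in> carrier G \<Longrightarrow> cmod (\<kappa> x) \<le> B" using kernel_boundE[OF \<kappa>] by blast
  show ?thesis
  proof (rule Bochner_Integration.integrable_bound)
    show "integrable M (\<lambda>z. B * cmod (\<xi> z))" using L2_integrable[OF \<xi>] by auto
    show "AE z in M. norm (\<kappa> (x \<otimes> inv z) * \<xi> z) \<le> norm (B * cmod (\<xi> z))"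
      using B x by (intro AE_I2) (auto simp: norm_mult space_eq intro!: mult_right_mono)
  qed measurable
qed

lemma conv_bound:
  assumes \<kappa>: "kernel \<kappa>" and \<xi>: "\<xi> \<in> L2 M" and B: "\<And>x. x \<in> carrier G \<Longrightarrow> cmod (\<kappa> x) \<le> B"
    and x: "x \<in> carrier G"
  shows "cmod (conv \<kappa> \<xi> x) \<le> B * L2_norm M \<xi>"
proof -
  have B0: "B \<ge> 0" using B[OF one_closed] norm_ge_zero[of "\<kappa> \<one>"] by linarith
  have "cmod (conv \<kappa> \<xi> x) \<le> (LINT z|M. cmod (\<kappa> (x \<otimes> inv z) * \<xi> z))"
    unfolding conv_def by (rule integral_norm_bound)
  also have "\<dots> \<le> (LINT z|M. B * cmod (\<xi> z))"
    using B x L2_integrable[OF \<xi>]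
    by (intro integral_mono integrable_norm[OF conv_integrable[OF \<kappa> \<xi> x]]) 
      (auto simp: norm_mult space_eq intro!: mult_right_mono)
  also have "\<dots> = B * (LINT z|M. cmod (\<xi> z))" by simp
  also have "\<dots> \<le> B * L2_norm M \<xi>" by (intro mult_left_mono L1_le_L2_norm \<xi> B0)
  finally show ?thesis .
qed

lemma conv_measurable:
  assumes \<kappa>: "kernel \<kappa>" and \<xi>: "\<xi> \<in> L2 M"
  shows "conv \<kappa> \<xi> \<in> borel_measurable M"
proof -
  have [measurable]: "\<kappa> \<in> borel_measurable M" "\<xi> \<in> borel_measurable M"
    using assms by (auto simp: kernel_measurable L2_measurable)
  show ?thesis unfolding conv_def by measurable
qed

lemma conv_L2:
  assumes \<kappa>: "kernel \<kappa>" and \<xi>: "\<xi> \<in> L2 M"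
  shows "conv \<kappa> \<xi> \<in> L2 M"
proof -
  obtain B where B: "B \<ge> 0" "\<And>x. x \<in> carrier G \<Longrightarrow> cmod (\<kappa> x) \<le> B" using kernel_boundE[OF \<kappa>] by blast
  show ?thesis using conv_bound[OF \<kappa> \<xi> B(2)] conv_measurable[OF \<kappa> \<xi>]
    by (intro L2_bounded) (auto simp: space_eq)
qed

lemma conv_alt:
  assumes \<kappa>: "kernel \<kappa>" and \<xi>: "\<xi> \<in> L2 M" and x: "x \<in> carrier G"
  shows "conv \<kappa> \<xi> x = (LINT y|M. \<kappa> y * \<xi> (inv y \<otimes> x))"
proof -
  have [measurable]: "\<kappa> \<in> borel_measurable M" "\<xi> \<in> borel_measurable M" "x \<in> carrier G"
    using assms by (auto simp: kernel_measurable L2_measurable)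
  have "(LINT y|M. \<kappa> y * \<xi> (inv y \<otimes> x)) = (LINT z|M. \<kappa> (x \<otimes> inv z) * \<xi> (inv (x \<otimes> inv z) \<otimes> x))"
    by (rule integral_mult_inv[symmetric]) measurable
  also have "\<dots> = conv \<kappa> \<xi> x" unfolding conv_def using x
    by (intro Bochner_Integration.integral_cong) (auto simp: space_eq inv_mult_group m_assoc)
  finally show ?thesis ..
qed

text \<open>The operator \<open>conv \<kappa>\<close> is the weak integral of
  \<open>\<kappa> y\<close> times left translation by \<open>y\<close>. Consequently its pairing
  with \<open>\<xi>\<close> and \<open>\<eta>\<close> sees only their coefficient function, which is
  how an operator in the von Neumann algebra acts on the Fourier algebra.\<close>

lemma conv_inner:
  assumes \<kappa>: "kernel \<kappa>" and \<xi>: "\<xi> \<in> L2 M" and \<eta>: "\<eta> \<in> L2 M"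
  shows "L2_inner M (conv \<kappa> \<xi>) \<eta> = (LINT y|M. \<kappa> y * L2_inner M (left_regular G y \<xi>) \<eta>)"
proof -
  interpret P: pair_prob_space M M ..
  have [measurable]: "\<kappa> \<in> borel_measurable M" "\<xi> \<in> borel_measurable M" "\<eta> \<in> borel_measurable M"
    using assms by (auto simp: kernel_measurable L2_measurable)
  obtain B where B: "B \<ge> 0" "\<And>x. x \<in> carrier G \<Longrightarrow> cmod (\<kappa> x) \<le> B" using kernel_boundE[OF \<kappa>] by blast
  define F where "F = (\<lambda>x y. \<kappa> y * \<xi> (inv y \<otimes> x) * cnj (\<eta> x))"
  have F_meas[measurable]: "case_prod F \<in> borel_measurable (M \<Otimes>\<^sub>M M)" unfolding F_def by measurable
  have int1: "integrable M (\<lambda>y. F x y)" if x: "x \<in> carrier G" for x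
  proof -
    have [measurable]: "x \<in> carrier G" by fact
    have "integrable M (\<lambda>z. \<kappa> (x \<otimes> inv z) * \<xi> (inv (x \<otimes> inv z) \<otimes> x))"
      using conv_integrable[OF \<kappa> \<xi> x] x
      by (subst Bochner_Integration.integrable_cong[where g = "\<lambda>z. \<kappa> (x \<otimes> inv z) * \<xi> z"]) 
        (auto simp: space_eq inv_mult_group m_assoc)
    hence "integrable M (\<lambda>y. \<kappa> y * \<xi> (inv y \<otimes> x))"
      by (subst (asm) integrable_mult_inv[where f = "\<lambda>y. \<kappa> y * \<xi> (inv y \<otimes> x)"]) measurable
    thus ?thesis unfolding F_def by simp
  qed
  \<comment> \<open>Neither \<open>\<xi>\<close> nor \<open>\<eta>\<close> is bounded, so
    integrability on the product needs an argument: the substitution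
    \<open>y = x \<otimes> inv z\<close> separates the two factors, and the L1 norm of
    \<open>\<xi>\<close> is at most its L2 norm.\<close>
  have int2: "(LINT y|M. norm (F x y)) \<le> B * L2_norm M \<xi> * cmod (\<eta> x)" if x: "x \<in> carrier G" for x
  proof -
    have [measurable]: "x \<in> carrier G" by fact
    have "(LINT y|M. norm (F x y)) = (LINT z|M. norm (F x (x \<otimes> inv z)))"
      by (rule integral_mult_inv[symmetric]) (unfold F_def, measurable)
    also have "\<dots> = (LINT z|M. norm (\<kappa> (x \<otimes> inv z)) * norm (\<xi> z) * norm (\<eta> x))"
      unfolding F_def using x
      by (intro Bochner_Integration.integral_cong) (auto simp: space_eq inv_mult_group m_assoc norm_mult)
    also have "\<dots> \<le> (LINT z|M. B * norm (\<xi> z) * norm (\<eta> x))"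
      using B x L2_integrable[OF \<xi>] integrable_norm[OF conv_integrable[OF \<kappa> \<xi> x]]
      by (intro integral_mono) (auto simp: norm_mult space_eq intro!: mult_right_mono)
    also have "\<dots> = B * (LINT z|M. cmod (\<xi> z)) * cmod (\<eta> x)" by simp
    also have "\<dots> \<le> B * L2_norm M \<xi> * cmod (\<eta> x)" by (intro mult_left_mono mult_right_mono L1_le_L2_norm \<xi> B) auto
    finally show ?thesis .
  qed
  have "integrable (M \<Otimes>\<^sub>M M) (case_prod F)"
  proof (rule P.Fubini_integrable)
    show "integrable M (\<lambda>x. LINT y|M. norm (case (x, y) of (x, y) \<Rightarrow> F x y))"
    proof (rule Bochner_Integration.integrable_bound)
      show "integrable M (\<lambda>x. B * L2_norm M \<xi> * cmod (\<eta> x))" using L2_integrable[OF \<eta>] by auto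
      show "AE x in M. norm (LINT y|M. norm (case (x, y) of (x, y) \<Rightarrow> F x y)) \<le> norm (B * L2_norm M \<xi> * cmod (\<eta> x))"
        using int2 B(1) by (intro AE_I2) (auto simp: space_eq abs_mult)
    qed measurable
  qed (use int1 in \<open>auto simp: space_eq\<close>)
  hence "(LINT y|M. LINT x|M. F x y) = (LINT x|M. LINT y|M. F x y)" by (rule P.Fubini_integral)
  moreover have "(LINT x|M. LINT y|M. F x y) = L2_inner M (conv \<kappa> \<xi>) \<eta>"
    unfolding L2_inner_def F_def
    by (intro Bochner_Integration.integral_cong) (auto simp: conv_alt[OF \<kappa> \<xi>] space_eq)
  moreover have "(LINT y|M. LINT x|M. F x y) = (LINT y|M. \<kappa> y * L2_inner M (left_regular G y \<xi>) \<eta>)"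
    unfolding L2_inner_def F_def left_regular_def by (simp add: mult.assoc)
  ultimately show ?thesis by simp
qed

lemma kernel_correlation:
  assumes \<kappa>: "kernel \<kappa>" and \<kappa>': "kernel \<kappa>'"
  shows "kernel (\<lambda>g. LINT x|M. \<kappa> (x \<otimes> g) * cnj (\<kappa>' x))"
proof -
  have [measurable]: "\<kappa> \<in> borel_measurable M" "\<kappa>' \<in> borel_measurable M"
    using assms by (auto simp: kernel_measurable)
  obtain B where B: "B \<ge> 0" "\<And>x. x \<in> carrier G \<Longrightarrow> cmod (\<kappa> x) \<le> B" using kernel_boundE[OF \<kappa>] by blast
  obtain B' where B': "B' \<ge> 0" "\<And>x. x \<in> carrier G \<Longrightarrow> cmod (\<kappa>' x) \<le> B'" using kernel_boundE[OF \<kappa>'] by blast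
  have "cmod (LINT x|M. \<kappa> (x \<otimes> g) * cnj (\<kappa>' x)) \<le> B * B'" if [measurable]: "g \<in> carrier G" for g
  proof -
    have le: "cmod (\<kappa> (x \<otimes> g) * cnj (\<kappa>' x)) \<le> B * B'" if "x \<in> carrier G" for x
      using B B' that \<open>g \<in> carrier G\<close> by (auto simp: norm_mult intro!: mult_mono)
    have int: "integrable M (\<lambda>x. \<kappa> (x \<otimes> g) * cnj (\<kappa>' x))"
      using le by (intro integrable_const_bound[where B = "B * B'"]) (auto simp: space_eq)
    have "cmod (LINT x|M. \<kappa> (x \<otimes> g) * cnj (\<kappa>' x)) \<le> (LINT x|M. cmod (\<kappa> (x \<otimes> g) * cnj (\<kappa>' x)))"
      by (rule integral_norm_bound)
    also have "\<dots> \<le> (LINT x|M. B * B')"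
      using le by (intro integral_mono integrable_norm int) (auto simp: space_eq)
    also have "\<dots> = B * B'" by (simp add: prob_space)
    finally show ?thesis .
  qed
  thus ?thesis unfolding kernel_def by (auto intro!: exI[of _ "B * B'"])
qed

text \<open>The correlation of two kernels is the kernel of the adjoint of
  \<open>conv \<kappa>'\<close> composed with \<open>conv \<kappa>\<close>. Orthogonality and norms
  of convolution operators thereby become integrals over the group. The exchanges of integrals are
  made with the bounded coefficient function in place of \<open>\<xi>\<close> and
  \<open>\<eta>\<close>.\<close>

lemma conv_inner_conv:
  assumes \<kappa>: "kernel \<kappa>" and \<kappa>': "kernel \<kappa>'" and \<xi>: "\<xi> \<in> L2 M" and \<eta>: "\<eta> \<in> L2 M"
  shows "L2_inner M (conv \<kappa> \<xi>) (conv \<kappa>' \<eta>) = 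
    L2_inner M (conv (\<lambda>g. LINT x|M. \<kappa> (x \<otimes> g) * cnj (\<kappa>' x)) \<xi>) \<eta>"
proof -
  define u where "u = (\<lambda>g. L2_inner M (left_regular G g \<xi>) \<eta>)"
  have [measurable]: "\<kappa> \<in> borel_measurable M" "\<kappa>' \<in> borel_measurable M" "u \<in> borel_measurable M"
    unfolding u_def using assms by (auto simp: kernel_measurable coefficient_measurable)
  obtain B where B: "B \<ge> 0" "\<And>x. x \<in> carrier G \<Longrightarrow> cmod (\<kappa> x) \<le> B" using kernel_boundE[OF \<kappa>] by blast
  obtain B' where B': "B' \<ge> 0" "\<And>x. x \<in> carrier G \<Longrightarrow> cmod (\<kappa>' x) \<le> B'" using kernel_boundE[OF \<kappa>'] by blast
  define C where "C = L2_norm M \<xi> * L2_norm M \<eta>"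
  have C: "C \<ge> 0" "\<And>x. x \<in> carrier G \<Longrightarrow> cmod (u x) \<le> C"
    unfolding u_def C_def by (auto intro: coefficient_bound \<xi> \<eta>)
  have inner: "L2_inner M (left_regular G y \<xi>) (conv \<kappa>' \<eta>) = (LINT w|M. cnj (\<kappa>' w) * u (inv w \<otimes> y))"
    if y: "y \<in> carrier G" for y
  proof -
    have "L2_inner M (left_regular G y \<xi>) (conv \<kappa>' \<eta>) = cnj (LINT w|M. \<kappa>' w * L2_inner M (left_regular G w \<eta>) (left_regular G y \<xi>))"
      by (subst L2_inner_cnj) (simp add: conv_inner \<kappa>' \<eta> left_regular_L2 \<xi> y)
    also have "\<dots> = (LINT w|M. cnj (\<kappa>' w) * cnj (L2_inner M (left_regular G w \<eta>) (left_regular G y \<xi>)))"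
      by (subst Bochner_Integration.integral_cnj[symmetric]) simp
    also have "\<dots> = (LINT w|M. cnj (\<kappa>' w) * u (inv w \<otimes> y))"
      unfolding L2_inner_cnj[symmetric] u_def
      by (intro Bochner_Integration.integral_cong) (auto simp: left_regular_inner \<xi> \<eta> y space_eq)
    finally show ?thesis .
  qed
  have "L2_inner M (conv \<kappa> \<xi>) (conv \<kappa>' \<eta>) = (LINT y|M. LINT w|M. \<kappa> y * (cnj (\<kappa>' w) * u (inv w \<otimes> y)))"
    unfolding conv_inner[OF \<kappa> \<xi> conv_L2[OF \<kappa>' \<eta>]]
    by (intro Bochner_Integration.integral_cong) (auto simp: inner space_eq)
  also have "\<dots> = (LINT w|M. LINT y|M. \<kappa> y * (cnj (\<kappa>' w) * u (inv w \<otimes> y)))"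
  proof (rule Fubini_bounded[where B = "B * (B' * C)"])
    fix x y assume "x \<in> space M" "y \<in> space M"
    thus "cmod (\<kappa> x * (cnj (\<kappa>' y) * u (inv y \<otimes> x))) \<le> B * (B' * C)"
      using B B' C by (auto simp: norm_mult space_eq intro!: mult_mono)
  qed measurable
  also have "\<dots> = (LINT w|M. LINT y|M. \<kappa> (w \<otimes> y) * cnj (\<kappa>' w) * u y)"
  proof (rule Bochner_Integration.integral_cong)
    fix w assume "w \<in> space M"
    hence w[measurable]: "w \<in> carrier G" by (simp add: space_eq)
    have "(LINT y|M. \<kappa> y * (cnj (\<kappa>' w) * u (inv w \<otimes> y))) = (LINT y|M. \<kappa> (w \<otimes> y) * (cnj (\<kappa>' w) * u (inv w \<otimes> (w \<otimes> y))))"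
      by (rule integral_left_mult[symmetric]) (auto simp: w)
    also have "\<dots> = (LINT y|M. \<kappa> (w \<otimes> y) * cnj (\<kappa>' w) * u y)"
      using w by (intro Bochner_Integration.integral_cong) (auto simp: space_eq m_assoc[symmetric] mult.assoc)
    finally show "(LINT y|M. \<kappa> y * (cnj (\<kappa>' w) * u (inv w \<otimes> y))) = (LINT y|M. \<kappa> (w \<otimes> y) * cnj (\<kappa>' w) * u y)" .
  qed simp
  also have "\<dots> = (LINT y|M. LINT w|M. \<kappa> (w \<otimes> y) * cnj (\<kappa>' w) * u y)"
  proof (rule Fubini_bounded[where B = "B * B' * C"])
    fix x y assume "x \<in> space M" "y \<in> space M"
    thus "cmod (\<kappa> (x \<otimes> y) * cnj (\<kappa>' x) * u y) \<le> B * B' * C"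
      using B B' C by (auto simp: norm_mult space_eq intro!: mult_mono)
  qed measurable
  also have "\<dots> = (LINT y|M. (LINT w|M. \<kappa> (w \<otimes> y) * cnj (\<kappa>' w)) * u y)" by simp
  also have "\<dots> = L2_inner M (conv (\<lambda>g. LINT x|M. \<kappa> (x \<otimes> g) * cnj (\<kappa>' x)) \<xi>) \<eta>"
    by (simp add: conv_inner kernel_correlation \<kappa> \<kappa>' \<xi> \<eta> u_def)
  finally show ?thesis .
qed

text \<open>An operator commuting with all translations commutes with their weak integral: tested
  against \<open>\<eta>\<close>, the vector representing the adjoint at \<open>\<eta>\<close> moves
  \<open>A\<close> inside the integral, where it meets a single translation.\<close>

lemma conv_commutant:
  assumes A: "A \<in> commutant M (left_regular G ` carrier G)" and \<kappa>: "kernel \<kappa>" and \<xi>: "\<xi> \<in> L2 M"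
  shows "AE x in M. A (conv \<kappa> \<xi>) x = conv \<kappa> (A \<xi>) x"
proof -
  have AL: "A \<in> L2_operators M" using A by (simp add: commutant_def)
  note D = L2_operatorsD[OF AL]
  show ?thesis
  proof (rule L2_AE_eqI_inner)
    fix \<eta> assume \<eta>: "\<eta> \<in> L2 M"
    obtain \<zeta> where \<zeta>: "\<zeta> \<in> L2 M" "\<And>\<xi>. \<xi> \<in> L2 M \<Longrightarrow> L2_inner M (A \<xi>) \<eta> = L2_inner M \<xi> \<zeta>"
      using L2_adjoint[OF AL \<eta>] by blast
    have "L2_inner M (A (conv \<kappa> \<xi>)) \<eta> = (LINT y|M. \<kappa> y * L2_inner M (left_regular G y \<xi>) \<zeta>)"
      by (simp add: \<zeta> conv_L2 \<kappa> \<xi> conv_inner)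
    also have "\<dots> = (LINT y|M. \<kappa> y * L2_inner M (left_regular G y (A \<xi>)) \<eta>)"
    proof (intro Bochner_Integration.integral_cong refl)
      fix y assume "y \<in> space M"
      hence y: "y \<in> carrier G" by (simp add: space_eq)
      have "L2_inner M (left_regular G y \<xi>) \<zeta> = L2_inner M (A (left_regular G y \<xi>)) \<eta>"
        by (simp add: \<zeta> left_regular_L2 \<xi> y)
      also have "\<dots> = L2_inner M (left_regular G y (A \<xi>)) \<eta>"
        using A y \<xi> by (intro L2_inner_cong_AE D(1) left_regular_L2 \<eta>) (auto simp: commutant_def)
      finally show "\<kappa> y * L2_inner M (left_regular G y \<xi>) \<zeta> = \<kappa> y * L2_inner M (left_regular G y (A \<xi>)) \<eta>"
        by simp
    qed
    also have "\<dots> = L2_inner M (conv \<kappa> (A \<xi>)) \<eta>" by (simp add: conv_inner \<kappa> \<eta> D(1) \<xi>)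
    finally show "L2_inner M (A (conv \<kappa> \<xi>)) \<eta> = L2_inner M (conv \<kappa> (A \<xi>)) \<eta>" .
  qed (intro D(1) conv_L2 \<kappa> \<xi>)+
qed

lemma conv_add:
  assumes "kernel \<kappa>" "\<xi> \<in> L2 M" "\<eta> \<in> L2 M" "x \<in> carrier G"
  shows "conv \<kappa> (\<lambda>y. \<xi> y + \<eta> y) x = conv \<kappa> \<xi> x + conv \<kappa> \<eta> x"
  unfolding conv_def using conv_integrable[OF assms(1,2,4)] conv_integrable[OF assms(1,3,4)]
  by (simp add: distrib_left)

lemma conv_scale: "conv \<kappa> (\<lambda>y. c * \<xi> y) x = c * conv \<kappa> \<xi> x"
  unfolding conv_def by (simp add: mult.left_commute)

text \<open>The partial sums converge strongly by orthogonality of their terms at each vector, and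
  the commutation with the commutant survives the limit because its elements are bounded.\<close>

theorem VN_orthogonal_series:
  assumes \<kappa>: "\<And>n. kernel (\<kappa> n)" and C: "C \<ge> 0"
    and orth: "\<And>m n \<xi>. \<xi> \<in> L2 M \<Longrightarrow> m \<noteq> n \<Longrightarrow> L2_inner M (conv (\<kappa> m) \<xi>) (conv (\<kappa> n) \<xi>) = 0"
    and bound: "\<And>N \<xi>. \<xi> \<in> L2 M \<Longrightarrow> (\<Sum>n<N. (L2_norm M (conv (\<kappa> n) \<xi>))\<^sup>2) \<le> (C * L2_norm M \<xi>)\<^sup>2"
  shows "\<exists>S\<in>VN G M. \<forall>\<xi>\<in>L2 M. \<forall>\<eta>\<in>L2 M. 
    summable (\<lambda>n. cmod (L2_inner M (conv (\<kappa> n) \<xi>) \<eta>)) \<and> 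
    L2_inner M (S \<xi>) \<eta> = (\<Sum>n. L2_inner M (conv (\<kappa> n) \<xi>) \<eta>)"
proof -
  define P where "P = (\<lambda>\<xi> N x. \<Sum>n<N. conv (\<kappa> n) \<xi> x)"
  \<comment> \<open>A choice of limit for each \<open>\<xi>\<close>; linearity and commutation hold
    almost everywhere by uniqueness of limits, which is all that operators on representatives
    require.\<close>
  define S where "S = (\<lambda>\<xi>. SOME f. L2_tendsto M (P \<xi>) f)"
  have P: "P \<xi> N \<in> L2 M" if "\<xi> \<in> L2 M" for \<xi> N
    unfolding P_def by (intro L2_sum conv_L2 \<kappa> that)
  have B0: "C * L2_norm M \<xi> \<ge> 0" for \<xi> using C by simp
  have S: "L2_tendsto M (P \<xi>) (S \<xi>)" if "\<xi> \<in> L2 M" for \<xi>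
  proof -
    have "\<exists>f. L2_tendsto M (P \<xi>) f" unfolding P_def
      by (rule L2_orthogonal_series(1)[where B = "C * L2_norm M \<xi>"]) 
        (intro conv_L2 \<kappa> that orth bound B0; assumption)+
    thus ?thesis unfolding S_def by (rule someI_ex)
  qed
  have SL: "S \<xi> \<in> L2 M" if "\<xi> \<in> L2 M" for \<xi> using S[OF that] by (simp add: L2_tendsto_def)
  have "S \<in> L2_operators M"
    unfolding L2_operators_def
  proof (intro CollectI conjI ballI allI)
    fix \<xi> \<eta> assume \<xi>: "\<xi> \<in> L2 M" and \<eta>: "\<eta> \<in> L2 M"
    have "L2_tendsto M (P (\<lambda>y. \<xi> y + \<eta> y)) (\<lambda>x. S \<xi> x + S \<eta> x)"
    proof (rule L2_tendsto_cong[OF L2_tendsto_add[OF S[OF \<xi>] S[OF \<eta>]]])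
      show "AE x in M. P \<xi> n x + P \<eta> n x = P (\<lambda>y. \<xi> y + \<eta> y) n x" for n
        by (rule AE_I2) (simp add: P_def conv_add[OF \<kappa> \<xi> \<eta>] space_eq sum.distrib)
    qed (intro P \<xi> \<eta> L2_add)+
    from L2_tendsto_unique[OF S[OF L2_add[OF \<xi> \<eta>]] this P[OF L2_add[OF \<xi> \<eta>]]]
    show "AE x in M. S (\<lambda>y. \<xi> y + \<eta> y) x = S \<xi> x + S \<eta> x" .
  next
    fix c \<xi> assume \<xi>: "\<xi> \<in> L2 M"
    have "L2_tendsto M (P (\<lambda>y. c * \<xi> y)) (\<lambda>x. c * S \<xi> x)"
      using L2_tendsto_scale[OF S[OF \<xi>], of c] by (simp add: P_def conv_scale sum_distrib_left)
    from L2_tendsto_unique[OF S[OF L2_scale[OF \<xi>]] this P[OF L2_scale[OF \<xi>]]]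
    show "AE x in M. S (\<lambda>y. c * \<xi> y) x = c * S \<xi> x" .
  next
    have "L2_norm M (S \<xi>) \<le> C * L2_norm M \<xi>" if \<xi>: "\<xi> \<in> L2 M" for \<xi>
    proof (rule L2_tendsto_norm_le[OF S[OF \<xi>] P[OF \<xi>]], rule power2_le_imp_le[OF _ B0])
      fix N
      have "(L2_norm M (P \<xi> N))\<^sup>2 = (\<Sum>n<N. (L2_norm M (conv (\<kappa> n) \<xi>))\<^sup>2)"
        unfolding P_def by (intro L2_norm_sum_orthogonal conv_L2 \<kappa> \<xi> orth) auto
      thus "(L2_norm M (P \<xi> N))\<^sup>2 \<le> (C * L2_norm M \<xi>)\<^sup>2" using bound[OF \<xi>] by simp
    qed
    thus "\<exists>C. \<forall>\<xi>\<in>L2 M. L2_norm M (S \<xi>) \<le> C * L2_norm M \<xi>" by blast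
  qed (rule SL)
  moreover have "AE x in M. S (A \<xi>) x = A (S \<xi>) x"
    if A: "A \<in> commutant M (left_regular G ` carrier G)" and \<xi>: "\<xi> \<in> L2 M" for A \<xi>
  proof -
    have AL: "A \<in> L2_operators M" using A by (simp add: commutant_def)
    note D = L2_operatorsD[OF AL]
    have AP: "AE x in M. A (P \<xi> N) x = P (A \<xi>) N x" for N
    proof (induction N)
      case 0
      show ?case using D(3)[OF L2_zero, of 0] by (simp add: P_def conv_def)
    next
      case (Suc N)
      have "AE x in M. A (\<lambda>y. P \<xi> N y + conv (\<kappa> N) \<xi> y) x = A (P \<xi> N) x + A (conv (\<kappa> N) \<xi>) x"
        by (rule D(2)[OF P[OF \<xi>] conv_L2[OF \<kappa> \<xi>]])
      with Suc conv_commutant[OF A \<kappa>[of N] \<xi>] show ?case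
        by eventually_elim (simp add: P_def)
    qed
    have "L2_tendsto M (P (A \<xi>)) (A (S \<xi>))"
      by (rule L2_tendsto_cong[OF L2_tendsto_operator[OF S[OF \<xi>] P[OF \<xi>] AL] AP]) (intro D(1) P \<xi>)+
    from L2_tendsto_unique[OF S[OF D(1)[OF \<xi>]] this P[OF D(1)[OF \<xi>]]] show ?thesis .
  qed
  ultimately have "S \<in> VN G M" unfolding VN_def by (simp add: commutant_def[of M "commutant M _"])
  moreover have "summable (\<lambda>n. cmod (L2_inner M (conv (\<kappa> n) \<xi>) \<eta>)) \<and> 
    L2_inner M (S \<xi>) \<eta> = (\<Sum>n. L2_inner M (conv (\<kappa> n) \<xi>) \<eta>)" if \<xi>: "\<xi> \<in> L2 M" and \<eta>: "\<eta> \<in> L2 M" for \<xi> \<eta>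
  proof
    show "summable (\<lambda>n. cmod (L2_inner M (conv (\<kappa> n) \<xi>) \<eta>))"
      by (rule L2_orthogonal_series(2)[where B = "C * L2_norm M \<xi>"]) (intro conv_L2 \<kappa> \<xi> orth bound B0 \<eta>; assumption)+
    have "(\<lambda>N. L2_inner M (P \<xi> N) \<eta>) \<longlonglongrightarrow> L2_inner M (S \<xi>) \<eta>"
      by (intro L2_tendsto_inner S P \<xi> \<eta>)
    hence "(\<lambda>n. L2_inner M (conv (\<kappa> n) \<xi>) \<eta>) sums L2_inner M (S \<xi>) \<eta>"
      unfolding P_def sums_def by (simp add: L2_inner_sum_left conv_L2 \<kappa> \<xi> \<eta>)
    thus "L2_inner M (S \<xi>) \<eta> = (\<Sum>n. L2_inner M (conv (\<kappa> n) \<xi>) \<eta>)" by (simp add: sums_iff)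
  qed
  ultimately show ?thesis by blast
qed

end

section \<open>Rescaled measures, product groups and normalization\<close>

lemma L2_density_const:
  assumes "c > 0"
  shows "L2 (density M (\<lambda>_. ennreal c)) = L2 M"
  using assms by (auto simp: L2_def integrable_density)

lemma L2_inner_density_const:
  assumes "c > 0" "\<xi> \<in> L2 M" "\<eta> \<in> L2 M"
  shows "L2_inner (density M (\<lambda>_. ennreal c)) \<xi> \<eta> = of_real c * L2_inner M \<xi> \<eta>"
proof -
  have [measurable]: "\<xi> \<in> borel_measurable M" "\<eta> \<in> borel_measurable M" 
    using assms by (auto dest: L2_measurable)
  show ?thesis using assms(1) by (simp add: L2_inner_def integral_density scaleR_conv_of_real)
qed

lemma L2_norm_density_const:
  assumes "c > 0" "\<xi> \<in> L2 M"
  shows "L2_norm (density M (\<lambda>_. ennreal c)) \<xi> = sqrt c * L2_norm M \<xi>"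
proof -
  have [measurable]: "\<xi> \<in> borel_measurable M"
    using assms by (auto dest: L2_measurable)
  show ?thesis using assms(1) by (simp add: L2_norm_def integral_density real_sqrt_mult)
qed

lemma AE_density_const:
  assumes "c > 0"
  shows "(AE x in density M (\<lambda>_. ennreal c). P x) \<longleftrightarrow> (AE x in M. P x)"
  using assms by (subst AE_density) auto

lemma L2_operators_density_const:
  assumes c: "c > 0"
  shows "L2_operators (density M (\<lambda>_. ennreal c)) = L2_operators M"
proof -
  have "(\<forall>f\<in>L2 M. L2_norm (density M (\<lambda>_. ennreal c)) (T f) \<le> C * L2_norm (density M (\<lambda>_. ennreal c)) f)
    \<longleftrightarrow> (\<forall>f\<in>L2 M. L2_norm M (T f) \<le> C * L2_norm M f)" if "\<forall>f\<in>L2 M. T f \<in> L2 M" for T C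
  proof (intro ball_cong refl)
    fix f assume "f \<in> L2 M"
    hence "L2_norm (density M (\<lambda>_. ennreal c)) (T f) \<le> C * L2_norm (density M (\<lambda>_. ennreal c)) f
      \<longleftrightarrow> sqrt c * L2_norm M (T f) \<le> sqrt c * (C * L2_norm M f)"
      using that by (simp add: L2_norm_density_const c mult_ac)
    thus "L2_norm (density M (\<lambda>_. ennreal c)) (T f) \<le> C * L2_norm (density M (\<lambda>_. ennreal c)) f
      \<longleftrightarrow> L2_norm M (T f) \<le> C * L2_norm M f" using c by simp
  qed
  thus ?thesis unfolding L2_operators_def L2_density_const[OF c] AE_density_const[OF c]
    by (intro Collect_cong) (auto cong: conj_cong)
qed

lemma VN_density_const:
  assumes c: "c > 0"
  shows "VN G (density M (\<lambda>_. ennreal c)) = VN G M"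
  unfolding VN_def commutant_def L2_operators_density_const[OF c] L2_density_const[OF c] AE_density_const[OF c] ..

text \<open>The definite description requires both that some pair represents \<open>u\<close> and
  that every representing pair gives the same value.\<close>

lemma VN_dual_eqI:
  assumes "\<xi> \<in> L2 M" "\<eta> \<in> L2 M" "\<And>g. g \<in> carrier G \<Longrightarrow> u g = L2_inner M (left_regular G g \<xi>) \<eta>"
    and "\<And>\<xi> \<eta>. \<xi> \<in> L2 M \<Longrightarrow> \<eta> \<in> L2 M \<Longrightarrow> (\<And>g. g \<in> carrier G \<Longrightarrow> u g = L2_inner M (left_regular G g \<xi>) \<eta>)
      \<Longrightarrow> L2_inner M (T \<xi>) \<eta> = c"
  shows "VN_dual G M T u = c"
  unfolding VN_dual_def using assms by (intro the_equality) blast+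

text \<open>A Haar measure on the product group lives on the Borel sets of a subspace of the
  product, while a product of measures lives on the product sigma algebra; second countability
  identifies the two.\<close>

lemma sets_restrict_borel_prod:
  fixes S :: "'a::second_countable_topology set" and T :: "'b::second_countable_topology set"
  shows "sets (restrict_space borel S \<Otimes>\<^sub>M restrict_space borel T) = sets (restrict_space borel (S \<times> T))"
proof -
  let ?P = "restrict_space borel S \<Otimes>\<^sub>M restrict_space borel T"
  let ?R = "restrict_space (borel \<Otimes>\<^sub>M borel) (S \<times> T)"
  have sp: "space ?P = S \<times> T" by (simp add: space_pair_measure space_restrict_space)
  have "sets ?P \<subseteq> sets ?R"
    unfolding sets_pair_measure[of "restrict_space borel S"]
  proof (rule sets.sigma_sets_subset')
    show "{a \<times> b |a b. a \<in> sets (restrict_space borel S) \<and> b \<in> sets (restrict_space borel T)} \<subseteq> sets ?R"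
    proof clarify
      fix a b assume "a \<in> sets (restrict_space borel S)" "b \<in> sets (restrict_space borel T)"
      then obtain a' b' where "a' \<in> sets borel" "a = S \<inter> a'" "b' \<in> sets borel" "b = T \<inter> b'"
        by (auto simp: sets_restrict_space)
      moreover from this have "a \<times> b = (S \<times> T) \<inter> (a' \<times> b')" by auto
      ultimately show "a \<times> b \<in> sets ?R" unfolding sets_restrict_space by (intro image_eqI[of _ _ "a' \<times> b'"]) auto
    qed
  qed (use sets.top[of ?R] in \<open>simp add: space_restrict_space space_pair_measure\<close>)
  moreover have "sets ?R \<subseteq> sets ?P"
  proof
    fix A assume "A \<in> sets ?R"
    then obtain A' where A': "A' \<in> sets (borel \<Otimes>\<^sub>M borel)" "A = (S \<times> T) \<inter> A'" by (auto simp: sets_restrict_space)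
    have id: "(\<lambda>x. x) \<in> restrict_space borel U \<rightarrow>\<^sub>M borel" for U :: "'c::topological_space set"
      by (rule measurable_restrict_space1) simp
    have "(\<lambda>p. (fst p, snd p)) \<in> ?P \<rightarrow>\<^sub>M borel \<Otimes>\<^sub>M borel"
      by (intro measurable_Pair measurable_compose[OF measurable_fst id] measurable_compose[OF measurable_snd id])
    from measurable_sets[OF this A'(1)] show "A \<in> sets ?P" by (simp add: sp A'(2) Int_commute)
  qed
  ultimately show ?thesis by (simp add: borel_prod)
qed

lemma prob_haar_prod:
  assumes M: "prob_haar G M" and N: "prob_haar H N"
  shows "prob_haar (G \<times>\<times> H) (M \<Otimes>\<^sub>M N)"
proof -
  interpret M: prob_haar G M by fact
  interpret N: prob_haar H N by fact
  interpret P: pair_prob_space M N ..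
  interpret GH: group "G \<times>\<times> H" by (intro DirProd_group M.is_group N.is_group)
  have mult: "(\<lambda>(x, y). x \<otimes>\<^bsub>G \<times>\<times> H\<^esub> y) = (\<lambda>p. (fst (fst p) \<otimes>\<^bsub>G\<^esub> fst (snd p), snd (fst p) \<otimes>\<^bsub>H\<^esub> snd (snd p)))"
    by (auto simp: DirProd_def fun_eq_iff)
  show ?thesis
  proof unfold_locales
    show "space (M \<Otimes>\<^sub>M N) = carrier (G \<times>\<times> H)" 
      by (simp add: space_pair_measure DirProd_def M.space_eq N.space_eq)
    show "(\<lambda>(x, y). x \<otimes>\<^bsub>G \<times>\<times> H\<^esub> y) \<in> (M \<Otimes>\<^sub>M N) \<Otimes>\<^sub>M (M \<Otimes>\<^sub>M N) \<rightarrow>\<^sub>M M \<Otimes>\<^sub>M N"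
      unfolding mult by measurable
    have "(\<lambda>p. (inv\<^bsub>G\<^esub> fst p, inv\<^bsub>H\<^esub> snd p)) \<in> M \<Otimes>\<^sub>M N \<rightarrow>\<^sub>M M \<Otimes>\<^sub>M N" by measurable
    also have "?this \<longleftrightarrow> (\<lambda>x. inv\<^bsub>G \<times>\<times> H\<^esub> x) \<in> M \<Otimes>\<^sub>M N \<rightarrow>\<^sub>M M \<Otimes>\<^sub>M N"
      by (intro measurable_cong) (auto simp: space_pair_measure M.space_eq N.space_eq inv_DirProd M.is_group N.is_group)
    finally show "(\<lambda>x. inv\<^bsub>G \<times>\<times> H\<^esub> x) \<in> M \<Otimes>\<^sub>M N \<rightarrow>\<^sub>M M \<Otimes>\<^sub>M N" .
    fix p assume "p \<in> carrier (G \<times>\<times> H)"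
    then obtain g h where p: "p = (g, h)" and [measurable]: "g \<in> carrier G" "h \<in> carrier H" by (auto simp: DirProd_def)
    have "distr (M \<Otimes>\<^sub>M N) (M \<Otimes>\<^sub>M N) (\<lambda>(x, y). (g \<otimes>\<^bsub>G\<^esub> x, h \<otimes>\<^bsub>H\<^esub> y)) = 
      distr M M (\<lambda>x. g \<otimes>\<^bsub>G\<^esub> x) \<Otimes>\<^sub>M distr N N (\<lambda>x. h \<otimes>\<^bsub>H\<^esub> x)"
      by (rule pair_measure_distr[symmetric]) 
        (simp_all add: N.distr_left_mult N.sigma_finite_measure_axioms \<open>h \<in> carrier H\<close>)
    also have "\<dots> = M \<Otimes>\<^sub>M N" 
      using N.distr_left_mult[OF \<open>h \<in> carrier H\<close>] M.distr_left_mult[OF \<open>g \<in> carrier G\<close>] by simp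
    also have "(\<lambda>(x, y). (g \<otimes>\<^bsub>G\<^esub> x, h \<otimes>\<^bsub>H\<^esub> y)) = (\<lambda>x. p \<otimes>\<^bsub>G \<times>\<times> H\<^esub> x)"
      by (auto simp: DirProd_def fun_eq_iff p)
    finally show "distr (M \<Otimes>\<^sub>M N) (M \<Otimes>\<^sub>M N) (\<lambda>x. p \<otimes>\<^bsub>G \<times>\<times> H\<^esub> x) = M \<Otimes>\<^sub>M N" .
  qed
qed

text \<open>On a compact group the total mass is finite and nonzero, so every Haar measure is a
  positive multiple \<open>c\<close> of a probability measure.\<close>

lemma haar_measure_normalize:
  assumes haar: "haar_measure G \<nu>" and compact: "compact (carrier G)" and group: "group G"
    and sets: "sets B = sets (restrict_space borel (carrier G))"
    and mult: "(\<lambda>(x, y). x \<otimes>\<^bsub>G\<^esub> y) \<in> B \<Otimes>\<^sub>M B \<rightarrow>\<^sub>M B"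
    and inv: "(\<lambda>x. inv\<^bsub>G\<^esub> x) \<in> B \<rightarrow>\<^sub>M B"
  obtains M c where "prob_haar G M" "c > 0" "sets M = sets B" "\<nu> = density M (\<lambda>_. ennreal c)"
proof -
  interpret group G by fact
  have [measurable_cong]: "sets \<nu> = sets B" using haar sets by (simp add: haar_measure_def)
  have sp: "space \<nu> = carrier G" 
    using haar sets_eq_imp_space_eq[of \<nu> "restrict_space borel (carrier G)"]
    by (simp add: haar_measure_def space_restrict_space)
  define c where "c = enn2real (emeasure \<nu> (space \<nu>))"
  have fin: "emeasure \<nu> (space \<nu>) < \<infinity>" and pos: "emeasure \<nu> (space \<nu>) \<noteq> 0"
    using haar compact unfolding haar_measure_def sp by (blast, blast)
  have c: "emeasure \<nu> (space \<nu>) = ennreal c" using fin by (simp add: c_def)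
  have c0: "c > 0" using pos c by (metis ennreal_0 enn2real_nonneg c_def le_less)
  define M where "M = density \<nu> (\<lambda>_. ennreal (1 / c))"
  have sM: "sets M = sets B" "space M = carrier G" using \<open>sets \<nu> = sets B\<close> sp by (auto simp: M_def)
  have eM: "emeasure M A = ennreal (1 / c) * emeasure \<nu> A" if "A \<in> sets \<nu>" for A
    unfolding M_def using that by (simp add: emeasure_density_const)
  have "\<nu> = density M (\<lambda>_. ennreal c)"
  proof (rule measure_eqI)
    fix A assume A: "A \<in> sets \<nu>"
    hence "A \<in> sets M" by (simp add: M_def)
    hence "emeasure (density M (\<lambda>_. ennreal c)) A = ennreal c * (ennreal (1 / c) * emeasure \<nu> A)"
      using A by (simp add: emeasure_density_const eM)
    also have "\<dots> = emeasure \<nu> A" using c0 by (simp add: mult.assoc[symmetric] ennreal_mult[symmetric])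
    finally show "emeasure \<nu> A = emeasure (density M (\<lambda>_. ennreal c)) A" ..
  qed (simp add: M_def)
  moreover have "prob_haar G M"
  proof (intro prob_haar.intro prob_haar_axioms.intro group)
    show "prob_space M"
    proof
      have "emeasure M (space M) = ennreal (1 / c) * ennreal c" 
        using c eM[of "space \<nu>"] by (simp add: M_def)
      thus "emeasure M (space M) = 1" using c0 by (simp add: ennreal_mult[symmetric])
    qed
    show "space M = carrier G" by fact
    show "(\<lambda>(x, y). x \<otimes>\<^bsub>G\<^esub> y) \<in> M \<Otimes>\<^sub>M M \<rightarrow>\<^sub>M M"
      using mult by (simp cong: measurable_cong_sets add: sM sets_pair_measure_cong[OF sM(1) sM(1)])
    show "(\<lambda>x. inv\<^bsub>G\<^esub> x) \<in> M \<rightarrow>\<^sub>M M" using inv by (simp cong: measurable_cong_sets add: sM)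
    fix g assume g: "g \<in> carrier G"
    have spB: "space B = carrier G" using sets_eq_imp_space_eq[OF sets] by (simp add: space_restrict_space)
    have "(\<lambda>x. (\<lambda>(x, y). x \<otimes>\<^bsub>G\<^esub> y) (g, x)) \<in> B \<rightarrow>\<^sub>M B"
      using g spB by (intro measurable_compose[OF _ mult]) simp
    hence gm: "(\<lambda>x. g \<otimes>\<^bsub>G\<^esub> x) \<in> M \<rightarrow>\<^sub>M M" by (simp cong: measurable_cong_sets add: sM)
    show "distr M M (\<lambda>x. g \<otimes>\<^bsub>G\<^esub> x) = M"
    proof (rule measure_eqI)
      fix A assume "A \<in> sets (distr M M (\<lambda>x. g \<otimes>\<^bsub>G\<^esub> x))"
      hence A: "A \<in> sets M" by simp
      \<comment> \<open>Invariance is given for images of sets, whereas \<open>distr\<close> uses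
        preimages; the group structure makes \<open>A\<close> the image of its preimage.\<close>
      define C where "C = (\<lambda>x. g \<otimes>\<^bsub>G\<^esub> x) -` A \<inter> space M"
      have C: "C \<in> sets M" unfolding C_def using gm A by (rule measurable_sets)
      have AC: "A \<subseteq> carrier G" using sets.sets_into_space[OF A] sM by simp
      have "A \<subseteq> (\<lambda>x. g \<otimes>\<^bsub>G\<^esub> x) ` C"
      proof
        fix a assume a: "a \<in> A"
        hence "a \<in> carrier G" using AC by blast
        hence "a = g \<otimes>\<^bsub>G\<^esub> (inv\<^bsub>G\<^esub> g \<otimes>\<^bsub>G\<^esub> a)" "inv\<^bsub>G\<^esub> g \<otimes>\<^bsub>G\<^esub> a \<in> carrier G"
          using g by (simp_all add: m_assoc[symmetric])
        thus "a \<in> (\<lambda>x. g \<otimes>\<^bsub>G\<^esub> x) ` C" using a sM by (intro image_eqI[of _ _ "inv\<^bsub>G\<^esub> g \<otimes>\<^bsub>G\<^esub> a"]) (auto simp: C_def)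
      qed
      hence im: "(\<lambda>x. g \<otimes>\<^bsub>G\<^esub> x) ` C = A" by (auto simp: C_def)
      have "emeasure \<nu> A = emeasure \<nu> C"
        using haar g C im \<open>sets \<nu> = sets B\<close> sM unfolding haar_measure_def by auto
      hence "emeasure M C = emeasure M A" using A C sM \<open>sets \<nu> = sets B\<close> by (simp add: eM)
      thus "emeasure (distr M M (\<lambda>x. g \<otimes>\<^bsub>G\<^esub> x)) A = emeasure M A"
        using A gm by (simp add: emeasure_distr C_def)
    qed simp
  qed
  ultimately show ?thesis using that c0 sM by blast
qed

section \<open>Chebyshev polynomials and the Poisson kernel\<close>

text \<open>\<open>cheb_V d\<close> is the Chebyshev polynomial of the second kind of degree d - 1,
  so that the index is the dimension of a representation and \<open>cheb_V 0\<close> is zero. The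
  joint recursion is the addition theorem for cosine and sine with one factor of sine divided
  out.\<close>

fun cheb_T :: "nat \<Rightarrow> real poly" and cheb_V :: "nat \<Rightarrow> real poly" where
  "cheb_T 0 = 1"
| "cheb_T (Suc d) = [:0, 1:] * cheb_T d - (1 - [:0, 1:]\<^sup>2) * cheb_V d"
| "cheb_V 0 = 0"
| "cheb_V (Suc d) = [:0, 1:] * cheb_V d + cheb_T d"

lemma cheb_cos:
  "poly (cheb_T d) (cos a) = cos (real d * a)"
  "sin a * poly (cheb_V d) (cos a) = sin (real d * a)"
proof (induction d)
  case (Suc d)
  case 1
  have "poly (cheb_T (Suc d)) (cos a) = cos a * cos (real d * a) - sin a * (sin a * poly (cheb_V d) (cos a))"
  proof -
    have "1 - (cos a)\<^sup>2 = sin a * sin a" unfolding power2_eq_square[of "sin a", symmetric] using sin_cos_squared_add[of a] by linarith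
    thus ?thesis using Suc(1) by (simp add: power2_eq_square)
  qed
  thus ?case using Suc by (simp add: cos_add distrib_right)
  case 2
  show ?case using Suc by (simp add: sin_add distrib_right algebra_simps)
qed auto

text \<open>These are the derivatives of cos(d \<theta>) and sin(d \<theta>) / sin \<theta> with
  respect to cos \<theta>, with the denominator \<open>1 - x\<^sup>2\<close> cleared. Each identity
  needs the other in the induction step.\<close>

lemma pderiv_cheb:
  "pderiv (cheb_T d) = of_nat d * cheb_V d"
  "(1 - [:0, 1:]\<^sup>2) * pderiv (cheb_V d) = [:0, 1:] * cheb_V d - of_nat d * cheb_T d"
proof (induction d)
  case (Suc d)
  have X: "pderiv ([:0, 1:] :: real poly) = 1" by (simp add: pderiv_pCons)
  define x where "x = ([:0, 1:] :: real poly)"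
  have x: "pderiv x = 1" by (simp add: X x_def)
  have y: "pderiv (x\<^sup>2) = 2 * x"
    by (simp add: power2_eq_square pderiv_mult x)
  note IH = Suc[folded x_def]
  note rec = cheb_T.simps(2)[folded x_def] cheb_V.simps(2)[folded x_def]
  case 1
  have "pderiv (cheb_T (Suc d)) = x * (of_nat d * cheb_V d) + cheb_T d + 2 * x * cheb_V d - (1 - x\<^sup>2) * pderiv (cheb_V d)"
    unfolding rec pderiv_diff pderiv_mult y x IH(1) by (simp add: pderiv_1 algebra_simps)
  also have "\<dots> = of_nat (Suc d) * cheb_V (Suc d)" unfolding IH(2) rec by (simp add: algebra_simps)
  finally show ?case .
  case 2
  have "(1 - x\<^sup>2) * pderiv (cheb_V (Suc d)) = (1 - x\<^sup>2) * cheb_V d + x * ((1 - x\<^sup>2) * pderiv (cheb_V d)) + (1 - x\<^sup>2) * (of_nat d * cheb_V d)"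
    unfolding rec by (simp add: pderiv_mult pderiv_add x IH(1) algebra_simps)
  also have "\<dots> = x * cheb_V (Suc d) - of_nat (Suc d) * cheb_T (Suc d)"
    unfolding IH(2) rec by (simp add: algebra_simps power2_eq_square)
  finally show ?case by (simp only: x_def)
qed (auto simp: pderiv_1)

text \<open>Differentiating the second identity of \<open>pderiv_cheb\<close> gives the Chebyshev
  differential equation, the radial form of the eigenvalue equation for the Casimir
  operator.\<close>

lemma cheb_V_ode:
  "(1 - [:0, 1:]\<^sup>2) * pderiv (pderiv (cheb_V d)) - 3 * [:0, 1:] * pderiv (cheb_V d) = - of_nat (d\<^sup>2) * cheb_V d + cheb_V d"
proof -
  define x where "x = ([:0, 1:] :: real poly)"
  have x: "pderiv x = 1" by (simp add: x_def pderiv_pCons)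
  note P = pderiv_cheb[folded x_def]
  have of_nat: "pderiv (of_nat d :: real poly) = 0" by (metis of_nat_poly pderiv_0 pderiv_pCons pCons_0_0 add_0)
  have "pderiv ((1 - x\<^sup>2) * pderiv (cheb_V d)) = pderiv (x * cheb_V d - of_nat d * cheb_T d)"
    by (simp only: P)
  hence "(1 - x\<^sup>2) * pderiv (pderiv (cheb_V d)) - 2 * x * pderiv (cheb_V d) 
    = cheb_V d + x * pderiv (cheb_V d) - of_nat d * (of_nat d * cheb_V d)"
    by (simp add: pderiv_mult pderiv_diff pderiv_1 x P(1) of_nat power2_eq_square algebra_simps)
  thus ?thesis unfolding x_def[symmetric] by (simp add: algebra_simps power2_eq_square)
qed

lemma cheb_V_ode_poly:
  "(1 - t\<^sup>2) * poly (pderiv (pderiv (cheb_V d))) t - 3 * t * poly (pderiv (cheb_V d)) t = (1 - (real d)\<^sup>2) * poly (cheb_V d) t"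
  using arg_cong[OF cheb_V_ode, of "\<lambda>p. poly p t"] by (simp add: algebra_simps)

lemma cheb_V_rec: "poly (cheb_V (Suc (Suc d))) t = 2 * t * poly (cheb_V (Suc d)) t - poly (cheb_V d) t"
  by (simp add: algebra_simps power2_eq_square)

text \<open>The recursion adds to \<open>t * poly (cheb_V d) t\<close> a value of
  \<open>cheb_T d\<close>, which is a cosine, so the bound grows by at most 1 per step.\<close>

lemma cheb_bound:
  assumes "\<bar>t\<bar> \<le> 1"
  shows "\<bar>poly (cheb_T d) t\<bar> \<le> 1" "\<bar>poly (cheb_V d) t\<bar> \<le> real d"
proof -
  have t: "t = cos (arccos t)" using assms by simp
  show T: "\<bar>poly (cheb_T d) t\<bar> \<le> 1" for d by (subst t) (simp add: cheb_cos)
  show "\<bar>poly (cheb_V d) t\<bar> \<le> real d"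
  proof (induction d)
    case (Suc d)
    have "\<bar>t * poly (cheb_V d) t\<bar> \<le> real d"
      using Suc assms by (simp add: abs_mult) (metis abs_ge_zero mult_left_le_one_le order_trans)
    thus ?case using T[of d] abs_triangle_ineq[of "t * poly (cheb_V d) t" "poly (cheb_T d) t"] by simp
  qed auto
qed

lemma cheb_one: "poly (cheb_T d) 1 = 1" "poly (cheb_V d) 1 = real d"
  by (induction d) auto

lemma cheb_minus:
  "poly (cheb_T d) (- t) = (- 1) ^ d * poly (cheb_T d) t"
  "poly (cheb_V d) (- t) = (- 1) ^ Suc d * poly (cheb_V d) t"
  by (induction d) (auto simp: algebra_simps)

section \<open>The Poisson kernel\<close>

lemma summable_power2_mult_power:
  fixes r :: real
  assumes "0 \<le> r" "r < 1"
  shows "summable (\<lambda>d. (real d)\<^sup>2 * r ^ d)"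
proof -
  have 1: "summable (\<lambda>n. diffs (\<lambda>n. diffs (\<lambda>_. 1) n) n * x ^ n)" if "norm x < 1" for x :: real
    by (rule termdiff_converges[OF that], rule termdiff_converges[where K = 1]) (auto intro: summable_geometric)
  have "summable (\<lambda>n. diffs (\<lambda>n. diffs (\<lambda>_. 1) n) n * r ^ n)" using assms by (intro 1) auto
  hence "summable (\<lambda>n. (1 + real n) * (2 + real n) * r ^ n)" by (simp add: diffs_def add.commute)
  thus ?thesis
  proof (rule summable_comparison_test')
    fix n
    have "(real n)\<^sup>2 \<le> (1 + real n) * (2 + real n)" by (simp add: power2_eq_square algebra_simps)
    thus "norm ((real n)\<^sup>2 * r ^ n) \<le> (1 + real n) * (2 + real n) * r ^ n"
      using assms by (auto intro!: mult_right_mono)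
  qed
qed

text \<open>The three term recurrence of \<open>cheb_V\<close> turns into one linear equation for
  each of the sums of \<open>r ^ d * V d\<close> and of \<open>d * r ^ d * V d\<close>; solving them
  successively gives r / q and then the Poisson kernel.\<close>

lemma poisson_sums:
  fixes r t :: real
  assumes r: "0 \<le> r" "r < 1" and t: "\<bar>t\<bar> \<le> 1"
  shows "(\<lambda>d. real d * r ^ d * poly (cheb_V d) t) sums (r * (1 - r\<^sup>2) / (1 - 2 * r * t + r\<^sup>2)\<^sup>2)"
proof -
  define V where "V = (\<lambda>d. poly (cheb_V d) t)"
  define q where "q = 1 - 2 * r * t + r\<^sup>2"
  have "r * t \<le> r" using r t by (intro mult_left_le) auto
  hence "q \<ge> (1 - r)\<^sup>2" by (simp add: q_def power2_diff)
  hence q: "q > 0" using r by (smt (verit) zero_less_power2)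
  have V: "\<bar>V d\<bar> \<le> real d" for d unfolding V_def by (rule cheb_bound[OF t])
  have sB: "summable (\<lambda>d. real d * r ^ d * V d)"
  proof (rule summable_comparison_test'[OF summable_power2_mult_power[OF r]])
    fix d show "norm (real d * r ^ d * V d) \<le> (real d)\<^sup>2 * r ^ d"
      using mult_left_mono[OF V[of d], of "real d * r ^ d"] r by (simp add: abs_mult power2_eq_square mult_ac)
  qed
  have sA: "summable (\<lambda>d. r ^ d * V d)"
  proof (rule summable_comparison_test'[OF summable_power2_mult_power[OF r]])
    fix d 
    have "\<bar>V d\<bar> \<le> (real d)\<^sup>2" using V[of d] by (cases d) (auto simp: power2_eq_square intro: order_trans)
    from mult_left_mono[OF this, of "r ^ d"] show "norm (r ^ d * V d) \<le> (real d)\<^sup>2 * r ^ d"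
      using r by (simp add: abs_mult mult_ac)
  qed
  have rec: "V (Suc (Suc d)) = 2 * t * V (Suc d) - V d" for d unfolding V_def by (rule cheb_V_rec)
  have V01: "V 0 = 0" "V (Suc 0) = 1" by (simp_all add: V_def)
  define A where "A = (\<Sum>d. r ^ d * V d)"
  define B where "B = (\<Sum>d. real d * r ^ d * V d)"
  have A: "(\<lambda>d. r ^ d * V d) sums A" and B: "(\<lambda>d. real d * r ^ d * V d) sums B"
    using sA sB by (simp_all add: A_def B_def summable_sums)
  \<comment> \<open>Shifting the index drops \<open>V 0 = 0\<close> at no cost, and the next shift
    drops \<open>V 1 = 1\<close>, which contributes \<open>r\<close>.\<close>
  have A1: "(\<lambda>d. r ^ Suc d * V (Suc d)) sums A" using A by (subst sums_Suc_iff) (simp add: V01)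
  have B1: "(\<lambda>d. real (Suc d) * r ^ Suc d * V (Suc d)) sums B" using B by (subst sums_Suc_iff) (simp add: V01)
  have A2: "(\<lambda>d. r ^ Suc (Suc d) * V (Suc (Suc d))) sums (A - r)" using A1 by (subst sums_Suc_iff) (simp add: V01)
  have B2: "(\<lambda>d. real (Suc (Suc d)) * r ^ Suc (Suc d) * V (Suc (Suc d))) sums (B - r)"
    using B1 by (subst sums_Suc_iff[where f = "\<lambda>d. real (Suc d) * r ^ Suc d * V (Suc d)"]) (simp add: V01)
  have "(\<lambda>d. 2 * r * t * (r ^ Suc d * V (Suc d)) - r\<^sup>2 * (r ^ d * V d)) sums (2 * r * t * A - r\<^sup>2 * A)"
    by (intro sums_diff sums_mult A1 A)
  also have "(\<lambda>d. 2 * r * t * (r ^ Suc d * V (Suc d)) - r\<^sup>2 * (r ^ d * V d)) = (\<lambda>d. r ^ Suc (Suc d) * V (Suc (Suc d)))"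
    unfolding rec by (simp add: algebra_simps power2_eq_square)
  finally have "A - r = 2 * r * t * A - r\<^sup>2 * A" using A2 sums_unique2 by blast
  hence Aq: "A * q = r" by (simp add: q_def algebra_simps)
  have "(\<lambda>d. 2 * r * t * (real (Suc d) * r ^ Suc d * V (Suc d) + r ^ Suc d * V (Suc d)) - 
      r\<^sup>2 * (real d * r ^ d * V d + 2 * (r ^ d * V d))) sums (2 * r * t * (B + A) - r\<^sup>2 * (B + 2 * A))"
    by (intro sums_diff sums_mult sums_add A1 B1 A B)
  also have "(\<lambda>d. 2 * r * t * (real (Suc d) * r ^ Suc d * V (Suc d) + r ^ Suc d * V (Suc d)) - 
      r\<^sup>2 * (real d * r ^ d * V d + 2 * (r ^ d * V d))) = (\<lambda>d. real (Suc (Suc d)) * r ^ Suc (Suc d) * V (Suc (Suc d)))"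
    unfolding rec by (simp add: algebra_simps power2_eq_square)
  finally have "B - r = 2 * r * t * (B + A) - r\<^sup>2 * (B + 2 * A)" using B2 sums_unique2 by blast
  hence "B * q = r + 2 * r * t * A - 2 * r\<^sup>2 * A" by (simp add: q_def algebra_simps)
  hence "B * q\<^sup>2 = r * q + 2 * r * t * (A * q) - 2 * r\<^sup>2 * (A * q)" by algebra
  also have "\<dots> = r * (1 - r\<^sup>2)" unfolding Aq by (simp add: q_def power2_eq_square algebra_simps)
  finally have "B = r * (1 - r\<^sup>2) / q\<^sup>2" using q by (simp add: field_simps)
  thus ?thesis using B by (simp add: V_def q_def)
qed

text \<open>Integration by parts on the group will show that the derivatives of the polynomials
  \<open>(\<rho>\<^sup>2 - s\<^sup>2) q(s)\<close> have integral zero, so only the affine part of \<open>W\<close> matters.\<close>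

lemma poly_split_roots:
  fixes W :: "real poly"
  shows "\<exists>\<alpha> \<beta> q. W = [:\<alpha>, \<beta>:] + [:\<rho>\<^sup>2, 0, -1:] * q"
proof (induction W)
  case (pCons a p)
  then obtain \<alpha> \<beta> q where p: "p = [:\<alpha>, \<beta>:] + [:\<rho>\<^sup>2, 0, -1:] * q" by blast
  have "pCons a p = [:a:] + [:0, 1:] * p" by simp
  also have "\<dots> = [:a + \<beta> * \<rho>\<^sup>2, \<alpha>:] + [:\<rho>\<^sup>2, 0, -1:] * ([:0, 1:] * q - [:\<beta>:])"
    unfolding p by (simp add: algebra_simps)
  finally show ?case by blast
qed (intro exI[of _ 0], simp)

section \<open>The group SU(2)\<close>

lemma mat2_mult_nth: fixes B :: mat2 shows "((A :: mat2) ** B) $ i $ j = A $ i $ 1 * B $ 1 $ j + A $ i $ 2 * B $ 2 $ j"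
  by (simp add: matrix_matrix_mult_def sum_2)

lemma mat2_eq_iff: "(A :: mat2) = B \<longleftrightarrow> A $ 1 $ 1 = B $ 1 $ 1 \<and> A $ 1 $ 2 = B $ 1 $ 2 \<and> A $ 2 $ 1 = B $ 2 $ 1 \<and> A $ 2 $ 2 = B $ 2 $ 2"
  by (auto simp: vec_eq_iff forall_2)

lemma mat2_one_nth: "(mat 1 :: mat2) $ i $ j = (if i = j then 1 else 0)"
  by (simp add: mat_def)

lemma conj_transpose_nth: "conj_transpose A $ i $ j = cnj (A $ j $ i)"
  by (simp add: conj_transpose_def map_matrix_def transpose_def)

lemmas mat2_simps = mat2_eq_iff mat2_mult_nth mat2_one_nth conj_transpose_nth

lemma mat2_scaleR_left: fixes A B C :: mat2 shows "(a *\<^sub>R (A :: mat2)) ** B = a *\<^sub>R (A ** B)"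
  by (simp add: mat2_simps scaleR_add_right)

lemma mat2_scaleR_right: fixes A B C :: mat2 shows "(A :: mat2) ** (a *\<^sub>R B) = a *\<^sub>R (A ** B)"
  by (simp add: mat2_simps scaleR_add_right)

lemma mat2_diff_right: fixes A B C :: mat2 shows "(A :: mat2) ** (B - C) = A ** B - A ** C"
  by (simp add: mat2_simps algebra_simps)

lemma mat2_diff_left: fixes A B C :: mat2 shows "((B :: mat2) - C) ** A = B ** A - C ** A"
  by (simp add: mat2_simps algebra_simps)

lemma mat2_minus_right: fixes A B C :: mat2 shows "(A :: mat2) ** (- B) = - (A ** B)"
  by (simp add: mat2_simps algebra_simps)

lemma mat2_minus_left: fixes A B C :: mat2 shows "(- (A :: mat2)) ** B = - (A ** B)"
  by (simp add: mat2_simps algebra_simps)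

lemma mat2_add_right: fixes A B C :: mat2 shows "A ** (B + C) = A ** B + A ** C"
  by (simp add: mat2_simps algebra_simps)

lemma mat2_add_left: fixes A B C :: mat2 shows "(B + C) ** A = B ** A + C ** A"
  by (simp add: mat2_simps algebra_simps)

lemmas mat2_distribs = mat2_add_right mat2_add_left mat2_scaleR_left mat2_scaleR_right
  mat2_diff_left mat2_diff_right mat2_minus_left mat2_minus_right

lemma continuous_on_mat2_mult [continuous_intros]:
  fixes f g :: "'a::topological_space \<Rightarrow> mat2"
  assumes "continuous_on S f" "continuous_on S g"
  shows "continuous_on S (\<lambda>x. f x ** g x)"
  unfolding matrix_matrix_mult_def sum_2 
  by (intro continuous_intros assms continuous_on_vec_lambda)

lemma continuous_on_conj_transpose [continuous_intros]:
  assumes "continuous_on S f"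
  shows "continuous_on S (\<lambda>x. conj_transpose (f x))"
proof -
  have "conj_transpose A = (\<chi> i j. cnj (A $ j $ i))" for A by (simp add: vec_eq_iff conj_transpose_nth)
  thus ?thesis by (simp only:) (intro continuous_intros assms continuous_on_vec_lambda)
qed

text \<open>An element of SU(2) has eigenvalues exp(\<plusminus> i \<theta>) and real trace, so this
  is cos \<theta>. Taking the real part makes it a real linear functional on all matrices, which is
  convenient for derivatives.\<close>

definition half_trace :: "mat2 \<Rightarrow> real" where
  "half_trace A = Re (A $ 1 $ 1 + A $ 2 $ 2) / 2"

lemma bounded_linear_half_trace: "bounded_linear half_trace"
proof -
  have "linear half_trace"
    by (rule linearI) (auto simp: half_trace_def field_simps)
  thus ?thesis by (rule linear_conv_bounded_linear[THEN iffD1])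
qed

lemma half_trace_simps [simp]:
  "half_trace (A + B) = half_trace A + half_trace B"
  "half_trace (A - B) = half_trace A - half_trace B"
  "half_trace (- A) = - half_trace A"
  "half_trace (a *\<^sub>R A) = a * half_trace A"
  "half_trace 0 = 0"
  "half_trace (mat 1) = 1"
  by (auto simp: half_trace_def mat2_one_nth field_simps)

lemma half_trace_commute: "half_trace (A ** B) = half_trace (B ** A)"
  by (simp add: half_trace_def mat2_mult_nth algebra_simps)

lemma continuous_on_half_trace [continuous_intros]:
  "continuous_on S f \<Longrightarrow> continuous_on S (\<lambda>x. half_trace (f x))"
  by (rule bounded_linear.continuous_on[OF bounded_linear_half_trace])

lemma SU2_group: "group SU2"
proof (rule groupI)
  fix x y assume xy: "x \<in> carrier SU2" "y \<in> carrier SU2"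
  have ct: "conj_transpose (x ** y) = conj_transpose y ** conj_transpose x"
    by (simp add: mat2_simps algebra_simps)
  have "conj_transpose (x ** y) ** (x ** y) = conj_transpose y ** (conj_transpose x ** x) ** y"
    unfolding ct by (simp add: matrix_mul_assoc)
  moreover have "(x ** y) ** conj_transpose (x ** y) = x ** (y ** conj_transpose y) ** conj_transpose x"
    unfolding ct by (simp add: matrix_mul_assoc)
  ultimately show "x \<otimes>\<^bsub>SU2\<^esub> y \<in> carrier SU2"
    using xy by (simp add: SU2_def det_mul)
next
  fix x assume x: "x \<in> carrier SU2"
  have "det (conj_transpose x) = cnj (det x)"
    by (simp add: det_2 conj_transpose_nth)
  moreover have "conj_transpose (conj_transpose x) = x" by (simp add: mat2_simps)
  ultimately have "conj_transpose x \<in> carrier SU2" using x by (simp add: SU2_def)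
  thus "\<exists>y\<in>carrier SU2. y \<otimes>\<^bsub>SU2\<^esub> x = \<one>\<^bsub>SU2\<^esub>"
    using x by (intro bexI[of _ "conj_transpose x"]) (auto simp: SU2_def)
qed (auto simp: SU2_def matrix_mul_assoc conj_transpose_def mat2_simps)

lemma SU2_mult [simp]: "x \<otimes>\<^bsub>SU2\<^esub> y = x ** y" and SU2_one [simp]: "\<one>\<^bsub>SU2\<^esub> = mat 1"
  by (simp_all add: SU2_def)

interpretation SU2: group SU2 by (rule SU2_group)

lemma SU2_conj_transpose:
  assumes "x \<in> carrier SU2"
  shows "conj_transpose x \<in> carrier SU2" "conj_transpose x ** x = mat 1" "x ** conj_transpose x = mat 1"
    "inv\<^bsub>SU2\<^esub> x = conj_transpose x"
proof -
  have "det (conj_transpose x) = cnj (det x)"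
    by (simp add: det_2 conj_transpose_nth)
  moreover have "conj_transpose (conj_transpose x) = x" by (simp add: mat2_simps)
  ultimately show *: "conj_transpose x \<in> carrier SU2" using assms by (simp add: SU2_def)
  show **: "conj_transpose x ** x = mat 1" "x ** conj_transpose x = mat 1" using assms by (auto simp: SU2_def)
  show "inv\<^bsub>SU2\<^esub> x = conj_transpose x"
    by (rule SU2.inv_equality) (use * ** assms in auto)
qed

lemma SU2_mult_closed: "x \<in> carrier SU2 \<Longrightarrow> y \<in> carrier SU2 \<Longrightarrow> x ** y \<in> carrier SU2"
  using SU2.m_closed by simp

lemma SU2_entries:
  assumes "x \<in> carrier SU2"
  shows "x $ 2 $ 1 = - cnj (x $ 1 $ 2)" "x $ 2 $ 2 = cnj (x $ 1 $ 1)"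
    "x $ 1 $ 1 * cnj (x $ 1 $ 1) + x $ 1 $ 2 * cnj (x $ 1 $ 2) = 1"
proof -
  have 1: "x $ 1 $ 1 * cnj (x $ 1 $ 1) + x $ 1 $ 2 * cnj (x $ 1 $ 2) = 1"
    and 2: "x $ 2 $ 1 * cnj (x $ 1 $ 1) + x $ 2 $ 2 * cnj (x $ 1 $ 2) = 0"
    and 3: "x $ 1 $ 1 * x $ 2 $ 2 - x $ 1 $ 2 * x $ 2 $ 1 = 1"
    using assms by (auto simp: SU2_def mat2_simps det_2)
  show "x $ 1 $ 1 * cnj (x $ 1 $ 1) + x $ 1 $ 2 * cnj (x $ 1 $ 2) = 1" by fact
  show "x $ 2 $ 2 = cnj (x $ 1 $ 1)" using 1 2 3 by algebra
  show "x $ 2 $ 1 = - cnj (x $ 1 $ 2)" using 1 2 3 by algebra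
qed

lemma SU2_closed: "closed (carrier SU2)"
proof -
  have "continuous_on UNIV (\<lambda>A :: mat2. conj_transpose A ** A)" "continuous_on UNIV (\<lambda>A :: mat2. A ** conj_transpose A)"
    "continuous_on UNIV (\<lambda>A :: mat2. det A)"
    unfolding det_2 by (intro continuous_intros)+
  hence "closed ({A :: mat2. conj_transpose A ** A = mat 1} \<inter> {A. A ** conj_transpose A = mat 1} \<inter> {A. det A = 1})"
    by (intro closed_Int closed_Collect_eq continuous_on_const)
  thus ?thesis by (simp add: SU2_def Collect_conj_eq Int_assoc)
qed

lemma SU2_entry_bound:
  assumes "x \<in> carrier SU2"
  shows "norm (x $ i $ j) \<le> 1"
proof -
  have "of_real ((cmod (x $ 1 $ 1))\<^sup>2 + (cmod (x $ 1 $ 2))\<^sup>2) = (1 :: complex)"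
    using SU2_entries(3)[OF assms] by (simp only: of_real_add complex_norm_square)
  hence "(cmod (x $ 1 $ 1))\<^sup>2 + (cmod (x $ 1 $ 2))\<^sup>2 = 1" using of_real_eq_1_iff by blast
  hence "(cmod (x $ 1 $ 1))\<^sup>2 \<le> 1" "(cmod (x $ 1 $ 2))\<^sup>2 \<le> 1"
    by (smt (verit) zero_le_power2)+
  hence *: "cmod (x $ 1 $ 1) \<le> 1" "cmod (x $ 1 $ 2) \<le> 1" by (simp_all add: abs_square_le_1)
  have "i = 1 \<or> i = 2" "j = 1 \<or> j = 2" by (rule exhaust_2)+
  thus ?thesis using * SU2_entries(1,2)[OF assms] by auto
qed

lemma SU2_compact: "compact (carrier SU2)"
proof (rule compact_eq_bounded_closed[THEN iffD2], rule conjI[OF _ SU2_closed], rule boundedI)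
  fix x assume x: "x \<in> carrier SU2"
  have "norm x \<le> (\<Sum>i\<in>UNIV. norm (x $ i))" by (simp add: norm_vec_def L2_set_le_sum)
  also have "\<dots> \<le> (\<Sum>i\<in>UNIV. \<Sum>j\<in>UNIV. norm (x $ i $ j))"
    by (intro sum_mono) (simp add: norm_vec_def L2_set_le_sum)
  also have "\<dots> \<le> (\<Sum>i::2\<in>UNIV. \<Sum>j::2\<in>UNIV. 1)" by (intro sum_mono SU2_entry_bound x)
  finally show "norm x \<le> 4" by simp
qed

section \<open>The Lie algebra and its exponential map\<close>

lemma su2_entries:
  assumes "X \<in> su2"
  shows "X $ 2 $ 2 = - X $ 1 $ 1" "X $ 2 $ 1 = - cnj (X $ 1 $ 2)" "cnj (X $ 1 $ 1) = - X $ 1 $ 1"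
proof -
  have "X $ 1 $ 1 + X $ 2 $ 2 = 0" and "conj_transpose X = - X"
    using assms by (auto simp: su2_def trace_def sum_2)
  thus "X $ 2 $ 2 = - X $ 1 $ 1" "X $ 2 $ 1 = - cnj (X $ 1 $ 2)" "cnj (X $ 1 $ 1) = - X $ 1 $ 1"
    by (auto simp: mat2_simps add_eq_0_iff)
qed

lemma su2I:
  assumes "X $ 2 $ 2 = - X $ 1 $ 1" "X $ 2 $ 1 = - cnj (X $ 1 $ 2)" "cnj (X $ 1 $ 1) = - X $ 1 $ 1"
  shows "X \<in> su2"
  using assms by (auto simp: su2_def trace_def sum_2 mat2_simps)

text \<open>The imaginary unit quaternions, i times the Pauli matrices. Each squares to minus the
  identity; with this scaling the sum of the squared derivatives acts on \<open>su2_char d\<close>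
  as 1 - d^2.\<close>

definition su2_basis :: "nat \<Rightarrow> mat2" where
  "su2_basis k = (if k = 0 then vector [vector [\<i>, 0], vector [0, -\<i>]]
    else if k = 1 then vector [vector [0, 1], vector [-1, 0]]
    else vector [vector [0, \<i>], vector [\<i>, 0]])"

lemma su2_basis_nth:
  "su2_basis 0 $ 1 $ 1 = \<i>" "su2_basis 0 $ 1 $ 2 = 0" "su2_basis 0 $ 2 $ 1 = 0" "su2_basis 0 $ 2 $ 2 = -\<i>"
  "su2_basis (Suc 0) $ 1 $ 1 = 0" "su2_basis (Suc 0) $ 1 $ 2 = 1" "su2_basis (Suc 0) $ 2 $ 1 = -1" "su2_basis (Suc 0) $ 2 $ 2 = 0"
  "su2_basis 2 $ 1 $ 1 = 0" "su2_basis 2 $ 1 $ 2 = \<i>" "su2_basis 2 $ 2 $ 1 = \<i>" "su2_basis 2 $ 2 $ 2 = 0"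
  by (simp_all add: su2_basis_def vector_2)

lemma sum_lessThan_3: "(\<Sum>k<3. f k) = f 0 + f (Suc 0) + f (2::nat)"
  by (simp add: eval_nat_numeral)

lemma su2_basis_su2: "su2_basis k \<in> su2"
  by (rule su2I) (auto simp: su2_basis_def vector_2)

lemma su2_expand:
  assumes "X \<in> su2"
  shows "X = (\<Sum>k<3. [Im (X $ 1 $ 1), Re (X $ 1 $ 2), Im (X $ 1 $ 2)] ! k *\<^sub>R su2_basis k)"
  unfolding sum_lessThan_3 using su2_entries[OF assms]
  by (simp add: mat2_simps su2_basis_nth complex_eq_iff)

text \<open>The square root of the determinant on su(2), hence by Cayley-Hamilton the number r with
  \<open>X ** X\<close> equal to minus r^2 times the identity.\<close>

definition su2_norm :: "mat2 \<Rightarrow> real" where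
  "su2_norm X = sqrt ((Im (X $ 1 $ 1))\<^sup>2 + (cmod (X $ 1 $ 2))\<^sup>2)"

lemma su2_norm_sq: "(su2_norm X)\<^sup>2 = (Im (X $ 1 $ 1))\<^sup>2 + ((Re (X $ 1 $ 2))\<^sup>2 + (Im (X $ 1 $ 2))\<^sup>2)"
  by (simp add: su2_norm_def cmod_power2)

lemma su2_square:
  assumes "X \<in> su2"
  shows "X ** X = - (su2_norm X)\<^sup>2 *\<^sub>R mat 1"
  unfolding su2_norm_sq using su2_entries[OF assms] 
  by (simp add: mat2_simps complex_eq_iff power2_eq_square algebra_simps)

lemma su2_norm_eq_0:
  assumes "X \<in> su2" "su2_norm X = 0"
  shows "X = 0"
  using su2_entries[OF assms(1)] assms(2)
  by (auto simp: mat2_eq_iff su2_norm_def add_nonneg_eq_0_iff complex_eq_iff)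

lemma su2_basis_norm: "su2_norm (su2_basis k) = 1"
  by (auto simp: su2_norm_def su2_basis_def vector_2)

text \<open>Powers of \<open>A\<close> alternate between multiples of the identity and of
  \<open>A\<close>, so the exponential series splits into a cosine and a sine series. At
  \<open>s = 0\<close> the quotient \<open>sin s / s\<close> has the value 0, which is harmless
  since \<open>A\<close> is then zero.\<close>

lemma mat_exp_eq:
  assumes A: "A ** A = - s\<^sup>2 *\<^sub>R mat 1" and s: "s = 0 \<Longrightarrow> A = 0"
  shows "mat_exp A = cos s *\<^sub>R mat 1 + (sin s / s) *\<^sub>R A"
proof -
  have "(1 / fact n) *\<^sub>R (((**) A) ^^ n) (mat 1) = (cos_coeff n * s ^ n) *\<^sub>R mat 1 + (sin_coeff n * s ^ n / s) *\<^sub>R A" for n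
  proof (induction n)
    case (Suc n)
    have "(1 / fact (Suc n)) *\<^sub>R (((**) A) ^^ Suc n) (mat 1) = (1 / real (Suc n)) *\<^sub>R (A ** ((1 / fact n) *\<^sub>R (((**) A) ^^ n) (mat 1)))"
      by (simp add: mat2_distribs)
    also have "\<dots> = (cos_coeff n / real (Suc n) * s ^ n) *\<^sub>R A - (sin_coeff n / real (Suc n) * s ^ n / s * s\<^sup>2) *\<^sub>R mat 1"
      unfolding Suc.IH by (simp add: mat2_distribs A scaleR_diff_right)
    also have "\<dots> = (cos_coeff (Suc n) * s ^ Suc n) *\<^sub>R mat 1 + (sin_coeff (Suc n) * s ^ Suc n / s) *\<^sub>R A"
      using s by (cases "s = 0") (auto simp: cos_coeff_Suc sin_coeff_Suc power2_eq_square)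
    finally show ?case .
  qed auto
  moreover have "(\<lambda>n. (cos_coeff n * s ^ n) *\<^sub>R mat 1 + (sin_coeff n * s ^ n / s) *\<^sub>R A) sums (cos s *\<^sub>R mat 1 + (sin s / s) *\<^sub>R A)"
    using cos_converges[of s] sin_converges[of s]
    by (intro sums_add sums_scaleR_left sums_divide) auto
  ultimately show ?thesis unfolding mat_exp_def by (simp add: sums_iff)
qed

text \<open>The closed form of the exponential; group law, adjoint and derivative become
  trigonometric identities.\<close>

definition su2_exp :: "mat2 \<Rightarrow> real \<Rightarrow> mat2" where
  "su2_exp X t = cos (su2_norm X * t) *\<^sub>R mat 1 + (sin (su2_norm X * t) / su2_norm X) *\<^sub>R X"

lemma mat_exp_su2:
  assumes "X \<in> su2"
  shows "mat_exp (t *\<^sub>R X) = su2_exp X t"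
proof (cases "su2_norm X = 0 \<or> t = 0")
  case True
  hence "t *\<^sub>R X = 0" using su2_norm_eq_0[OF assms] by auto
  moreover have "mat_exp 0 = mat 1" using mat_exp_eq[of 0 0] by (simp add: matrix_matrix_mult_def vec_eq_iff)
  ultimately show ?thesis using True by (auto simp: su2_exp_def)
next
  case False
  have "mat_exp (t *\<^sub>R X) = cos (su2_norm X * t) *\<^sub>R mat 1 + (sin (su2_norm X * t) / (su2_norm X * t)) *\<^sub>R (t *\<^sub>R X)"
    using False by (intro mat_exp_eq) (auto simp: mat2_distribs su2_square[OF assms] power2_eq_square)
  thus ?thesis using False by (simp add: su2_exp_def)
qed

lemma su2_exp_0 [simp]: "su2_exp X 0 = mat 1"
  by (simp add: su2_exp_def)

lemma su2_exp_add:
  assumes "X \<in> su2"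
  shows "su2_exp X (s + t) = su2_exp X s ** su2_exp X t"
proof (cases "su2_norm X = 0")
  case False
  define r where "r = su2_norm X"
  have "su2_exp X s ** su2_exp X t = 
    (cos (r * s) * cos (r * t)) *\<^sub>R mat 1 + (cos (r * s) * (sin (r * t) / r)) *\<^sub>R X + 
    ((sin (r * s) / r * cos (r * t)) *\<^sub>R X - (sin (r * s) / r * (sin (r * t) / r) * r\<^sup>2) *\<^sub>R mat 1)"
    unfolding su2_exp_def r_def[symmetric]
    by (simp add: mat2_distribs su2_square[OF assms] r_def[symmetric] scaleR_add_right scaleR_diff_right mult_ac)
  also have "\<dots> = (cos (r * s) * cos (r * t) - sin (r * s) * sin (r * t)) *\<^sub>R mat 1 
     + ((cos (r * s) * sin (r * t) + sin (r * s) * cos (r * t)) / r) *\<^sub>R X"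
    using False by (simp add: r_def power2_eq_square scaleR_add_left scaleR_diff_left add_divide_distrib)
  also have "\<dots> = su2_exp X (s + t)"
    by (simp add: su2_exp_def r_def[symmetric] distrib_left cos_add sin_add add.commute)
  finally show ?thesis ..
qed (simp add: su2_exp_def)

lemma su2_exp_SU2:
  assumes "X \<in> su2"
  shows "su2_exp X t \<in> carrier SU2"
proof -
  have "conj_transpose X = - X" using assms by (simp add: su2_def)
  hence ct: "conj_transpose (su2_exp X t) = su2_exp X (- t)"
    by (simp add: su2_exp_def mat2_simps)
  have "su2_exp X t ** su2_exp X (- t) = mat 1" "su2_exp X (- t) ** su2_exp X t = mat 1"
    by (simp_all add: su2_exp_add[OF assms, symmetric])
  moreover have "det (su2_exp X t) = 1"
  proof -
    define c s r where "c = cos (su2_norm X * t)" and "s = sin (su2_norm X * t) / su2_norm X" and "r = su2_norm X"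
    \<comment> \<open>For \<open>r = 0\<close> the division makes \<open>s\<close> zero, and the
      cosine alone gives determinant 1.\<close>
    have eq: "c\<^sup>2 + s\<^sup>2 * r\<^sup>2 = 1 \<or> r = 0 \<and> c = 1 \<and> s = 0"
      by (cases "r = 0") (auto simp: c_def s_def r_def power_divide)
    have r2: "r\<^sup>2 = (Im (X $ 1 $ 1))\<^sup>2 + (Re (X $ 1 $ 2))\<^sup>2 + (Im (X $ 1 $ 2))\<^sup>2"
      by (simp add: r_def su2_norm_def cmod_power2)
    have "su2_exp X t = c *\<^sub>R mat 1 + s *\<^sub>R X" by (simp add: su2_exp_def c_def s_def)
    hence "det (su2_exp X t) = of_real (c\<^sup>2 + s\<^sup>2 * r\<^sup>2)"
      unfolding r2 using su2_entries[OF assms]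
      by (simp add: det_2 mat2_one_nth complex_eq_iff power2_eq_square algebra_simps)
    moreover have "c\<^sup>2 + s\<^sup>2 * r\<^sup>2 = 1" using eq by auto
    ultimately show ?thesis by (simp only: of_real_1)
  qed
  ultimately show ?thesis by (simp add: SU2_def ct)
qed

lemma conj_transpose_su2_exp: "X \<in> su2 \<Longrightarrow> conj_transpose (su2_exp X t) = su2_exp X (- t)"
  by (simp add: su2_def su2_exp_def mat2_simps)

lemma has_vector_derivative_su2_exp:
  assumes "X \<in> su2"
  shows "(su2_exp X has_vector_derivative X) (at 0)"
proof (cases "su2_norm X = 0")
  case True
  hence "su2_exp X = (\<lambda>t. mat 1)" "X = 0" using su2_norm_eq_0[OF assms] by (auto simp: su2_exp_def)
  thus ?thesis by simp
next
  case False
  have "((\<lambda>t. cos (su2_norm X * t)) has_real_derivative 0) (at 0)"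
    by (auto intro!: derivative_eq_intros)
  moreover have "((\<lambda>t. sin (su2_norm X * t) / su2_norm X) has_real_derivative 1) (at 0)"
    using False by (auto intro!: derivative_eq_intros)
  ultimately have "((\<lambda>t. cos (su2_norm X * t) *\<^sub>R mat 1 + (sin (su2_norm X * t) / su2_norm X) *\<^sub>R X) has_vector_derivative
      (cos (su2_norm X * 0) *\<^sub>R 0 + 0 *\<^sub>R mat 1) + ((sin (su2_norm X * 0) / su2_norm X) *\<^sub>R 0 + 1 *\<^sub>R X)) (at 0)"
    by (intro has_vector_derivative_add has_vector_derivative_scaleR has_vector_derivative_const)
  thus ?thesis by (simp add: su2_exp_def[abs_def])
qed

text \<open>The next three sums are the squared gradient of \<open>half_trace\<close>, and the Laplacian and the squared
  gradient of \<open>b \<mapsto> half_trace (b Z b\<^sup>* Y)\<close>.\<close>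

lemma half_trace_basis_sum:
  assumes "g \<in> carrier SU2"
  shows "(\<Sum>k<3. (half_trace (g ** su2_basis k))\<^sup>2) = 1 - (half_trace g)\<^sup>2"
proof -
  have "(Re (g $ 1 $ 1))\<^sup>2 + (Im (g $ 1 $ 1))\<^sup>2 + (Re (g $ 1 $ 2))\<^sup>2 + (Im (g $ 1 $ 2))\<^sup>2 = 1"
    using arg_cong[OF SU2_entries(3)[OF assms], of Re] by (simp add: power2_eq_square)
  thus ?thesis unfolding sum_lessThan_3 half_trace_def
    using SU2_entries(1,2)[OF assms] by (simp add: mat2_mult_nth su2_basis_nth)
qed

lemma su2_casimir_adjoint:
  assumes "Z \<in> su2"
  shows "(\<Sum>k<3. let Y = su2_basis k ** Z - Z ** su2_basis k in su2_basis k ** Y - Y ** su2_basis k) = (- 8) *\<^sub>R Z"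
  unfolding sum_lessThan_3 Let_def using su2_entries[OF assms]
  by (simp add: mat2_simps su2_basis_nth complex_eq_iff)

lemma su2_lagrange:
  assumes "Z \<in> su2" "Y \<in> su2"
  shows "(\<Sum>k<3. (half_trace ((su2_basis k ** Z - Z ** su2_basis k) ** Y))\<^sup>2) =
    4 * (half_trace (Z ** Z) * half_trace (Y ** Y) - (half_trace (Z ** Y))\<^sup>2)"
  unfolding sum_lessThan_3 half_trace_def using su2_entries[OF assms(1)] su2_entries[OF assms(2)]
  by (simp add: mat2_mult_nth su2_basis_nth complex_eq_iff power2_eq_square field_simps)

section \<open>Smooth functions\<close>

lemma C_k_on_cong:
  assumes "open W" "\<And>x. x \<in> W \<Longrightarrow> f x = g x" "C_k_on k f W"
  shows "C_k_on k g W"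
  using assms(2,3)
proof (induction k arbitrary: f g)
  case 0
  thus ?case using continuous_on_cong[of W W f g] by simp
next
  case (Suc k)
  have eq: "(f has_derivative D) (at x) \<longleftrightarrow> (g has_derivative D) (at x)" if x: "x \<in> W" for x D
  proof
    show "(g has_derivative D) (at x)" if "(f has_derivative D) (at x)"
      by (rule has_derivative_transform_within_open[OF that assms(1) x]) (rule Suc.prems(1))
    show "(f has_derivative D) (at x)" if "(g has_derivative D) (at x)"
      by (rule has_derivative_transform_within_open[OF that assms(1) x]) (rule Suc.prems(1)[symmetric])
  qed
  have "g differentiable at x" if "x \<in> W" for x
    using Suc.prems(2) that by (auto simp: differentiable_def eq)
  moreover have fd: "frechet_derivative f (at x) = frechet_derivative g (at x)" if "x \<in> W" for x
    unfolding frechet_derivative_def using eq[OF that] by simp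
  have "C_k_on k (\<lambda>x. frechet_derivative g (at x) v) W" for v
    by (rule Suc.IH[of "\<lambda>x. frechet_derivative f (at x) v"]) (use fd Suc.prems(2) in auto)
  ultimately show ?case by simp
qed

lemma C_k_on_Suc_D: "C_k_on (Suc k) f W \<Longrightarrow> C_k_on k f W"
proof (induction k arbitrary: f)
  case 0
  thus ?case by (auto intro!: continuous_at_imp_continuous_on differentiable_imp_continuous_within)
qed auto

lemma C_k_on_const: "C_k_on k (\<lambda>x. c) W"
proof (induction k arbitrary: c)
  case (Suc k)
  have "frechet_derivative (\<lambda>x. c) (at x) v = 0" for x v :: 'a
    using frechet_derivative_at[OF has_derivative_const[of c "at x"]] by metis
  thus ?case using Suc by (simp add: fun_eq_iff)
qed simp

lemma C_k_on_add:
  assumes W: "open W" and "C_k_on k f W" "C_k_on k g W"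
  shows "C_k_on k (\<lambda>x. f x + g x) W"
  using assms(2,3)
proof (induction k arbitrary: f g)
  case 0
  thus ?case by (auto intro: continuous_intros)
next
  case (Suc k)
  have eq: "frechet_derivative (\<lambda>x. f x + g x) (at x) v = frechet_derivative f (at x) v + frechet_derivative g (at x) v"
    if "x \<in> W" for x v
  proof -
    have "((\<lambda>x. f x + g x) has_derivative (\<lambda>v. frechet_derivative f (at x) v + frechet_derivative g (at x) v)) (at x)"
      using Suc.prems that by (intro has_derivative_add) (auto simp: frechet_derivative_works[symmetric])
    from frechet_derivative_at[OF this] show ?thesis by metis
  qed
  have "C_k_on k (\<lambda>x. frechet_derivative (\<lambda>x. f x + g x) (at x) v) W" for v
    by (rule C_k_on_cong[OF W eq[symmetric] Suc.IH]) (use Suc.prems in auto)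
  thus ?case using Suc.prems by auto
qed

lemma C_k_on_sum:
  assumes "open W" "\<And>i. i \<in> I \<Longrightarrow> C_k_on k (f i) W"
  shows "C_k_on k (\<lambda>x. \<Sum>i\<in>I. f i x) W"
  using assms(2) by (induction I rule: infinite_finite_induct) (auto simp: C_k_on_const C_k_on_add assms(1))

text \<open>The affine form of the factor makes the induction close: the derivative of the product
  is again a sum of two such products, one with the same factor and one with the constant factor
  \<open>l v\<close>.\<close>

lemma C_k_on_linear_scaleR:
  assumes W: "open W" and L: "bounded_linear l" and "C_k_on k f W"
  shows "C_k_on k (\<lambda>x. (c + l x :: real) *\<^sub>R f x) W"
  using L assms(3)
proof (induction k arbitrary: f c l)
  case 0
  hence "continuous_on W l" "continuous_on W f" by (auto intro: linear_continuous_on)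
  thus ?case by (auto intro!: continuous_intros)
next
  case (Suc k)
  have D: "((\<lambda>x. (c + l x) *\<^sub>R f x) has_derivative (\<lambda>v. (c + l x) *\<^sub>R frechet_derivative f (at x) v + l v *\<^sub>R f x)) (at x)"
    if "x \<in> W" for x
  proof -
    have "(f has_derivative frechet_derivative f (at x)) (at x)"
      using Suc.prems(2) that by (simp add: frechet_derivative_works[symmetric])
    from has_derivative_scaleR[OF has_derivative_add[OF has_derivative_const 
        bounded_linear_imp_has_derivative[OF Suc.prems(1)]] this, of c]
    show ?thesis by simp
  qed
  have eq: "frechet_derivative (\<lambda>x. (c + l x) *\<^sub>R f x) (at x) v = (c + l x) *\<^sub>R frechet_derivative f (at x) v + (l v + 0) *\<^sub>R f x"
    if "x \<in> W" for x v
    using fun_cong[OF frechet_derivative_at[OF D[OF that]], of v] by simp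
  have "C_k_on k (\<lambda>x. frechet_derivative (\<lambda>x. (c + l x) *\<^sub>R f x) (at x) v) W" for v
  proof -
    have "C_k_on k (\<lambda>x. (c + l x) *\<^sub>R frechet_derivative f (at x) v) W"
      by (rule Suc.IH[OF Suc.prems(1)]) (use Suc.prems(2) in simp)
    moreover have "C_k_on k (\<lambda>x. (l v + 0) *\<^sub>R f x) W"
      by (rule Suc.IH[OF bounded_linear_zero C_k_on_Suc_D[OF Suc.prems(2)]])
    ultimately have "C_k_on k (\<lambda>x. (c + l x) *\<^sub>R frechet_derivative f (at x) v + (l v + 0) *\<^sub>R f x) W"
      by (rule C_k_on_add[OF W])
    thus ?thesis by (rule C_k_on_cong[OF W, rotated]) (simp add: eq)
  qed
  moreover have "(\<lambda>x. (c + l x) *\<^sub>R f x) differentiable at x" if "x \<in> W" for x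
    using D[OF that] by (auto simp: differentiable_def)
  ultimately show ?case by auto
qed

section \<open>Smooth functions on a submanifold and flows\<close>

lemma smooth_fun_on_continuous:
  assumes "smooth_fun_on S u"
  shows "continuous_on S u"
  unfolding continuous_on_eq_continuous_within
proof
  fix p assume p: "p \<in> S"
  with assms obtain W F where W: "open W" "p \<in> W" "\<forall>k. C_k_on k F W" "\<forall>x\<in>W \<inter> S. F x = u x"
    unfolding smooth_fun_on_def by blast
  have "continuous_on W F" using W(3) C_k_on.simps(1) by blast
  hence "continuous (at p within S) F" using W(1,2) by (auto simp: continuous_on_eq_continuous_at intro: continuous_at_imp_continuous_at_within)
  moreover have "eventually (\<lambda>x. F x = u x) (at p within S)"
    using W p by (intro eventually_at_topological[THEN iffD2] exI[of _ W]) auto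
  ultimately show "continuous (at p within S) u"
    using W p unfolding continuous_within by (auto elim: Lim_transform_eventually)
qed

text \<open>A left invariant vector field on a matrix group is the restriction of the linear map
  \<open>g \<mapsto> g ** X\<close>. Linearity of the velocity field lets the derivative along the
  flow be extended smoothly off the submanifold.\<close>

lemma smooth_fun_on_flow_derivative:
  fixes u :: "'a::euclidean_space \<Rightarrow> complex"
  assumes u: "smooth_fun_on S u" and L: "bounded_linear L"
    and \<gamma>: "\<And>p t. p \<in> S \<Longrightarrow> \<gamma> p t \<in> S" "\<And>p. p \<in> S \<Longrightarrow> \<gamma> p 0 = p"
      "\<And>p. p \<in> S \<Longrightarrow> (\<gamma> p has_vector_derivative L p) (at 0)"
    and Du: "\<And>p. p \<in> S \<Longrightarrow> Du p = vector_derivative (\<lambda>t. u (\<gamma> p t)) (at 0)"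
  shows "smooth_fun_on S Du" and "p \<in> S \<Longrightarrow> ((\<lambda>t. u (\<gamma> p t)) has_vector_derivative Du p) (at 0)"
proof -
  have loc: "((\<lambda>t. u (\<gamma> p t)) has_vector_derivative frechet_derivative F (at p) (L p)) (at 0)"
    if p: "p \<in> S" and W: "open W" "p \<in> W" "\<forall>k. C_k_on k F W" "\<forall>x\<in>W \<inter> S. F x = u x" for p W F
  proof -
    have "F differentiable at p" using W(2,3) C_k_on.simps(2)[of 0 F W] by blast
    hence "(F has_derivative frechet_derivative F (at p)) (at (\<gamma> p 0))"
      using p by (simp add: frechet_derivative_works[symmetric] \<gamma>)
    from vector_derivative_diff_chain_within[OF \<gamma>(3)[OF p] this[THEN has_derivative_at_withinI]]
    have "((\<lambda>t. F (\<gamma> p t)) has_vector_derivative frechet_derivative F (at p) (L p)) (at 0)"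
      by (simp add: o_def)
    moreover have "eventually (\<lambda>t. \<gamma> p t \<in> W) (at 0)"
    proof -
      have "isCont (\<gamma> p) 0" using \<gamma>(3)[OF p] has_vector_derivative_continuous by blast
      thus ?thesis using W(1,2) \<gamma>(2)[OF p] unfolding isCont_def by (metis topological_tendstoD)
    qed
    hence "eventually (\<lambda>t. F (\<gamma> p t) = u (\<gamma> p t)) (at 0)"
      by eventually_elim (use W(4) \<gamma>(1)[OF p] in auto)
    ultimately show ?thesis unfolding has_vector_derivative_def
      using W p \<gamma> by (elim has_derivative_transform_eventually) auto
  qed
  show "((\<lambda>t. u (\<gamma> p t)) has_vector_derivative Du p) (at 0)" if p: "p \<in> S" for p
  proof -
    obtain W F where W: "open W" "p \<in> W" "\<forall>k. C_k_on k F W" "\<forall>x\<in>W \<inter> S. F x = u x"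
      using u p unfolding smooth_fun_on_def by blast
    from loc[OF p this] show ?thesis using Du[OF p] by (simp add: vector_derivative_at)
  qed
  show "smooth_fun_on S Du"
    unfolding smooth_fun_on_def
  proof
    fix p assume p: "p \<in> S"
    then obtain W F where W: "open W" "p \<in> W" "\<forall>k. C_k_on k F W" "\<forall>x\<in>W \<inter> S. F x = u x"
      using u unfolding smooth_fun_on_def by blast
    \<comment> \<open>The local extension of \<open>Du\<close>: the differential of \<open>F\<close>
      applied to \<open>L x\<close>, expanded in the basis so that the direction of differentiation
      is constant and the coefficients are linear in \<open>x\<close>.\<close>
    define H where "H = (\<lambda>x. \<Sum>b\<in>Basis. (0 + L x \<bullet> b) *\<^sub>R frechet_derivative F (at x) b)"
    have "C_k_on k H W" for k
      unfolding H_def using W(1) W(3)[rule_format, of "Suc k"]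
      by (intro C_k_on_sum C_k_on_linear_scaleR bounded_linear_compose[OF bounded_linear_inner_left L]) auto
    moreover have "H x = Du x" if x: "x \<in> W \<inter> S" for x
    proof -
      have "F differentiable at x" using x W(3) C_k_on.simps(2)[of 0 F W] by blast
      hence lin: "linear (frechet_derivative F (at x))" by (rule linear_frechet_derivative)
      have "Du x = frechet_derivative F (at x) (L x)"
        using loc[of x W F] x W Du[of x] by (simp add: vector_derivative_at)
      also have "\<dots> = frechet_derivative F (at x) (\<Sum>b\<in>Basis. (L x \<bullet> b) *\<^sub>R b)" by (simp add: euclidean_representation)
      also have "\<dots> = H x" unfolding H_def using lin by (simp add: linear_sum linear_scale)
      finally show ?thesis ..
    qed
    ultimately show "\<exists>W F. open W \<and> p \<in> W \<and> (\<forall>k. C_k_on k F W) \<and> (\<forall>x\<in>W \<inter> S. F x = Du x)"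
      using W by blast
  qed
qed

section \<open>Characters of SU(2)\<close>

lemma (in prob_space) integral_of_derivative:
  fixes F :: "'a \<Rightarrow> real \<Rightarrow> 'b::{banach, second_countable_topology}"
  assumes int: "\<And>s. integrable M (\<lambda>b. F b s)"
    and deriv: "\<And>b s. b \<in> space M \<Longrightarrow> (F b has_vector_derivative F' b s) (at s)"
    and bound: "\<And>b s. b \<in> space M \<Longrightarrow> norm (F' b s) \<le> B"
    and meas: "(\<lambda>b. F' b 0) \<in> borel_measurable M"
    and \<Phi>: "\<And>s. (LINT b|M. F b s) = \<Phi> s" "(\<Phi> has_vector_derivative \<Phi>') (at 0)"
  shows "(LINT b|M. F' b 0) = \<Phi>'"
proof -
  define h where "h = (\<lambda>n. inverse (real (Suc n)))"
  have h0: "h n \<noteq> 0" and h_pos: "h n > 0" for n by (auto simp: h_def)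
  have h_lim: "h \<longlonglongrightarrow> 0" unfolding h_def by (rule LIMSEQ_inverse_real_of_nat)
  have lim: "(\<lambda>n. (f (h n) - f 0) /\<^sub>R h n) \<longlonglongrightarrow> f'" if "(f has_vector_derivative f') (at 0)" 
    for f :: "real \<Rightarrow> 'b" and f'
  proof -
    have "((\<lambda>y. norm (f (0 + y) - f 0 - y *\<^sub>R f') / norm y) \<longlongrightarrow> 0) (at 0)"
      using that by (simp add: has_vector_derivative_def has_derivative_at)
    moreover have "filterlim h (at 0) sequentially" using h_lim h0 by (simp add: filterlim_at)
    ultimately have "(\<lambda>n. norm (f (0 + h n) - f 0 - h n *\<^sub>R f') / norm (h n)) \<longlonglongrightarrow> 0"
      by (rule filterlim_compose)
    moreover have "norm (f (0 + h n) - f 0 - h n *\<^sub>R f') / norm (h n) = norm ((f (h n) - f 0) /\<^sub>R h n - f')" for n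
    proof -
      have "f (h n) - f 0 - h n *\<^sub>R f' = h n *\<^sub>R ((f (h n) - f 0) /\<^sub>R h n - f')"
        using h0[of n] by (simp add: scaleR_diff_right)
      thus ?thesis using h0[of n] by simp
    qed
    ultimately show ?thesis by (simp add: tendsto_norm_zero_iff LIM_zero_iff)
  qed
  \<comment> \<open>The mean value inequality supplies the constant dominating all difference
    quotients.\<close>
  have B: "norm ((F b (h n) - F b 0) /\<^sub>R h n) \<le> B" if "b \<in> space M" for b n
  proof -
    have "norm (F b (h n) - F b 0) \<le> B * norm (h n - 0)"
    proof (rule differentiable_bound[of UNIV "F b" "\<lambda>s h. h *\<^sub>R F' b s"])
      show "onorm (\<lambda>h. h *\<^sub>R F' b s) \<le> B" for s
        using bound[OF that, of s] by (intro onorm_le) (simp add: mult_left_mono mult.commute[of B])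
    qed (use deriv[OF that] in \<open>auto simp: has_vector_derivative_def\<close>)
    thus ?thesis using h_pos[of n] unfolding norm_scaleR by (simp add: field_simps)
  qed
  have "(\<lambda>n. LINT b|M. (F b (h n) - F b 0) /\<^sub>R h n) \<longlonglongrightarrow> (LINT b|M. F' b 0)"
  proof (rule integral_dominated_convergence[where w = "\<lambda>_. B"])
    show "AE b in M. (\<lambda>n. (F b (h n) - F b 0) /\<^sub>R h n) \<longlonglongrightarrow> F' b 0"
      using deriv by (intro AE_I2 lim)
    show "AE b in M. norm ((F b (h n) - F b 0) /\<^sub>R h n) \<le> B" for n by (intro AE_I2 B)
  qed (use int meas in auto)
  moreover have "(LINT b|M. (F b (h n) - F b 0) /\<^sub>R h n) = (\<Phi> (h n) - \<Phi> 0) /\<^sub>R h n" for n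
    using int by (simp add: \<Phi>(1))
  ultimately have "(\<lambda>n. (\<Phi> (h n) - \<Phi> 0) /\<^sub>R h n) \<longlonglongrightarrow> (LINT b|M. F' b 0)" by (simp only:)
  thus ?thesis using lim[OF \<Phi>(2)] by (rule LIMSEQ_unique)
qed

text \<open>The left invariant vector field of \<open>X\<close>, encoded as a relation that carries
  along the continuity of function and derivative. Differentiability at 0 for every base point is
  enough, since other parameters arise by moving the base point.\<close>

definition group_derivative :: "mat2 \<Rightarrow> (mat2 \<Rightarrow> 'b::real_normed_vector) \<Rightarrow> (mat2 \<Rightarrow> 'b) \<Rightarrow> bool" where
  "group_derivative X f f' \<longleftrightarrow> continuous_on (carrier SU2) f \<and> continuous_on (carrier SU2) f' \<and>
     (\<forall>g\<in>carrier SU2. ((\<lambda>t. f (g ** su2_exp X t)) has_vector_derivative f' g) (at 0))"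

lemma group_derivative_at:
  assumes X: "X \<in> su2" and f: "group_derivative X f f'" and g: "g \<in> carrier SU2"
  shows "((\<lambda>t. f (g ** su2_exp X t)) has_vector_derivative f' (g ** su2_exp X s)) (at s)"
proof -
  have "((\<lambda>t. f (g ** su2_exp X s ** su2_exp X t)) has_vector_derivative f' (g ** su2_exp X s)) (at 0)"
    using f SU2_mult_closed[OF g su2_exp_SU2[OF X]] by (simp add: group_derivative_def)
  also have "(\<lambda>t. f (g ** su2_exp X s ** su2_exp X t)) = (\<lambda>t. f (g ** su2_exp X t)) \<circ> (\<lambda>t. s + t)"
    by (simp add: su2_exp_add[OF X] matrix_mul_assoc o_def)
  finally have 0: "((\<lambda>t. f (g ** su2_exp X t)) \<circ> (\<lambda>t. s + t) has_vector_derivative f' (g ** su2_exp X s)) (at (s - s))" by (simp add: o_def)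
  have "((\<lambda>t. t - s) has_vector_derivative 1) (at s)"
    by (auto intro!: derivative_eq_intros)
  from vector_diff_chain_at[OF this 0] show ?thesis by (simp add: o_def)
qed

lemma group_derivative_mult:
  fixes f h :: "mat2 \<Rightarrow> 'b::real_normed_algebra"
  assumes "group_derivative X f f'" "group_derivative X h h'"
  shows "group_derivative X (\<lambda>g. f g * h g) (\<lambda>g. f g * h' g + f' g * h g)"
  unfolding group_derivative_def
proof (intro conjI ballI)
  fix g assume "g \<in> carrier SU2"
  thus "((\<lambda>t. f (g ** su2_exp X t) * h (g ** su2_exp X t)) has_vector_derivative f g * h' g + f' g * h g) (at 0)"
    using has_vector_derivative_mult[of "\<lambda>t. f (g ** su2_exp X t)" "f' g" 0 UNIV "\<lambda>t. h (g ** su2_exp X t)" "h' g"] assms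
    by (simp add: group_derivative_def)
qed (use assms in \<open>auto simp: group_derivative_def intro!: continuous_intros\<close>)

lemma group_derivative_of_real:
  assumes "group_derivative X f f'"
  shows "group_derivative X (\<lambda>g. complex_of_real (f g)) (\<lambda>g. complex_of_real (f' g))"
  using assms by (auto simp: group_derivative_def intro!: continuous_intros 
      bounded_linear.has_vector_derivative[OF bounded_linear_of_real])

lemma group_derivative_scaleR:
  assumes "group_derivative X f f'"
  shows "group_derivative X (\<lambda>g. a *\<^sub>R f g) (\<lambda>g. a *\<^sub>R f' g)"
  using assms unfolding group_derivative_def
  by (auto intro!: continuous_intros bounded_linear.has_vector_derivative[OF bounded_linear_scaleR_right])

lemma group_derivative_poly:
  fixes f f' :: "mat2 \<Rightarrow> real"
  assumes "group_derivative X f f'"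
  shows "group_derivative X (\<lambda>g. poly p (f g)) (\<lambda>g. poly (pderiv p) (f g) * f' g)"
  unfolding group_derivative_def
proof (intro conjI ballI)
  fix g assume g: "g \<in> carrier SU2"
  have "((\<lambda>t. f (g ** su2_exp X t)) has_real_derivative f' g) (at 0)"
    using assms g by (simp add: group_derivative_def has_real_derivative_iff_has_vector_derivative)
  from DERIV_chain2[OF poly_DERIV this]
  show "((\<lambda>t. poly p (f (g ** su2_exp X t))) has_vector_derivative poly (pderiv p) (f g) * f' g) (at 0)"
    by (simp add: has_real_derivative_iff_has_vector_derivative)
qed (use assms in \<open>auto simp: group_derivative_def intro!: continuous_intros\<close>)

lemma group_derivative_half_trace:
  assumes "X \<in> su2"
  shows "group_derivative X (\<lambda>g. half_trace (A ** g ** B)) (\<lambda>g. half_trace (A ** g ** X ** B))"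
  unfolding group_derivative_def
proof (intro conjI ballI)
  fix g :: mat2
  have "bounded_linear (\<lambda>Y :: mat2. half_trace (A ** g ** Y ** B))"
    by (rule linear_conv_bounded_linear[THEN iffD1], rule linearI) (auto simp: mat2_distribs)
  from bounded_linear.has_vector_derivative[OF this has_vector_derivative_su2_exp[OF assms]]
  show "((\<lambda>t. half_trace (A ** (g ** su2_exp X t) ** B)) has_vector_derivative half_trace (A ** g ** X ** B)) (at 0)"
    by (simp add: matrix_mul_assoc)
qed (intro continuous_intros)+

text \<open>The conjugate transpose moves along the inverse one-parameter group, so the two
  contributions combine to the commutator of \<open>X\<close> and \<open>Z\<close>.\<close>

lemma group_derivative_conjugate:
  assumes "X \<in> su2"
  shows "group_derivative X (\<lambda>b. half_trace (b ** Z ** conj_transpose b ** Y))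
    (\<lambda>b. half_trace (b ** (X ** Z - Z ** X) ** conj_transpose b ** Y))"
  unfolding group_derivative_def
proof (intro conjI ballI)
  fix b :: mat2
  let ?E = "su2_exp X"
  have bl: "bounded_bilinear (\<lambda>U V :: mat2. half_trace (b ** U ** Z ** V ** conj_transpose b ** Y))"
    unfolding bilinear_conv_bounded_bilinear[symmetric] bilinear_def
    by (auto intro!: linearI simp: mat2_distribs)
  have E': "((\<lambda>t. ?E (- t)) has_vector_derivative - X) (at 0)"
    using vector_diff_chain_at[of uminus "-1" 0 ?E X] has_vector_derivative_su2_exp[OF assms]
    by (simp add: o_def has_vector_derivative_minus has_vector_derivative_id)
  have "conj_transpose (b ** ?E t) = ?E (- t) ** conj_transpose b" for t
  proof -
    have "conj_transpose (b ** ?E t) = conj_transpose (?E t) ** conj_transpose b" by (simp add: mat2_simps algebra_simps)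
    thus ?thesis by (simp add: conj_transpose_su2_exp assms)
  qed
  hence "(\<lambda>t. half_trace (b ** ?E t ** Z ** conj_transpose (b ** ?E t) ** Y)) 
     = (\<lambda>t. half_trace (b ** ?E t ** Z ** ?E (- t) ** conj_transpose b ** Y))"
    by (simp add: matrix_mul_assoc)
  moreover have "((\<lambda>t. half_trace (b ** ?E t ** Z ** ?E (- t) ** conj_transpose b ** Y)) has_vector_derivative 
      half_trace (b ** mat 1 ** Z ** (- X) ** conj_transpose b ** Y) + half_trace (b ** X ** Z ** mat 1 ** conj_transpose b ** Y)) (at 0)"
    using bounded_bilinear.has_vector_derivative[OF bl has_vector_derivative_su2_exp[OF assms] E'] by simp
  moreover have "half_trace (b ** mat 1 ** Z ** (- X) ** conj_transpose b ** Y) + half_trace (b ** X ** Z ** mat 1 ** conj_transpose b ** Y)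
     = half_trace (b ** (X ** Z - Z ** X) ** conj_transpose b ** Y)"
    by (simp add: mat2_distribs matrix_mul_assoc)
  ultimately show "((\<lambda>t. half_trace (b ** ?E t ** Z ** conj_transpose (b ** ?E t) ** Y)) has_vector_derivative
       half_trace (b ** (X ** Z - Z ** X) ** conj_transpose b ** Y)) (at 0)" by simp
qed (intro continuous_intros)+

text \<open>The character of the irreducible representation of dimension \<open>d\<close>. Since it vanishes for \<open>d = 0\<close>,
  the terms with a division by \<open>d = 0\<close> in the series below are harmless.\<close>

definition su2_char :: "nat \<Rightarrow> mat2 \<Rightarrow> real" where
  "su2_char d g = poly (cheb_V d) (half_trace g)"

text \<open>The squared gradient of \<open>half_trace\<close> is nonnegative.\<close>

lemma half_trace_bound:
  assumes "g \<in> carrier SU2"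
  shows "\<bar>half_trace g\<bar> \<le> 1"
proof -
  have "0 \<le> (\<Sum>k<3. (half_trace (g ** su2_basis k))\<^sup>2)" by (intro sum_nonneg) auto
  thus ?thesis using half_trace_basis_sum[OF assms] by (simp add: abs_square_le_1)
qed

lemma su2_char_bound: "g \<in> carrier SU2 \<Longrightarrow> \<bar>su2_char d g\<bar> \<le> real d"
  unfolding su2_char_def by (rule cheb_bound(2)[OF half_trace_bound])

lemma su2_char_commute: "su2_char d (g ** h) = su2_char d (h ** g)"
  unfolding su2_char_def by (simp only: half_trace_commute)

lemma continuous_on_su2_char [continuous_intros]:
  "continuous_on S f \<Longrightarrow> continuous_on S (\<lambda>x. su2_char d (f x))"
  unfolding su2_char_def by (intro continuous_intros)

definition su2_char_deriv :: "mat2 \<Rightarrow> nat \<Rightarrow> mat2 \<Rightarrow> real" where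
  "su2_char_deriv X d g = poly (pderiv (cheb_V d)) (half_trace g) * half_trace (g ** X)"

text \<open>The second derivative along \<open>X\<close>; its last term comes from
  \<open>X ** X\<close> being a negative multiple of the identity.\<close>

definition su2_char_deriv2 :: "mat2 \<Rightarrow> nat \<Rightarrow> mat2 \<Rightarrow> real" where
  "su2_char_deriv2 X d g = poly (pderiv (pderiv (cheb_V d))) (half_trace g) * (half_trace (g ** X))\<^sup>2
     - (su2_norm X)\<^sup>2 * poly (pderiv (cheb_V d)) (half_trace g) * half_trace g"

lemma continuous_on_su2_char_deriv [continuous_intros]:
  "continuous_on S f \<Longrightarrow> continuous_on S (\<lambda>x. su2_char_deriv X d (f x))"
  "continuous_on S f \<Longrightarrow> continuous_on S (\<lambda>x. su2_char_deriv2 X d (f x))"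
  unfolding su2_char_deriv_def su2_char_deriv2_def by (intro continuous_intros; assumption)+

lemma group_derivative_char:
  assumes X: "X \<in> su2"
  shows "group_derivative X (\<lambda>g. su2_char d (A ** g)) (\<lambda>g. su2_char_deriv X d (A ** g))"
    and "group_derivative X (\<lambda>g. su2_char_deriv X d (A ** g)) (\<lambda>g. su2_char_deriv2 X d (A ** g))"
proof -
  have 1: "group_derivative X (\<lambda>g. half_trace (A ** g)) (\<lambda>g. half_trace (A ** g ** X))"
    using group_derivative_half_trace[OF X, of A "mat 1"] by simp
  show "group_derivative X (\<lambda>g. su2_char d (A ** g)) (\<lambda>g. su2_char_deriv X d (A ** g))"
    unfolding su2_char_def su2_char_deriv_def by (rule group_derivative_poly[OF 1])
  have 2: "group_derivative X (\<lambda>g. half_trace (A ** g ** X)) (\<lambda>g. - (su2_norm X)\<^sup>2 * half_trace (A ** g))"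
    using group_derivative_half_trace[OF X, of A X]
    by (simp add: matrix_mul_assoc[symmetric] su2_square[OF X] mat2_distribs)
  show "group_derivative X (\<lambda>g. su2_char_deriv X d (A ** g)) (\<lambda>g. su2_char_deriv2 X d (A ** g))"
    using group_derivative_mult[OF group_derivative_poly[OF 1, of "pderiv (cheb_V d)"] 2]
    unfolding su2_char_deriv_def su2_char_deriv2_def by (simp add: power2_eq_square algebra_simps)
qed

text \<open>The squared gradient of \<open>half_trace\<close> is 1 - t^2 and each second derivative
  of it is - t, three in number, so summing over the basis gives exactly the left side of the
  Chebyshev equation.\<close>

lemma su2_char_casimir:
  assumes "g \<in> carrier SU2"
  shows "(\<Sum>k<3. su2_char_deriv2 (su2_basis k) d g) = (1 - (real d)\<^sup>2) * su2_char d g"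
proof -
  have "(\<Sum>k<3. su2_char_deriv2 (su2_basis k) d g) = 
    poly (pderiv (pderiv (cheb_V d))) (half_trace g) * (\<Sum>k<3. (half_trace (g ** su2_basis k))\<^sup>2) 
     - 3 * (poly (pderiv (cheb_V d)) (half_trace g) * half_trace g)"
    by (simp add: su2_char_deriv2_def su2_basis_norm sum_lessThan_3 algebra_simps)
  thus ?thesis using cheb_V_ode_poly[of "half_trace g" d] 
    by (simp add: half_trace_basis_sum[OF assms] su2_char_def algebra_simps)
qed

section \<open>Invariant integration on SU(2)\<close>

locale su2_haar = prob_haar SU2 M for M :: "mat2 measure" +
  assumes sets_borel: "sets M = sets (restrict_space borel (carrier SU2))"
begin

lemma space_SU2: "space M = carrier SU2" by (rule space_eq)

lemma borel_measurable_continuous: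
  fixes f :: "mat2 \<Rightarrow> 'b::topological_space"
  assumes "continuous_on (carrier SU2) f"
  shows "f \<in> borel_measurable M"
  using borel_measurable_continuous_on_restrict[OF assms] by (simp cong: measurable_cong_sets add: sets_borel)

lemma integrable_continuous:
  fixes f :: "mat2 \<Rightarrow> 'b::{banach, second_countable_topology}"
  assumes "continuous_on (carrier SU2) f"
  shows "integrable M f"
proof -
  have "bounded (f ` carrier SU2)" by (intro compact_imp_bounded compact_continuous_image assms SU2_compact)
  then obtain B where "\<And>x. x \<in> carrier SU2 \<Longrightarrow> norm (f x) \<le> B" by (auto simp: bounded_iff)
  thus ?thesis by (intro integrable_const_bound[where B = B] borel_measurable_continuous assms) (auto simp: space_SU2)
qed

text \<open>By right invariance the integral of the translate by \<open>su2_exp X s\<close> does not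
  depend on \<open>s\<close>.\<close>

lemma integral_group_derivative:
  fixes f :: "mat2 \<Rightarrow> 'b::{banach, second_countable_topology}"
  assumes X: "X \<in> su2" and f: "group_derivative X f f'"
  shows "(LINT g|M. f' g) = 0"
proof -
  have c: "continuous_on (carrier SU2) f" "continuous_on (carrier SU2) f'"
    using f by (auto simp: group_derivative_def)
  have "bounded (f' ` carrier SU2)" by (intro compact_imp_bounded compact_continuous_image c SU2_compact)
  then obtain B where B: "\<And>x. x \<in> carrier SU2 \<Longrightarrow> norm (f' x) \<le> B" by (auto simp: bounded_iff)
  have cl: "g ** su2_exp X s \<in> carrier SU2" if "g \<in> carrier SU2" for g s
    using that by (intro SU2_mult_closed su2_exp_SU2 X)
  have cE: "continuous_on (carrier SU2) (\<lambda>g. f (g ** su2_exp X s))" for s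
    by (rule continuous_on_compose2[OF c(1)]) (auto intro!: continuous_intros cl)
  have "(LINT g|M. f' (g ** su2_exp X 0)) = 0"
  proof (rule integral_of_derivative[where F = "\<lambda>g s. f (g ** su2_exp X s)" and F' = "\<lambda>g s. f' (g ** su2_exp X s)" and B = B
        and \<Phi> = "\<lambda>s. LINT g|M. f g"])
    fix g s assume "g \<in> space M"
    hence g: "g \<in> carrier SU2" by (simp add: space_SU2)
    show "((\<lambda>t. f (g ** su2_exp X t)) has_vector_derivative f' (g ** su2_exp X s)) (at s)"
      by (rule group_derivative_at[OF X f g])
    show "norm (f' (g ** su2_exp X s)) \<le> B" by (intro B cl g)
  next
    fix s
    show "(LINT g|M. f (g ** su2_exp X s)) = (LINT g|M. f g)"
      using integral_right_mult[OF borel_measurable_continuous[OF c(1)] su2_exp_SU2[OF X, of s]] by simp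
  qed (use integrable_continuous[OF cE] borel_measurable_continuous[OF c(2)] in auto)
  thus ?thesis by simp
qed

lemma integral_by_parts:
  fixes f h :: "mat2 \<Rightarrow> 'b::{banach, second_countable_topology, real_normed_algebra}"
  assumes X: "X \<in> su2" and f: "group_derivative X f f'" and h: "group_derivative X h h'"
  shows "(LINT g|M. f g * h' g) = - (LINT g|M. f' g * h g)"
proof -
  have "(LINT g|M. f g * h' g + f' g * h g) = 0"
    by (rule integral_group_derivative[OF X group_derivative_mult[OF f h]])
  moreover have "integrable M (\<lambda>g. f g * h' g)" "integrable M (\<lambda>g. f' g * h g)"
    using f h by (auto simp: group_derivative_def intro!: integrable_continuous continuous_intros)
  ultimately show ?thesis by (simp add: eq_neg_iff_add_eq_0)
qed

text \<open>Two integrations by parts move the Casimir operator to the character, where it is a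
  scalar. The shift by \<open>A\<close> on the left does not interfere with derivatives taken on the
  right.\<close>

lemma integral_casimir:
  fixes f :: "mat2 \<Rightarrow> complex" and f1 f2 :: "nat \<Rightarrow> mat2 \<Rightarrow> complex"
  assumes f1: "\<And>k. group_derivative (su2_basis k) f (f1 k)" 
    and f2: "\<And>k. group_derivative (su2_basis k) (f1 k) (f2 k)" and A: "A \<in> carrier SU2"
  shows "(LINT c|M. su2_char d (A ** c) * (\<Sum>k<3. f2 k c)) = (1 - (real d)\<^sup>2) * (LINT c|M. su2_char d (A ** c) * f c)"
proof -
  have c: "continuous_on (carrier SU2) f" "\<And>k. continuous_on (carrier SU2) (f2 k)"
    using f1 f2 by (auto simp: group_derivative_def)
  note D = group_derivative_of_real[OF group_derivative_char(1)[OF su2_basis_su2, where A = A and d = d]]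
    group_derivative_of_real[OF group_derivative_char(2)[OF su2_basis_su2, where A = A and d = d]]
  have "(LINT c|M. su2_char d (A ** c) * (\<Sum>k<3. f2 k c)) = (\<Sum>k<3. LINT c|M. su2_char d (A ** c) * f2 k c)"
    unfolding sum_distrib_left
    by (rule Bochner_Integration.integral_sum) (auto intro!: integrable_continuous continuous_intros c)
  also have "\<dots> = (\<Sum>k<3. LINT c|M. su2_char_deriv2 (su2_basis k) d (A ** c) * f c)"
    using integral_by_parts[OF su2_basis_su2 D(1) f2] integral_by_parts[OF su2_basis_su2 D(2) f1] by simp
  also have "\<dots> = (LINT c|M. (\<Sum>k<3. su2_char_deriv2 (su2_basis k) d (A ** c) * f c))"
    by (rule Bochner_Integration.integral_sum[symmetric]) (auto intro!: integrable_continuous continuous_intros c)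
  also have "\<dots> = (LINT c|M. complex_of_real (1 - (real d)\<^sup>2) * (su2_char d (A ** c) * f c))"
  proof (intro Bochner_Integration.integral_cong refl)
    fix c assume "c \<in> space M"
    hence "A ** c \<in> carrier SU2" using A by (simp add: space_SU2 SU2_mult_closed)
    from su2_char_casimir[OF this, of d, THEN arg_cong[where f = complex_of_real]]
    show "(\<Sum>k<3. su2_char_deriv2 (su2_basis k) d (A ** c) * f c) = complex_of_real (1 - (real d)\<^sup>2) * (su2_char d (A ** c) * f c)"
      by (simp only: sum_distrib_right[symmetric] of_real_sum[symmetric]) (simp add: mult.assoc)
  qed
  finally show ?thesis by simp
qed

text \<open>After splitting off the traces of \<open>h\<close> and \<open>c\<close> the argument of
  the character is \<open>h0 * c0 + \<sigma> b\<close>, and \<sigma> is uniformly distributed on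
  [-\<rho>, \<rho>] with \<rho> the product of the two sines. Since d times the character is the
  derivative of \<open>cheb_T d\<close>, its mean is a difference quotient of cosines at the angles
  a - b and a + b, which factorizes. Uniformity enters only through the integrals of polynomial
  derivatives.\<close>

lemma integral_char_conjugate:
  assumes h: "h \<in> carrier SU2" and c: "c \<in> carrier SU2"
  shows "real d * (LINT b|M. su2_char d (b ** h ** conj_transpose b ** c)) = su2_char d h * su2_char d c"
proof -
  define h0 c0 where "h0 = half_trace h" and "c0 = half_trace c"
  define Z Y where "Z = h - h0 *\<^sub>R mat 1" and "Y = c - c0 *\<^sub>R mat 1"
  define \<sigma> where "\<sigma> = (\<lambda>b. half_trace (b ** Z ** conj_transpose b ** Y))"
  have su2: "g - half_trace g *\<^sub>R mat 1 \<in> su2" if "g \<in> carrier SU2" for g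
    using SU2_entries(1,2)[OF that] by (intro su2I) (auto simp: mat2_one_nth half_trace_def complex_eq_iff)
  have Z: "Z \<in> su2" and Y: "Y \<in> su2" unfolding Z_def Y_def h0_def c0_def by (intro su2 h c)+
  have hc: "\<bar>h0\<bar> \<le> 1" "\<bar>c0\<bar> \<le> 1" unfolding h0_def c0_def by (intro half_trace_bound h c)+
  have split: "half_trace (b ** h ** conj_transpose b ** c) = h0 * c0 + \<sigma> b" if b: "b \<in> carrier SU2" for b
  proof -
    have hh: "h = h0 *\<^sub>R mat 1 + Z" "c = c0 *\<^sub>R mat 1 + Y" by (simp_all add: Z_def Y_def)
    have tZY: "half_trace Z = 0" "half_trace Y = 0" by (simp_all add: Z_def Y_def h0_def c0_def)
    have "half_trace (b ** Z ** conj_transpose b) = half_trace (conj_transpose b ** b ** Z)"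
      by (subst half_trace_commute) (simp add: matrix_mul_assoc)
    hence "half_trace (b ** Z ** conj_transpose b) = 0" using SU2_conj_transpose(2)[OF b] tZY by simp
    hence "half_trace (b ** (h0 *\<^sub>R mat 1 + Z) ** conj_transpose b ** (c0 *\<^sub>R mat 1 + Y)) = h0 * c0 + \<sigma> b" 
      unfolding \<sigma>_def by (simp add: mat2_distribs SU2_conj_transpose(3)[OF b] tZY)
    thus ?thesis unfolding hh[symmetric] .
  qed
  have norm: "- half_trace ((g - half_trace g *\<^sub>R mat 1) ** (g - half_trace g *\<^sub>R mat 1)) = 1 - (half_trace g)\<^sup>2"
    if g: "g \<in> carrier SU2" for g
  proof -
    have "(Re (g $ 1 $ 1))\<^sup>2 + (Im (g $ 1 $ 1))\<^sup>2 + (Re (g $ 1 $ 2))\<^sup>2 + (Im (g $ 1 $ 2))\<^sup>2 = 1"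
      using arg_cong[OF SU2_entries(3)[OF g], of Re] by (simp add: power2_eq_square)
    thus ?thesis using SU2_entries(1,2)[OF g]
      by (simp add: half_trace_def mat2_mult_nth mat2_one_nth power2_eq_square) (simp add: field_simps)
  qed
  \<comment> \<open>The squared half length of the interval of values of \<sigma>.\<close>
  define \<rho>2 where "\<rho>2 = half_trace (Z ** Z) * half_trace (Y ** Y)"
  have \<rho>2: "\<rho>2 = (1 - h0\<^sup>2) * (1 - c0\<^sup>2)"
  proof -
    have "\<rho>2 = (- half_trace (Z ** Z)) * (- half_trace (Y ** Y))" by (simp add: \<rho>2_def)
    thus ?thesis unfolding Z_def Y_def h0_def c0_def norm[OF h] norm[OF c] .
  qed
  \<comment> \<open>The integrated divergence of q(\<sigma>) times the gradient of \<sigma> is zero.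
    The squared gradient is 4 (\<rho>^2 - \<sigma>^2) and the Laplacian is -8 \<sigma>, so that
    divergence is 4 times the derivative of (\<rho>^2 - s^2) q(s) at \<sigma>.\<close>
  have vanish: "(LINT b|M. poly (pderiv ([:\<rho>2, 0, -1:] * q)) (\<sigma> b)) = 0" for q
  proof -
    define D where "D = (\<lambda>k b. half_trace (b ** (su2_basis k ** Z - Z ** su2_basis k) ** conj_transpose b ** Y))"
    define D2 where "D2 = (\<lambda>k b. half_trace (b ** (su2_basis k ** (su2_basis k ** Z - Z ** su2_basis k) - 
       (su2_basis k ** Z - Z ** su2_basis k) ** su2_basis k) ** conj_transpose b ** Y))"
    have g: "group_derivative (su2_basis k) (\<lambda>b. D k b * poly q (\<sigma> b)) (\<lambda>b. D k b * (poly (pderiv q) (\<sigma> b) * D k b) + D2 k b * poly q (\<sigma> b))" for k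
      unfolding D_def D2_def \<sigma>_def
      by (intro group_derivative_mult group_derivative_conjugate group_derivative_poly su2_basis_su2)
    have "(LINT b|M. (\<Sum>k<3. D k b * (poly (pderiv q) (\<sigma> b) * D k b) + D2 k b * poly q (\<sigma> b))) 
      = (\<Sum>k<3. LINT b|M. D k b * (poly (pderiv q) (\<sigma> b) * D k b) + D2 k b * poly q (\<sigma> b))"
      using g by (intro Bochner_Integration.integral_sum integrable_continuous) (auto simp: group_derivative_def)
    also have "\<dots> = 0" by (simp add: integral_group_derivative[OF su2_basis_su2 g])
    also have "(LINT b|M. (\<Sum>k<3. D k b * (poly (pderiv q) (\<sigma> b) * D k b) + D2 k b * poly q (\<sigma> b)))
      = (LINT b|M. 4 * poly (pderiv ([:\<rho>2, 0, -1:] * q)) (\<sigma> b))"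
    proof (intro Bochner_Integration.integral_cong refl)
      fix b assume "b \<in> space M"
      hence b: "b \<in> carrier SU2" by (simp add: space_SU2)
      \<comment> \<open>Cyclicity of the trace moves the conjugation by \<open>b\<close> from the
        varying first factor to \<open>Y\<close>, leaving an element of su(2) with the same trace of
        its square; the identities for fixed matrices then apply.\<close>
      define W where "W = conj_transpose b ** Y ** b"
      have W: "W \<in> su2" unfolding W_def using su2_entries[OF Y]
        by (intro su2I) (auto simp: mat2_mult_nth conj_transpose_nth SU2_entries(1,2)[OF b] algebra_simps)
      have tr: "half_trace (b ** A ** conj_transpose b ** Y) = half_trace (A ** W)" for A :: mat2
        using half_trace_commute[of b "A ** conj_transpose b ** Y"] by (simp add: W_def matrix_mul_assoc)
      have "half_trace (W ** W) = half_trace (conj_transpose b ** (Y ** (b ** conj_transpose b) ** Y ** b))"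
        unfolding W_def by (simp add: matrix_mul_assoc)
      also have "\<dots> = half_trace (Y ** Y ** (b ** conj_transpose b))"
        unfolding SU2_conj_transpose(3)[OF b] by (subst half_trace_commute) (simp add: matrix_mul_assoc[symmetric] SU2_conj_transpose(3)[OF b])
      finally have WW: "half_trace (W ** W) = half_trace (Y ** Y)" by (simp add: SU2_conj_transpose(3)[OF b])
      have 1: "(\<Sum>k<3. (D k b)\<^sup>2) = 4 * (\<rho>2 - (\<sigma> b)\<^sup>2)"
        unfolding D_def \<sigma>_def tr su2_lagrange[OF Z W] WW \<rho>2_def ..
      have "(\<Sum>k<3. D2 k b) = half_trace ((\<Sum>k<3. let Y = su2_basis k ** Z - Z ** su2_basis k in su2_basis k ** Y - Y ** su2_basis k) ** W)"
        unfolding D2_def tr sum_lessThan_3 Let_def by (simp add: mat2_distribs)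
      hence 2: "(\<Sum>k<3. D2 k b) = - 8 * \<sigma> b"
        unfolding su2_casimir_adjoint[OF Z] \<sigma>_def tr by (simp add: mat2_distribs)
      have "(\<Sum>k<3. D k b * (poly (pderiv q) (\<sigma> b) * D k b) + D2 k b * poly q (\<sigma> b)) =
        poly (pderiv q) (\<sigma> b) * (\<Sum>k<3. (D k b)\<^sup>2) + (\<Sum>k<3. D2 k b) * poly q (\<sigma> b)"
        by (simp add: sum_lessThan_3 power2_eq_square algebra_simps)
      also have "\<dots> = 4 * poly (pderiv ([:\<rho>2, 0, -1:] * q)) (\<sigma> b)"
      proof -
        have pd: "poly (pderiv ([:\<rho>2, 0, -1:] * q)) x = (\<rho>2 - x\<^sup>2) * poly (pderiv q) x - 2 * x * poly q x" for x
          by (subst pderiv_mult) (simp add: pderiv_pCons power2_eq_square algebra_simps)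
        show ?thesis unfolding 1 2 pd by (simp add: algebra_simps)
      qed
      finally show "(\<Sum>k<3. D k b * (poly (pderiv q) (\<sigma> b) * D k b) + D2 k b * poly q (\<sigma> b)) = 4 * poly (pderiv ([:\<rho>2, 0, -1:] * q)) (\<sigma> b)" .
    qed
    finally show ?thesis by simp
  qed
  show ?thesis
  proof (cases "\<rho>2 = 0")
    case False
    define a b where "a = arccos h0" and "b = arccos c0"
    have ab: "cos a = h0" "cos b = c0" "sin a \<ge> 0" "sin b \<ge> 0"
      using hc by (auto simp: a_def b_def abs_le_iff intro!: sin_ge_zero arccos_lbound arccos_ubound)
    define \<rho> where "\<rho> = sin a * sin b"
    have \<rho>: "\<rho>\<^sup>2 = \<rho>2" unfolding \<rho>2 ab(1,2)[symmetric] \<rho>_def by (simp add: power_mult_distrib sin_squared_eq)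
    hence \<rho>0: "\<rho> \<noteq> 0" using False by auto
    \<comment> \<open>A primitive, up to the factor d already present, of the shifted character;
      only its values at \<rho> and - \<rho> matter, and there the argument of
      \<open>cheb_T d\<close> is the cosine of a - b or of a + b.\<close>
    define W where "W = pcompose (cheb_T d) [:h0 * c0, 1:]"
    obtain \<alpha> \<beta> q where W: "W = [:\<alpha>, \<beta>:] + [:\<rho>2, 0, -1:] * q" using poly_split_roots[of W \<rho>] \<rho> by auto
    have "2 * \<rho> * \<beta> = poly W \<rho> - poly W (- \<rho>)" unfolding W \<rho>[symmetric] by (simp add: power2_eq_square algebra_simps)
    also have "\<dots> = cos (real d * (a - b)) - cos (real d * (a + b))"
      unfolding cheb_cos(1)[symmetric] by (simp add: W_def poly_pcompose ab \<rho>_def cos_diff cos_add)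
    also have "\<dots> = 2 * (sin (real d * a) * sin (real d * b))"
      by (simp add: right_diff_distrib distrib_left cos_diff cos_add)
    also have "\<dots> = 2 * \<rho> * (su2_char d h * su2_char d c)"
      unfolding cheb_cos(2)[symmetric] by (simp add: ab su2_char_def h0_def c0_def \<rho>_def)
    finally have \<beta>: "\<beta> = su2_char d h * su2_char d c" using \<rho>0 by simp
    have cont: "continuous_on (carrier SU2) \<sigma>" unfolding \<sigma>_def by (intro continuous_intros)
    have "real d * (LINT b|M. su2_char d (b ** h ** conj_transpose b ** c)) = (LINT b|M. poly (pderiv W) (\<sigma> b))"
    proof -
      have "real d * (LINT b|M. su2_char d (b ** h ** conj_transpose b ** c)) = (LINT b|M. real d * su2_char d (b ** h ** conj_transpose b ** c))" by simp
      also have "\<dots> = (LINT b|M. poly (pderiv W) (\<sigma> b))"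
        by (intro Bochner_Integration.integral_cong refl) 
          (simp add: space_SU2 su2_char_def split W_def pderiv_pcompose pderiv_cheb poly_pcompose pderiv_pCons)
      finally show ?thesis .
    qed
    also have "\<dots> = (LINT b|M. \<beta> + poly (pderiv ([:\<rho>2, 0, -1:] * q)) (\<sigma> b))"
      unfolding W pderiv_add poly_add by (simp add: pderiv_pCons)
    also have "\<dots> = \<beta>" using vanish[of q]
      by (subst Bochner_Integration.integral_add) (auto intro!: integrable_continuous continuous_intros cont simp: prob_space)
    finally show ?thesis unfolding \<beta> .
  next
    case True
    \<comment> \<open>In the degenerate case \<sigma> vanishes identically and one of
      \<open>h0\<close>, \<open>c0\<close> is 1 or -1, where the claim is the value or the parity of
      \<open>cheb_V\<close>.\<close>
    have *: "half_trace (A ** A) = 0 \<Longrightarrow> A = 0" if "A \<in> su2" for A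
      using that su2_square[OF that] by (simp add: su2_norm_eq_0)
    hence "Z = 0 \<or> Y = 0" using True Z Y by (auto simp: \<rho>2_def)
    hence \<sigma>0: "\<sigma> b = 0" for b by (auto simp: \<sigma>_def matrix_matrix_mult_def half_trace_def zero_vec_def)
    have "h0\<^sup>2 = 1 \<or> c0\<^sup>2 = 1" using True by (simp add: \<rho>2)
    hence "h0 = 1 \<or> h0 = -1 \<or> c0 = 1 \<or> c0 = -1" by (simp add: power2_eq_1_iff disj_ac)
    hence "real d * poly (cheb_V d) (h0 * c0) = poly (cheb_V d) h0 * poly (cheb_V d) c0"
      by (auto simp: cheb_one cheb_minus)
    moreover have "(LINT b|M. su2_char d (b ** h ** conj_transpose b ** c)) = (LINT b|M. poly (cheb_V d) (h0 * c0))"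
      by (intro Bochner_Integration.integral_cong refl) (simp add: space_SU2 su2_char_def split \<sigma>0)
    ultimately show ?thesis by (simp add: prob_space su2_char_def h0_def c0_def)
  qed
qed

end

section \<open>Orthogonality of characters and of their derivatives\<close>

context su2_haar
begin

lemma Fubini_continuous:
  fixes f :: "mat2 \<Rightarrow> mat2 \<Rightarrow> 'b::{banach, second_countable_topology}"
  assumes "continuous_on (carrier SU2 \<times> carrier SU2) (\<lambda>p. f (fst p) (snd p))"
  shows "(LINT x|M. LINT y|M. f x y) = (LINT y|M. LINT x|M. f x y)"
proof -
  have c: "continuous_on (carrier SU2 \<times> carrier SU2) (case_prod f)"
    using assms by (simp add: case_prod_unfold)
  have "sets (M \<Otimes>\<^sub>M M) = sets (restrict_space borel (carrier SU2 \<times> carrier SU2))"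
    using sets_restrict_borel_prod[of "carrier SU2" "carrier SU2"] sets_pair_measure_cong[OF sets_borel sets_borel] by simp
  hence "case_prod f \<in> borel_measurable (M \<Otimes>\<^sub>M M)"
    using borel_measurable_continuous_on_restrict[OF c] by (simp cong: measurable_cong_sets)
  moreover have "bounded (case_prod f ` (carrier SU2 \<times> carrier SU2))"
    by (intro compact_imp_bounded compact_continuous_image c compact_Times SU2_compact)
  then obtain B where "\<And>x y. x \<in> carrier SU2 \<Longrightarrow> y \<in> carrier SU2 \<Longrightarrow> norm (f x y) \<le> B"
    by (auto simp: bounded_iff)
  ultimately show ?thesis by (intro Fubini_bounded) (auto simp: space_SU2)
qed

lemma continuous_on_SU2_fst_snd [continuous_intros]:
  assumes "continuous_on (carrier SU2) f"
  shows "continuous_on (carrier SU2 \<times> carrier SU2) (\<lambda>p. f (fst p))" "continuous_on (carrier SU2 \<times> carrier SU2) (\<lambda>p. f (snd p))"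
  by (auto intro!: continuous_on_compose2[OF assms] continuous_intros)

lemma integral_conjugate:
  fixes f :: "mat2 \<Rightarrow> 'b::{banach, second_countable_topology}"
  assumes f: "continuous_on (carrier SU2) f" and b: "b \<in> carrier SU2"
  shows "(LINT c|M. f (b ** c ** conj_transpose b)) = (LINT c|M. f c)"
proof -
  have "(LINT c|M. f (b ** c ** conj_transpose b)) = (LINT c|M. f (c ** conj_transpose b))"
  proof -
    have "(\<lambda>c. f (c ** conj_transpose b)) \<in> borel_measurable M"
      by (intro borel_measurable_continuous continuous_on_compose2[OF f] continuous_intros)
        (auto intro!: SU2_mult_closed SU2_conj_transpose b)
    from integral_left_mult[OF this b] show ?thesis by simp
  qed
  also have "\<dots> = (LINT c|M. f c)"
    using integral_right_mult[of f "conj_transpose b"] b f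
    by (auto intro!: borel_measurable_continuous SU2_conj_transpose)
  finally show ?thesis .
qed

text \<open>The Casimir operator is symmetric and has different eigenvalues on the two
  characters.\<close>

lemma integral_char_neq:
  assumes A: "A \<in> carrier SU2" and "n \<noteq> m"
  shows "(LINT c|M. su2_char n (A ** c) * su2_char m c) = 0"
proof -
  define I where "I = (LINT c|M. su2_char n (A ** c) * su2_char m c)"
  note D = group_derivative_of_real[OF group_derivative_char(1)[OF su2_basis_su2, where A = "mat 1" and d = m]]
    group_derivative_of_real[OF group_derivative_char(2)[OF su2_basis_su2, where A = "mat 1" and d = m]]
  have I: "(LINT c|M. complex_of_real (su2_char n (A ** c)) * complex_of_real (su2_char m c)) = of_real I"
    unfolding I_def of_real_mult[symmetric] by (rule integral_complex_of_real)
  have "(LINT c|M. complex_of_real (su2_char n (A ** c)) * (\<Sum>k<3. complex_of_real (su2_char_deriv2 (su2_basis k) m c)))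
      = (LINT c|M. complex_of_real (1 - (real m)\<^sup>2) * (complex_of_real (su2_char n (A ** c)) * complex_of_real (su2_char m c)))"
    by (intro Bochner_Integration.integral_cong refl)
      (simp add: space_SU2 su2_char_casimir of_real_sum[symmetric] del: of_real_sum)
  hence "(1 - (real m)\<^sup>2) * complex_of_real I = (1 - (real n)\<^sup>2) * complex_of_real I"
    using integral_casimir[OF D A, of n] I by simp
  hence "complex_of_real ((real n)\<^sup>2 - (real m)\<^sup>2) * complex_of_real I = 0" by (simp add: algebra_simps)
  moreover have "(real n)\<^sup>2 - (real m)\<^sup>2 \<noteq> 0" using assms(2) by (simp add: power2_eq_iff_nonneg)
  ultimately show ?thesis by (simp add: I_def del: of_real_diff of_real_power)
qed

text \<open>With t the half trace, the recurrence is used twice: one factor of index n + 1 is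
  replaced by 2 t times index n, then 2 t times the other factor is expanded again, leaving the
  integral for n because all mixed terms vanish.\<close>

lemma integral_char_square:
  assumes "n > 0"
  shows "(LINT c|M. su2_char n c * su2_char n c) = 1"
  using assms
proof (induction n rule: nat_induct_non_zero)
  case 1
  show ?case by (simp add: su2_char_def prob_space)
next
  case (Suc n)
  have rec: "su2_char (Suc (Suc k)) c = 2 * half_trace c * su2_char (Suc k) c - su2_char k c" for k c
    unfolding su2_char_def by (rule cheb_V_rec)
  obtain k where n: "n = Suc k" using Suc.hyps by (cases n) auto
  have int: "integrable M (\<lambda>c. su2_char i c * su2_char j c)" "integrable M (\<lambda>c. half_trace c * su2_char i c * su2_char j c)" for i j
    by (intro integrable_continuous continuous_intros)+
  have neq: "(LINT c|M. su2_char i c * su2_char j c) = 0" if "i \<noteq> j" for i j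
    using integral_char_neq[of "mat 1", OF _ that] SU2.one_closed by simp
  have "(LINT c|M. su2_char (Suc n) c * su2_char (Suc n) c) = 
     (LINT c|M. 2 * (half_trace c * su2_char n c * su2_char (Suc n) c) - su2_char k c * su2_char (Suc n) c)"
    by (subst (1) n, subst rec) (simp add: n algebra_simps)
  also have "\<dots> = 2 * (LINT c|M. half_trace c * su2_char n c * su2_char (Suc n) c)"
    using int neq[of k "Suc n"] by (subst Bochner_Integration.integral_diff) (auto simp: n)
  also have "\<dots> = (LINT c|M. 2 * half_trace c * su2_char n c * su2_char (Suc n) c)" 
    by (simp flip: integral_mult_right_zero add: mult.assoc)
  also have "\<dots> = (LINT c|M. su2_char n c * su2_char (Suc (Suc n)) c + su2_char n c * su2_char n c)"
    unfolding rec by (simp add: algebra_simps)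
  also have "\<dots> = 1" using int neq[of n "Suc (Suc n)"] Suc.IH by (subst Bochner_Integration.integral_add) auto
  finally show ?case .
qed

text \<open>Averaging over the conjugates of \<open>c\<close> leaves the class function
  \<open>su2_char n c\<close> unchanged and factors the other character by the functional equation,
  so only the norm of the character remains.\<close>

lemma integral_char_char:
  assumes A: "A \<in> carrier SU2"
  shows "(LINT c|M. su2_char n (A ** c) * su2_char m c) = (if n = m then su2_char n A / n else 0)"
proof (cases "n = m \<and> n > 0")
  case True
  define I where "I = (LINT c|M. su2_char n (A ** c) * su2_char n c)"
  have "I = (LINT b|M. LINT c|M. su2_char n (A ** b ** c ** conj_transpose b) * su2_char n c)"
  proof -
    have "(LINT c|M. su2_char n (A ** b ** c ** conj_transpose b) * su2_char n c) = I" if b: "b \<in> carrier SU2" for b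
    proof -
      have "su2_char n (b ** c ** conj_transpose b) = su2_char n c" for c
        by (subst su2_char_commute) (simp add: matrix_mul_assoc SU2_conj_transpose[OF b])
      thus ?thesis unfolding I_def
        using integral_conjugate[of "\<lambda>c. su2_char n (A ** c) * su2_char n c", OF _ b]
        by (simp add: matrix_mul_assoc continuous_intros)
    qed
    hence "(LINT b|M. LINT c|M. su2_char n (A ** b ** c ** conj_transpose b) * su2_char n c) = (LINT b|M. I)"
      by (intro Bochner_Integration.integral_cong refl) (simp add: space_SU2)
    thus ?thesis by (simp add: prob_space)
  qed
  also have "\<dots> = (LINT c|M. LINT b|M. su2_char n (A ** b ** c ** conj_transpose b) * su2_char n c)"
    by (rule Fubini_continuous) (intro continuous_intros)
  also have "\<dots> = (LINT c|M. su2_char n A / n * (su2_char n c * su2_char n c))"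
  proof (intro Bochner_Integration.integral_cong refl)
    fix c assume "c \<in> space M"
    hence c: "c \<in> carrier SU2" by (simp add: space_SU2)
    have "su2_char n (A ** b ** c ** conj_transpose b) = su2_char n (b ** c ** conj_transpose b ** A)" for b
      using su2_char_commute[of n A "b ** c ** conj_transpose b"] by (simp add: matrix_mul_assoc)
    hence "(LINT b|M. su2_char n (A ** b ** c ** conj_transpose b) * su2_char n c) 
      = (LINT b|M. su2_char n (b ** c ** conj_transpose b ** A)) * su2_char n c" by simp
    also have "\<dots> = su2_char n A / n * (su2_char n c * su2_char n c)"
      using integral_char_conjugate[OF c A, of n] True by (simp add: field_simps)
    finally show "(LINT b|M. su2_char n (A ** b ** c ** conj_transpose b) * su2_char n c) = su2_char n A / n * (su2_char n c * su2_char n c)" .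
  qed
  also have "\<dots> = su2_char n A / n" using integral_char_square[of n] True by simp
  finally show ?thesis using True by (simp add: I_def)
next
  case False
  thus ?thesis using integral_char_neq[OF A, of n m] by (auto simp: su2_char_def)
qed

lemma integral_char:
  "(LINT c|M. su2_char n c) = (if n = 1 then 1 else 0)"
  using integral_char_char[OF SU2.one_closed, of n 1] by (simp add: su2_char_def)

text \<open>Differentiating a known integral identity with respect to a one-parameter subgroup
  replaces a character in it by its derivative; the base point \<open>p c\<close> is
  arbitrary.\<close>

lemma integral_group_derivative_param:
  fixes f f' :: "mat2 \<Rightarrow> real"
  assumes X: "X \<in> su2" and f: "group_derivative X f f'" 
    and p: "continuous_on (carrier SU2) p" "\<And>c. c \<in> carrier SU2 \<Longrightarrow> p c \<in> carrier SU2"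
    and w: "continuous_on (carrier SU2) w"
    and J: "\<And>s. (LINT c|M. f (p c ** su2_exp X s) * w c) = J s" "(J has_vector_derivative J') (at 0)"
  shows "(LINT c|M. f' (p c) * w c) = J'"
proof -
  have c: "continuous_on (carrier SU2) f" "continuous_on (carrier SU2) f'"
    using f by (auto simp: group_derivative_def)
  have "bounded (f' ` carrier SU2)" "bounded (w ` carrier SU2)" 
    by (intro compact_imp_bounded compact_continuous_image c w SU2_compact)+
  then obtain B C where B: "\<And>x. x \<in> carrier SU2 \<Longrightarrow> \<bar>f' x\<bar> \<le> B" and C: "\<And>x. x \<in> carrier SU2 \<Longrightarrow> \<bar>w x\<bar> \<le> C" 
    by (auto simp: bounded_iff)
  have cl: "p c ** su2_exp X s \<in> carrier SU2" if "c \<in> carrier SU2" for c s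
    using that by (intro SU2_mult_closed su2_exp_SU2 X p)
  have "(LINT c|M. f' (p c ** su2_exp X 0) * w c) = J'"
  proof (rule integral_of_derivative[where F = "\<lambda>c s. f (p c ** su2_exp X s) * w c" and F' = "\<lambda>c s. f' (p c ** su2_exp X s) * w c" 
        and B = "B * C" and \<Phi> = J])
    fix s show "integrable M (\<lambda>c. f (p c ** su2_exp X s) * w c)"
      by (intro integrable_continuous continuous_intros w continuous_on_compose2[OF c(1)] p) (auto intro: cl p)
  next
    fix c s assume "c \<in> space M"
    hence c: "c \<in> carrier SU2" by (simp add: space_SU2)
    show "((\<lambda>s. f (p c ** su2_exp X s) * w c) has_vector_derivative f' (p c ** su2_exp X s) * w c) (at s)"
      by (rule bounded_linear.has_vector_derivative[OF bounded_linear_mult_left group_derivative_at[OF X f p(2)[OF c]]])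
    show "norm (f' (p c ** su2_exp X s) * w c) \<le> B * C"
      using B[OF cl[OF c]] C[OF c] order_trans[OF abs_ge_zero B[OF cl[OF c]]] unfolding real_norm_def abs_mult by (intro mult_mono) auto
  next
    show "(\<lambda>c. f' (p c ** su2_exp X 0) * w c) \<in> borel_measurable M"
      by (intro borel_measurable_continuous continuous_intros w continuous_on_compose2[OF c(2)] p) (auto intro: cl p)
  qed (use J in auto)
  thus ?thesis by simp
qed

context
  fixes X assumes X: "X \<in> su2"
begin

lemma integral_char_deriv_char:
  assumes g: "g \<in> carrier SU2"
  shows "(LINT c|M. su2_char_deriv X n (c ** g) * su2_char m c) = (if n = m then su2_char_deriv X n g / n else 0)"
proof -
  note D = group_derivative_char(1)[OF X, where A = "mat 1" and d = n, simplified]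
  show ?thesis
  proof (rule integral_group_derivative_param[OF X D, where p = "\<lambda>c. c ** g"])
    fix s
    have gE: "g ** su2_exp X s \<in> carrier SU2" by (intro SU2_mult_closed g su2_exp_SU2 X)
    have "su2_char n (c ** g ** su2_exp X s) = su2_char n (g ** su2_exp X s ** c)" for c
      using su2_char_commute[of n c "g ** su2_exp X s"] by (simp add: matrix_mul_assoc)
    thus "(LINT c|M. su2_char n (c ** g ** su2_exp X s) * su2_char m c) = (if n = m then 1 / n else 0) *\<^sub>R su2_char n (g ** su2_exp X s)"
      using integral_char_char[OF gE, of n m] by simp
  next
    have "((\<lambda>s. (if n = m then 1 / n else 0) *\<^sub>R su2_char n (g ** su2_exp X s)) has_vector_derivative (if n = m then 1 / n else 0) *\<^sub>R su2_char_deriv X n g) (at 0)"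
      using D g by (intro bounded_linear.has_vector_derivative[OF bounded_linear_scaleR_right]) (auto simp: group_derivative_def)
    thus "((\<lambda>s. (if n = m then 1 / n else 0) *\<^sub>R su2_char n (g ** su2_exp X s)) has_vector_derivative (if n = m then su2_char_deriv X n g / n else 0)) (at 0)"
      by (simp split: if_splits)
  qed (auto intro!: continuous_intros SU2_mult_closed g)
qed

text \<open>Right invariance shifts the one-parameter group from the factor with index
  \<open>m\<close> to the other one, where it appears inverted; the derivative in its parameter then
  gives the second derivative with a minus sign.\<close>

lemma integral_char_deriv_deriv:
  assumes g: "g \<in> carrier SU2"
  shows "(LINT c|M. su2_char_deriv X n (c ** g) * su2_char_deriv X m c) = (if n = m then - su2_char_deriv2 X n g / n else 0)"
proof -
  let ?E = "su2_exp X"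
  define a where "a = (if n = m then 1 / real n else 0)"
  note Dm = group_derivative_char(1)[OF X, where A = "mat 1" and d = m, simplified]
  note Dn = group_derivative_char(2)[OF X, where A = "mat 1" and d = n, simplified]
  \<comment> \<open>The one-parameter group commutes with \<open>X\<close>, so it may change sides
    inside the derivative of the character, where it is in the position required for differentiating
    once more.\<close>
  have comm: "su2_char_deriv X n (?E s ** g) = su2_char_deriv X n (g ** ?E s)" for s
  proof -
    have "?E s ** X = X ** ?E s" by (simp add: su2_exp_def mat2_distribs)
    hence "half_trace (?E s ** g ** X) = half_trace (g ** ?E s ** X)"
      by (metis half_trace_commute matrix_mul_assoc)
    thus ?thesis by (simp add: su2_char_deriv_def half_trace_commute[of "?E s" g])
  qed
  have "(LINT c|M. su2_char_deriv X m c * su2_char_deriv X n (c ** g)) = a *\<^sub>R (- su2_char_deriv2 X n g)"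
  proof (rule integral_group_derivative_param[OF X Dm, where p = "\<lambda>c. c"])
    fix s
    have E: "?E (- s) \<in> carrier SU2" by (intro su2_exp_SU2 X)
    have EE: "?E s ** ?E (- s) = mat 1" "?E (- s) ** ?E s = mat 1" by (simp_all add: su2_exp_add[OF X, symmetric])
    have "(LINT c|M. su2_char m (c ** ?E s) * su2_char_deriv X n (c ** g)) = 
       (LINT c|M. su2_char m (c ** ?E (- s) ** ?E s) * su2_char_deriv X n (c ** ?E (- s) ** g))"
      using integral_right_mult[of "\<lambda>c. su2_char m (c ** ?E s) * su2_char_deriv X n (c ** g)", OF _ E]
      by (simp add: borel_measurable_continuous continuous_intros)
    also have "\<dots> = (LINT c|M. su2_char_deriv X n (c ** (?E (- s) ** g)) * su2_char m c)"
      by (simp add: matrix_mul_assoc[symmetric] EE mult.commute)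
    also have "\<dots> = a *\<^sub>R su2_char_deriv X n (g ** ?E (- s))"
      unfolding comm[symmetric] using integral_char_deriv_char[of "?E (- s) ** g" n m] by (simp add: SU2_mult_closed E g a_def)
    finally show "(LINT c|M. su2_char m (c ** ?E s) * su2_char_deriv X n (c ** g)) = a *\<^sub>R su2_char_deriv X n (g ** ?E (- s))" .
  next
    have "((\<lambda>s. su2_char_deriv X n (g ** ?E s)) has_vector_derivative su2_char_deriv2 X n g) (at 0)"
      using Dn g by (auto simp: group_derivative_def)
    hence "((\<lambda>s. su2_char_deriv X n (g ** ?E (- s))) has_vector_derivative - su2_char_deriv2 X n g) (at 0)"
      using vector_diff_chain_at[of uminus "-1" 0 "\<lambda>s. su2_char_deriv X n (g ** ?E s)"]
      by (simp add: o_def has_vector_derivative_minus has_vector_derivative_id)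
    thus "((\<lambda>s. a *\<^sub>R su2_char_deriv X n (g ** ?E (- s))) has_vector_derivative a *\<^sub>R (- su2_char_deriv2 X n g)) (at 0)"
      by (rule bounded_linear.has_vector_derivative[OF bounded_linear_scaleR_right])
  qed (auto intro!: continuous_intros)
  thus ?thesis by (simp add: mult.commute a_def)
qed

lemma integral_char_deriv_conjugate:
  assumes h: "h \<in> carrier SU2" and y: "y \<in> carrier SU2"
  shows "real n * (LINT b|M. su2_char_deriv X n (b ** h ** conj_transpose b ** y)) = su2_char n h * su2_char_deriv X n y"
proof (cases "n = 0")
  case False
  note D = group_derivative_char(1)[OF X, where A = "mat 1" and d = n, simplified]
  have "(LINT b|M. su2_char_deriv X n (b ** h ** conj_transpose b ** y) * 1) = (su2_char n h / n) *\<^sub>R su2_char_deriv X n y"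
  proof (rule integral_group_derivative_param[OF X D, where p = "\<lambda>b. b ** h ** conj_transpose b ** y"])
    fix s
    show "(LINT b|M. su2_char n (b ** h ** conj_transpose b ** y ** su2_exp X s) * 1) = (su2_char n h / n) *\<^sub>R su2_char n (y ** su2_exp X s)"
      using integral_char_conjugate[OF h, of "y ** su2_exp X s" n] False
      by (simp add: SU2_mult_closed y su2_exp_SU2 X matrix_mul_assoc field_simps)
  next
    show "((\<lambda>s. (su2_char n h / n) *\<^sub>R su2_char n (y ** su2_exp X s)) has_vector_derivative (su2_char n h / n) *\<^sub>R su2_char_deriv X n y) (at 0)"
      using D y by (intro bounded_linear.has_vector_derivative[OF bounded_linear_scaleR_right]) (auto simp: group_derivative_def)
  qed (auto intro!: continuous_intros SU2_mult_closed SU2_conj_transpose h y)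
  thus ?thesis using False by simp
qed (simp add: su2_char_def)

end

section \<open>Abel summation of character coefficients\<close>

lemma poisson_kernel_sums:
  assumes "0 \<le> r" "r < 1" "g \<in> carrier SU2"
  shows "(\<lambda>n. real n * r ^ n * su2_char n g) sums (r * (1 - r\<^sup>2) / (1 - 2 * r * half_trace g + r\<^sup>2)\<^sup>2)"
  unfolding su2_char_def by (rule poisson_sums[OF assms(1,2) half_trace_bound[OF assms(3)]])

text \<open>The n-th character is at most n in modulus, so the terms are dominated by n^2 r^n and
  summation and integration may be exchanged.\<close>

lemma integral_poisson:
  fixes f :: "mat2 \<Rightarrow> complex"
  assumes r: "0 \<le> r" "r < 1" and f: "continuous_on (carrier SU2) f"
  shows "(\<lambda>n. of_real (r ^ n) * (LINT k|M. of_real (real n * su2_char n k) * f k)) sums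
    (LINT k|M. of_real (r * (1 - r\<^sup>2) / (1 - 2 * r * half_trace k + r\<^sup>2)\<^sup>2) * f k)"
proof -
  have "bounded (f ` carrier SU2)" by (intro compact_imp_bounded compact_continuous_image f SU2_compact)
  then obtain B where B: "\<And>x. x \<in> carrier SU2 \<Longrightarrow> norm (f x) \<le> B" by (auto simp: bounded_iff)
  define F where "F = (\<lambda>n k. of_real (real n * r ^ n * su2_char n k) * f k)"
  have le: "norm (F n k) \<le> (real n)\<^sup>2 * r ^ n * B" if "k \<in> carrier SU2" for n k
  proof -
    have "norm (F n k) = (real n * r ^ n * \<bar>su2_char n k\<bar>) * norm (f k)"
      unfolding F_def norm_mult norm_of_real abs_mult using r by simp
    also have "\<dots> \<le> (real n * r ^ n * real n) * B"
      using r B[OF that] su2_char_bound[OF that, of n] by (intro mult_mono mult_left_mono) auto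
    finally show ?thesis by (simp add: power2_eq_square mult_ac)
  qed
  have summ: "summable (\<lambda>n. (real n)\<^sup>2 * r ^ n * B)" by (intro summable_mult2 summable_power2_mult_power r)
  have int: "integrable M (F n)" for n
    unfolding F_def by (intro integrable_continuous continuous_intros f)
  have "(\<lambda>n. LINT k|M. F n k) sums (LINT k|M. (\<Sum>n. F n k))"
  proof (rule sums_integral[OF int])
    show "AE k in M. summable (\<lambda>n. norm (F n k))"
      using le by (intro AE_I2 summable_comparison_test'[OF summ]) (auto simp: space_SU2)
    show "summable (\<lambda>n. LINT k|M. norm (F n k))"
    proof (rule summable_comparison_test'[OF summ])
      fix n
      have "(LINT k|M. norm (F n k)) \<le> (LINT k|M. (real n)\<^sup>2 * r ^ n * B)"
        using le by (intro integral_mono integrable_norm int) (auto simp: space_SU2)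
      thus "norm (LINT k|M. norm (F n k)) \<le> (real n)\<^sup>2 * r ^ n * B" by (simp add: prob_space)
    qed
  qed
  also have "(LINT k|M. (\<Sum>n. F n k)) = (LINT k|M. of_real (r * (1 - r\<^sup>2) / (1 - 2 * r * half_trace k + r\<^sup>2)\<^sup>2) * f k)"
  proof (intro Bochner_Integration.integral_cong refl)
    fix k assume "k \<in> space M"
    hence "k \<in> carrier SU2" by (simp add: space_SU2)
    from sums_mult2[OF sums_of_real[OF poisson_kernel_sums[OF r this]], of "f k"]
    show "(\<Sum>n. F n k) = of_real (r * (1 - r\<^sup>2) / (1 - 2 * r * half_trace k + r\<^sup>2)\<^sup>2) * f k"
      unfolding F_def by (simp add: sums_iff)
  qed
  also have "(\<lambda>n. LINT k|M. F n k) = (\<lambda>n. of_real (r ^ n) * (LINT k|M. of_real (real n * su2_char n k) * f k))"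
    unfolding F_def by (subst integral_mult_right_zero[symmetric]) (simp add: mult_ac)
  finally show ?thesis .
qed

end

section \<open>Expansion in characters and the Fourier algebra\<close>

text \<open>The Poisson kernel depends only on the half trace; this identity turns its concentration
  at half trace 1 into concentration at the identity.\<close>

lemma SU2_near_one:
  assumes g: "g \<in> carrier SU2"
  shows "(norm (g - mat 1))\<^sup>2 = 4 * (1 - half_trace g)"
proof -
  have "(Re (g $ 1 $ 1))\<^sup>2 + (Im (g $ 1 $ 1))\<^sup>2 + (Re (g $ 1 $ 2))\<^sup>2 + (Im (g $ 1 $ 2))\<^sup>2 = 1"
    using arg_cong[OF SU2_entries(3)[OF g], of Re] by (simp add: power2_eq_square)
  moreover have "(norm (g - mat 1))\<^sup>2 = (cmod (g $ 1 $ 1 - 1))\<^sup>2 + (cmod (g $ 1 $ 2))\<^sup>2 + (cmod (g $ 2 $ 1))\<^sup>2 + (cmod (g $ 2 $ 2 - 1))\<^sup>2"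
    by (simp add: norm_vec_def L2_set_def sum_2 mat2_one_nth)
  ultimately show ?thesis unfolding cmod_power2 using SU2_entries(1,2)[OF g]
    by (simp add: half_trace_def power2_eq_square algebra_simps)
qed

context su2_haar
begin

text \<open>The Poisson kernel \<open>r (1 - r\<^sup>2) / (1 - 2 r t + r\<^sup>2)\<^sup>2\<close> is a positive approximate identity, which
  makes the character expansion Abel summable; absolute convergence then removes the Abel factor.\<close>

lemma char_expansion:
  fixes f :: "mat2 \<Rightarrow> complex"
  assumes f: "continuous_on (carrier SU2) f"
    and summ: "summable (\<lambda>n. norm (LINT k|M. of_real (real n * su2_char n k) * f k))"
  shows "(\<Sum>n. LINT k|M. of_real (real n * su2_char n k) * f k) = f (mat 1)"
proof -
  define c where "c = (\<lambda>n. LINT k|M. of_real (real n * su2_char n k) * f k)"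
  define P where "P = (\<lambda>r k. r * (1 - r\<^sup>2) / (1 - 2 * r * half_trace k + r\<^sup>2)\<^sup>2)"
  define r where "r = (\<lambda>j. 1 - inverse (real (Suc j)))"
  have r: "0 \<le> r j" "r j < 1" for j by (auto simp: r_def field_simps)
  have r_lim: "r \<longlonglongrightarrow> 1" 
    using tendsto_diff[OF tendsto_const LIMSEQ_inverse_real_of_nat, of 1] by (simp add: r_def)
  have "bounded (f ` carrier SU2)" by (intro compact_imp_bounded compact_continuous_image f SU2_compact)
  then obtain B where B: "\<And>x. x \<in> carrier SU2 \<Longrightarrow> norm (f x) \<le> B" by (auto simp: bounded_iff)
  have B0: "B \<ge> 0" using B[OF SU2.one_closed] norm_ge_zero order_trans by blast
  have den: "1 - 2 * r j * half_trace k + (r j)\<^sup>2 > 0" if "k \<in> carrier SU2" for j k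
  proof -
    have "r j * half_trace k \<le> r j" using r[of j] half_trace_bound[OF that] by (intro mult_left_le) auto
    hence "1 - 2 * r j * half_trace k + (r j)\<^sup>2 \<ge> (1 - r j)\<^sup>2" by (simp add: power2_diff)
    moreover have "(1 - r j)\<^sup>2 > 0" using r[of j] by simp
    ultimately show ?thesis by linarith
  qed
  have P0: "P (r j) k \<ge> 0" for j k
    using r[of j] unfolding P_def by (intro divide_nonneg_nonneg mult_nonneg_nonneg) (auto simp: power_le_one)
  have P_cont: "continuous_on (carrier SU2) (P (r j))" for j
  proof -
    have "(1 - 2 * r j * half_trace k + (r j)\<^sup>2)\<^sup>2 \<noteq> 0" if "k \<in> carrier SU2" for k
      using den[OF that, of j] by simp
    thus ?thesis unfolding P_def by (intro continuous_intros ballI)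
  qed
  have sums: "(\<lambda>n. of_real (r j ^ n) * c n) sums (LINT k|M. of_real (P (r j) k) * f k)" for j
    unfolding c_def P_def by (rule integral_poisson[OF r f])
  \<comment> \<open>Expanding the constant function leaves only the coefficient of the trivial
    character, so the mass of the kernel is \<open>r j\<close>, which tends to 1.\<close>
  have P_int: "(LINT k|M. P (r j) k) = r j" for j
  proof -
    have sums1: "(\<lambda>n. of_real (r j ^ n) * (LINT k|M. of_real (real n * su2_char n k) * (1::complex))) sums (LINT k|M. of_real (P (r j) k) * 1)"
      unfolding P_def by (rule integral_poisson[OF r]) (rule continuous_on_const)
    have coeff: "of_real (r j ^ n) * (LINT k|M. of_real (real n * su2_char n k) * (1::complex)) = (if n = 1 then of_real (r j) else 0)" for n
      using integral_char[of n] by simp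
    have "(\<lambda>n. if n = 1 then complex_of_real (r j) else 0) sums of_real (r j)" by (rule sums_single)
    hence "(LINT k|M. complex_of_real (P (r j) k) * 1) = of_real (r j)"
      by (rule sums_unique2[OF sums1[unfolded coeff]])
    thus ?thesis by (simp del: of_real_mult)
  qed
  have "(\<lambda>j. LINT k|M. of_real (P (r j) k) * f k) \<longlonglongrightarrow> (\<Sum>n. c n)"
  proof -
    \<comment> \<open>Tannery's theorem with the absolutely summable coefficients themselves as
      majorant.\<close>
    have "(\<lambda>j. \<Sum>n. of_real (r j ^ n) * c n) \<longlonglongrightarrow> (\<Sum>n. c n)"
    proof (rule tannerys_theorem[THEN conjunct2, THEN conjunct2])
      show "(\<lambda>j. of_real (r j ^ n) * c n) \<longlonglongrightarrow> c n" for n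
        using r_lim by (auto intro!: tendsto_eq_intros)
      show "summable (\<lambda>n. norm (c n))" using summ by (simp add: c_def)
      have "norm (of_real (r j ^ n) * c n) \<le> norm (c n)" for n j
        using r[of j] by (auto simp: norm_mult norm_power power_le_one intro!: mult_left_le_one_le)
      thus "\<forall>\<^sub>F (n, j) in sequentially \<times>\<^sub>F sequentially. norm (of_real (r j ^ n) * c n) \<le> norm (c n)"
        by (intro always_eventually) auto
    qed simp
    thus ?thesis using sums by (simp add: sums_iff)
  qed
  moreover have "(\<lambda>j. of_real (r j) * f (mat 1)) \<longlonglongrightarrow> f (mat 1)"
    using r_lim by (auto intro!: tendsto_eq_intros)
  ultimately have lim: "(\<lambda>j. norm ((LINT k|M. of_real (P (r j) k) * f k) - of_real (r j) * f (mat 1))) \<longlonglongrightarrow> norm ((\<Sum>n. c n) - f (mat 1))"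
    by (intro tendsto_intros)
  have "norm ((\<Sum>n. c n) - f (mat 1)) \<le> e" if e: "e > 0" for e
  proof -
    obtain d where d: "d > 0" "\<And>g. g \<in> carrier SU2 \<Longrightarrow> dist g (mat 1) < d \<Longrightarrow> dist (f g) (f (mat 1)) < e"
      using f SU2.one_closed e unfolding continuous_on_iff by (metis SU2_one)
    define \<delta> where "\<delta> = d\<^sup>2 / 4"
    have \<delta>: "\<delta> > 0" using d by (simp add: \<delta>_def)
    \<comment> \<open>A bound for the kernel where the half trace is at most
      \<open>1 - \<delta>\<close>: the base of the denominator is at least
      \<open>2 * r j * \<delta>\<close>. It is used for \<open>j \<ge> 1\<close> only, as
      \<open>r 0 = 0\<close>.\<close>
    define m where "m = (\<lambda>j. r j * (1 - (r j)\<^sup>2) / (2 * r j * \<delta>)\<^sup>2)"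
    have bound: "P (r j) k * norm (f k - f (mat 1)) \<le> P (r j) k * e + 2 * B * m j" if k: "k \<in> carrier SU2" and j: "j \<ge> 1" for k j
    proof (cases "half_trace k > 1 - \<delta>")
      case True
      have "(norm (k - mat 1))\<^sup>2 < d\<^sup>2" unfolding SU2_near_one[OF k] using True by (simp add: \<delta>_def)
      hence "norm (k - mat 1) < d" using d(1) by (simp add: power2_less_imp_less)
      hence "norm (f k - f (mat 1)) \<le> e" using d(2)[OF k] by (auto simp: dist_norm intro: less_imp_le)
      hence "P (r j) k * norm (f k - f (mat 1)) \<le> P (r j) k * e" using P0 by (intro mult_left_mono) auto
      moreover have "m j \<ge> 0" unfolding m_def using r[of j] 
        by (intro divide_nonneg_nonneg mult_nonneg_nonneg) (auto simp: power_le_one)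
      ultimately show ?thesis using B0 by (simp add: add_increasing2)
    next
      case False
      have rj: "r j > 0" using j by (simp add: r_def field_simps)
      have "2 * r j * \<delta> \<le> 2 * r j * (1 - half_trace k)" using False rj by (intro mult_left_mono) auto
      also have "\<dots> \<le> (1 - r j)\<^sup>2 + 2 * r j * (1 - half_trace k)" by simp
      also have "\<dots> = 1 - 2 * r j * half_trace k + (r j)\<^sup>2" by (simp add: power2_eq_square algebra_simps)
      finally have "P (r j) k \<le> m j" unfolding P_def m_def using r[of j] rj \<delta>
        by (intro divide_left_mono power_mono mult_nonneg_nonneg mult_pos_pos zero_less_power den k) (auto simp: power_le_one)
      moreover have "norm (f k - f (mat 1)) \<le> 2 * B"
        using norm_triangle_ineq4[of "f k" "f (mat 1)"] B[OF k] B[OF SU2.one_closed] by simp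
      ultimately have "P (r j) k * norm (f k - f (mat 1)) \<le> m j * (2 * B)"
        using P0 by (intro mult_mono) (auto intro: order_trans)
      thus ?thesis using mult_nonneg_nonneg[OF P0[of j k] less_imp_le[OF e]] by (simp add: mult_ac)
    qed
    have "norm ((LINT k|M. of_real (P (r j) k) * f k) - of_real (r j) * f (mat 1)) \<le> r j * e + 2 * B * m j" if j: "j \<ge> 1" for j
    proof -
      have i1: "integrable M (\<lambda>k. complex_of_real (P (r j) k) * f k)" "integrable M (\<lambda>k. complex_of_real (P (r j) k) * f (mat 1))"
        by (intro integrable_continuous continuous_intros f P_cont)+
      have "of_real (r j) * f (mat 1) = (LINT k|M. of_real (P (r j) k) * f (mat 1))"
        by (simp add: P_int)
      hence "(LINT k|M. of_real (P (r j) k) * f k) - of_real (r j) * f (mat 1) = (LINT k|M. of_real (P (r j) k) * (f k - f (mat 1)))"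
        using i1 by (simp add: right_diff_distrib)
      hence "norm ((LINT k|M. of_real (P (r j) k) * f k) - of_real (r j) * f (mat 1)) \<le> (LINT k|M. norm (of_real (P (r j) k) * (f k - f (mat 1))))"
        by (simp only: integral_norm_bound)
      also have "\<dots> \<le> (LINT k|M. P (r j) k * e + 2 * B * m j)"
      proof (rule integral_mono)
        show "integrable M (\<lambda>k. norm (of_real (P (r j) k) * (f k - f (mat 1))))" "integrable M (\<lambda>k. P (r j) k * e + 2 * B * m j)"
          by (intro integrable_continuous continuous_intros f P_cont)+
        show "norm (of_real (P (r j) k) * (f k - f (mat 1))) \<le> P (r j) k * e + 2 * B * m j" if "k \<in> space M" for k
          using bound[OF _ j] that P0[of j k] by (simp add: space_SU2 norm_mult)
      qed
      also have "\<dots> = r j * e + 2 * B * m j"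
        using integrable_continuous[OF P_cont[of j]] by (simp add: P_int prob_space)
      finally show ?thesis .
    qed
    moreover have "m \<longlonglongrightarrow> 1 * (1 - 1\<^sup>2) / (2 * 1 * \<delta>)\<^sup>2"
      unfolding m_def using \<delta> by (intro tendsto_intros r_lim) auto
    hence "(\<lambda>j. r j * e + 2 * B * m j) \<longlonglongrightarrow> 1 * e + 2 * B * 0" by (intro tendsto_intros r_lim) simp
    ultimately show ?thesis by (intro LIMSEQ_le[OF lim]) auto
  qed
  hence "norm ((\<Sum>n. c n) - f (mat 1)) \<le> 0" by (rule field_le_epsilon[of _ 0, simplified])
  thus ?thesis by (simp add: c_def)
qed

text \<open>Two powers of 1 + Casimir are inverted because a single one would leave the n-th
  character over n, bounded by 1 only; the exponent 3 bounds the terms by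
  \<open>1 / (real n)\<^sup>2\<close> and makes the sum continuous.\<close>

definition resolvent_kernel :: "mat2 \<Rightarrow> complex" where
  "resolvent_kernel g = of_real (\<Sum>n. su2_char n g / real n ^ 3)"

lemma summable_inverse_square: "summable (\<lambda>n. 1 / (real n)\<^sup>2)"
  using inverse_power_summable[of 2, where 'a = real] by (simp add: inverse_eq_divide)

lemma char_div_cube_bound: "g \<in> carrier SU2 \<Longrightarrow> norm (su2_char n g / real n ^ 3) \<le> 1 / (real n)\<^sup>2"
  using su2_char_bound[of g n] by (cases "n = 0") (auto simp: power2_eq_square power3_eq_cube field_simps)

lemma continuous_on_char_div_cube: "continuous_on S f \<Longrightarrow> continuous_on S (\<lambda>x. su2_char n (f x) / real n ^ 3)"
  by (cases "n = 0") (auto intro!: continuous_intros)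

lemma continuous_on_resolvent_kernel: "continuous_on (carrier SU2) resolvent_kernel"
proof -
  have "uniform_limit (carrier SU2) (\<lambda>N g. \<Sum>n<N. su2_char n g / real n ^ 3) (\<lambda>g. \<Sum>n. su2_char n g / real n ^ 3) sequentially"
    by (rule Weierstrass_m_test[OF char_div_cube_bound summable_inverse_square])
  hence "continuous_on (carrier SU2) (\<lambda>g. \<Sum>n. su2_char n g / real n ^ 3)"
    by (rule uniform_limit_theorem[rotated]) (auto intro!: always_eventually continuous_on_sum continuous_on_char_div_cube)
  thus ?thesis unfolding resolvent_kernel_def by (intro continuous_intros)
qed

text \<open>\<open>resolvent_kernel\<close> is a fundamental solution of the square of \<open>1 + Casimir\<close>, which acts on
  the \<open>n\<close>-th isotypic component as \<open>n\<^sup>4\<close>, against \<open>n \<chi>\<^sub>n\<close> for the identity.\<close>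

lemma resolvent_representation:
  fixes f F :: "mat2 \<Rightarrow> complex"
  assumes f: "continuous_on (carrier SU2) f" and F: "continuous_on (carrier SU2) F"
    and eig: "\<And>n A. A \<in> carrier SU2 \<Longrightarrow> (LINT x|M. su2_char n (A ** x) * F x) = of_nat n ^ 4 * (LINT x|M. su2_char n (A ** x) * f x)"
    and g: "g \<in> carrier SU2"
  shows "f g = (LINT x|M. resolvent_kernel (conj_transpose g ** x) * F x)"
proof -
  have g': "conj_transpose g \<in> carrier SU2" using g by (rule SU2_conj_transpose)
  have cl: "g ** k \<in> carrier SU2" "conj_transpose g ** k \<in> carrier SU2" if "k \<in> carrier SU2" for k
    using that g g' by (auto intro: SU2_mult_closed)
  have "bounded (F ` carrier SU2)" by (intro compact_imp_bounded compact_continuous_image F SU2_compact)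
  then obtain B where B: "\<And>x. x \<in> carrier SU2 \<Longrightarrow> norm (F x) \<le> B" by (auto simp: bounded_iff)
  have B0: "B \<ge> 0" using B[OF SU2.one_closed] norm_ge_zero order_trans by blast
  define H where "H = (\<lambda>n x. of_real (su2_char n (conj_transpose g ** x) / real n ^ 3) * F x)"
  have H_int: "integrable M (H n)" for n
    unfolding H_def by (intro integrable_continuous continuous_on_mult continuous_on_of_real continuous_on_char_div_cube F continuous_intros)
  have H_le: "norm (H n x) \<le> 1 / (real n)\<^sup>2 * B" if "x \<in> carrier SU2" for n x
    unfolding H_def norm_mult norm_of_real
    using char_div_cube_bound[OF cl(2)[OF that], of n] B[OF that] by (intro mult_mono) auto
  have summ: "summable (\<lambda>n. 1 / (real n)\<^sup>2 * B)" by (intro summable_mult2 summable_inverse_square)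
  have HI_le: "(LINT x|M. norm (H n x)) \<le> 1 / (real n)\<^sup>2 * B" for n
  proof -
    have "(LINT x|M. norm (H n x)) \<le> (LINT x|M. 1 / (real n)\<^sup>2 * B)"
      using H_le by (intro integral_mono integrable_norm H_int) (auto simp: space_SU2)
    thus ?thesis by (simp add: prob_space)
  qed
  have "(\<lambda>n. LINT x|M. H n x) sums (LINT x|M. (\<Sum>n. H n x))"
  proof (rule sums_integral[OF H_int])
    show "AE x in M. summable (\<lambda>n. norm (H n x))"
      using H_le by (intro AE_I2 summable_comparison_test'[OF summ]) (auto simp: space_SU2)
    show "summable (\<lambda>n. LINT x|M. norm (H n x))"
      using HI_le by (intro summable_comparison_test'[OF summ]) auto
  qed
  also have "(LINT x|M. (\<Sum>n. H n x)) = (LINT x|M. resolvent_kernel (conj_transpose g ** x) * F x)"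
  proof (intro Bochner_Integration.integral_cong refl)
    fix x assume "x \<in> space M"
    hence x: "conj_transpose g ** x \<in> carrier SU2" by (simp add: space_SU2 cl)
    have "summable (\<lambda>n. su2_char n (conj_transpose g ** x) / real n ^ 3)"
      by (rule summable_comparison_test'[OF summable_inverse_square char_div_cube_bound[OF x]])
    from sums_mult2[OF sums_of_real[OF summable_sums[OF this]], of "F x"]
    show "(\<Sum>n. H n x) = resolvent_kernel (conj_transpose g ** x) * F x"
      unfolding H_def resolvent_kernel_def by (simp add: sums_iff)
  qed
  finally have 1: "(\<lambda>n. LINT x|M. H n x) sums (LINT x|M. resolvent_kernel (conj_transpose g ** x) * F x)" .
  have fg: "continuous_on (carrier SU2) (\<lambda>k. f (g ** k))"
    by (rule continuous_on_compose2[OF f]) (auto intro!: continuous_intros cl)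
  have 2: "(LINT k|M. of_real (real n * su2_char n k) * f (g ** k)) = (LINT x|M. H n x)" for n
  proof -
    have "(\<lambda>x. of_real (real n * su2_char n (conj_transpose g ** x)) * f x) \<in> borel_measurable M"
      by (intro borel_measurable_continuous continuous_intros f)
    from integral_left_mult[OF this g]
    have "(LINT k|M. of_real (real n * su2_char n k) * f (g ** k)) = (LINT x|M. of_real (real n * su2_char n (conj_transpose g ** x)) * f x)"
      by (simp add: matrix_mul_assoc SU2_conj_transpose[OF g])
    also have "\<dots> = of_nat n * (LINT x|M. su2_char n (conj_transpose g ** x) * f x)" by (simp add: mult.assoc)
    \<comment> \<open>The weight n of the character expansion is n^4 / n^3, also for
      \<open>n = 0\<close>, where both sides are zero.\<close>
    also have "\<dots> = (1 / of_nat n ^ 3) * (of_nat n ^ 4 * (LINT x|M. su2_char n (conj_transpose g ** x) * f x))"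
      by (cases "n = 0") (simp_all add: power3_eq_cube power4_eq_xxxx)
    also have "\<dots> = (LINT x|M. H n x)" unfolding eig[OF g', symmetric] H_def 
      by (subst integral_mult_right_zero[symmetric]) (simp add: mult_ac)
    finally show ?thesis .
  qed
  have "summable (\<lambda>n. norm (LINT k|M. of_real (real n * su2_char n k) * f (g ** k)))"
    unfolding 2 using HI_le by (intro summable_comparison_test'[OF summ]) (auto intro: order_trans[OF integral_norm_bound])
  from char_expansion[OF fg this] have "(\<Sum>n. LINT x|M. H n x) = f g" unfolding 2 by simp
  thus ?thesis using 1 by (simp add: sums_iff)
qed

end

section \<open>Derivatives of smooth functions on the product group\<close>

lemma C_k_on_subset: "C_k_on k f W \<Longrightarrow> W' \<subseteq> W \<Longrightarrow> C_k_on k f W'"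
  by (induction k arbitrary: f) (auto intro: continuous_on_subset)

lemma smooth_fun_on_add:
  assumes "smooth_fun_on S u" "smooth_fun_on S v"
  shows "smooth_fun_on S (\<lambda>x. u x + v x)"
  unfolding smooth_fun_on_def
proof
  fix p assume p: "p \<in> S"
  from assms(1) p obtain W F where W: "open W" "p \<in> W" "\<forall>k. C_k_on k F W" "\<forall>x\<in>W \<inter> S. F x = u x"
    unfolding smooth_fun_on_def by blast
  from assms(2) p obtain W' F' where W': "open W'" "p \<in> W'" "\<forall>k. C_k_on k F' W'" "\<forall>x\<in>W' \<inter> S. F' x = v x"
    unfolding smooth_fun_on_def by blast
  have "C_k_on k (\<lambda>x. F x + F' x) (W \<inter> W')" for k
    using W(1,3) W'(1,3) by (intro C_k_on_add open_Int) (auto intro: C_k_on_subset)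
  thus "\<exists>W F. open W \<and> p \<in> W \<and> (\<forall>k. C_k_on k F W) \<and> (\<forall>x\<in>W \<inter> S. F x = u x + v x)"
    using W W' by (intro exI[of _ "W \<inter> W'"] exI[of _ "\<lambda>x. F x + F' x"]) auto
qed

lemma smooth_fun_on_scaleR:
  assumes "smooth_fun_on S u"
  shows "smooth_fun_on S (\<lambda>x. c *\<^sub>R u x)"
  unfolding smooth_fun_on_def
proof
  fix p assume p: "p \<in> S"
  from assms p obtain W F where W: "open W" "p \<in> W" "\<forall>k. C_k_on k F W" "\<forall>x\<in>W \<inter> S. F x = u x"
    unfolding smooth_fun_on_def by blast
  have "C_k_on k (\<lambda>x. (c + 0) *\<^sub>R F x) W" for k
    using W by (intro C_k_on_linear_scaleR bounded_linear_zero) auto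
  thus "\<exists>W F. open W \<and> p \<in> W \<and> (\<forall>k. C_k_on k F W) \<and> (\<forall>x\<in>W \<inter> S. F x = c *\<^sub>R u x)"
    using W by (intro exI[of _ W] exI[of _ "\<lambda>x. (c + 0) *\<^sub>R F x"]) auto
qed

lemma smooth_fun_on_sum:
  "finite I \<Longrightarrow> I \<noteq> {} \<Longrightarrow> (\<And>i. i \<in> I \<Longrightarrow> smooth_fun_on S (u i)) \<Longrightarrow> smooth_fun_on S (\<lambda>x. \<Sum>i\<in>I. u i x)"
  by (induction rule: finite_ne_induct) (auto intro: smooth_fun_on_add)

text \<open>The counterpart of \<open>deriv_X0\<close> in the second variable, needed because
  membership in the Fourier algebra takes Casimir operators in both variables.\<close>

definition deriv_0X :: "mat2 \<Rightarrow> (mat2 \<times> mat2 \<Rightarrow> complex) \<Rightarrow> mat2 \<times> mat2 \<Rightarrow> complex" where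
  "deriv_0X X u = (\<lambda>(g, h). vector_derivative (\<lambda>t. u (g, h ** su2_exp X t)) (at 0))"

lemma bounded_linear_mat2_mult_right: "bounded_linear (\<lambda>A :: mat2. A ** X)" for X :: mat2
  by (rule linear_conv_bounded_linear[THEN iffD1], rule linearI) (auto simp: mat2_distribs)

lemma bounded_linear_mat2_mult_left: "bounded_linear (\<lambda>A :: mat2. X ** A)" for X :: mat2
  by (rule linear_conv_bounded_linear[THEN iffD1], rule linearI) (auto simp: mat2_distribs)

lemma has_vector_derivative_mult_su2_exp:
  fixes g :: mat2
  assumes "X \<in> su2"
  shows "((\<lambda>t. g ** su2_exp X t) has_vector_derivative g ** X) (at 0)"
  by (rule bounded_linear.has_vector_derivative[OF bounded_linear_mat2_mult_left has_vector_derivative_su2_exp[OF assms]])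

abbreviation SU2_sq :: "(mat2 \<times> mat2) set" where
  "SU2_sq \<equiv> carrier SU2 \<times> carrier SU2"

lemma
  assumes u: "smooth_fun_on SU2_sq u" and X: "X \<in> su2"
  shows smooth_deriv_X0: "smooth_fun_on SU2_sq (deriv_X0 X u)"
    and group_derivative_X0: "h \<in> carrier SU2 \<Longrightarrow> group_derivative X (\<lambda>g. u (g, h)) (\<lambda>g. deriv_X0 X u (g, h))"
proof -
  have L: "bounded_linear (\<lambda>p :: mat2 \<times> mat2. (fst p ** X, 0 :: mat2))"
    by (intro bounded_linear_Pair bounded_linear_zero bounded_linear_compose[OF bounded_linear_mat2_mult_right bounded_linear_fst])
  note flow = smooth_fun_on_flow_derivative[OF u L, where \<gamma> = "\<lambda>p t. (fst p ** su2_exp X t, snd p)" and Du = "deriv_X0 X u"]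
  have D: "((\<lambda>t. (fst p ** su2_exp X t, snd p)) has_vector_derivative (fst p ** X, 0)) (at 0)" for p :: "mat2 \<times> mat2"
    by (intro has_vector_derivative_Pair has_vector_derivative_mult_su2_exp X has_vector_derivative_const)
  show sm: "smooth_fun_on SU2_sq (deriv_X0 X u)"
    by (rule flow(1)) (auto simp: SU2_mult_closed su2_exp_SU2 X deriv_X0_def mat_exp_su2 intro: D)
  show "group_derivative X (\<lambda>g. u (g, h)) (\<lambda>g. deriv_X0 X u (g, h))" if h: "h \<in> carrier SU2"
    unfolding group_derivative_def
  proof (intro conjI ballI)
    show "continuous_on (carrier SU2) (\<lambda>g. u (g, h))" "continuous_on (carrier SU2) (\<lambda>g. deriv_X0 X u (g, h))"
      using h by (auto intro!: continuous_on_compose2[OF smooth_fun_on_continuous[OF u]] 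
          continuous_on_compose2[OF smooth_fun_on_continuous[OF sm]] continuous_intros)
    fix g assume g: "g \<in> carrier SU2"
    have "((\<lambda>t. u (fst (g, h) ** su2_exp X t, snd (g, h))) has_vector_derivative deriv_X0 X u (g, h)) (at 0)"
      by (rule flow(2)) (use g h in \<open>auto simp: SU2_mult_closed su2_exp_SU2 X deriv_X0_def mat_exp_su2 intro: D\<close>)
    thus "((\<lambda>t. u (g ** su2_exp X t, h)) has_vector_derivative deriv_X0 X u (g, h)) (at 0)" by simp
  qed
qed

lemma
  assumes u: "smooth_fun_on SU2_sq u" and X: "X \<in> su2"
  shows smooth_deriv_0X: "smooth_fun_on SU2_sq (deriv_0X X u)"
    and group_derivative_0X: "g \<in> carrier SU2 \<Longrightarrow> group_derivative X (\<lambda>h. u (g, h)) (\<lambda>h. deriv_0X X u (g, h))"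
proof -
  have L: "bounded_linear (\<lambda>p :: mat2 \<times> mat2. (0 :: mat2, snd p ** X))"
    by (intro bounded_linear_Pair bounded_linear_zero bounded_linear_compose[OF bounded_linear_mat2_mult_right bounded_linear_snd])
  note flow = smooth_fun_on_flow_derivative[OF u L, where \<gamma> = "\<lambda>p t. (fst p, snd p ** su2_exp X t)" and Du = "deriv_0X X u"]
  have D: "((\<lambda>t. (fst p, snd p ** su2_exp X t)) has_vector_derivative (0, snd p ** X)) (at 0)" for p :: "mat2 \<times> mat2"
    by (intro has_vector_derivative_Pair has_vector_derivative_mult_su2_exp X has_vector_derivative_const)
  show sm: "smooth_fun_on SU2_sq (deriv_0X X u)"
    by (rule flow(1)) (auto simp: SU2_mult_closed su2_exp_SU2 X deriv_0X_def intro: D)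
  show "group_derivative X (\<lambda>h. u (g, h)) (\<lambda>h. deriv_0X X u (g, h))" if g: "g \<in> carrier SU2"
    unfolding group_derivative_def
  proof (intro conjI ballI)
    show "continuous_on (carrier SU2) (\<lambda>h. u (g, h))" "continuous_on (carrier SU2) (\<lambda>h. deriv_0X X u (g, h))"
      using g by (auto intro!: continuous_on_compose2[OF smooth_fun_on_continuous[OF u]] 
          continuous_on_compose2[OF smooth_fun_on_continuous[OF sm]] continuous_intros)
    fix h assume h: "h \<in> carrier SU2"
    have "((\<lambda>t. u (fst (g, h), snd (g, h) ** su2_exp X t)) has_vector_derivative deriv_0X X u (g, h)) (at 0)"
      by (rule flow(2)) (use g h in \<open>auto simp: SU2_mult_closed su2_exp_SU2 X deriv_0X_def intro: D\<close>)
    thus "((\<lambda>t. u (g, h ** su2_exp X t)) has_vector_derivative deriv_0X X u (g, h)) (at 0)" by simp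
  qed
qed

text \<open>1 + Casimir in the first variable, the Casimir being minus the sum of the squared basis
  derivatives; against the n-th character it acts as n^2.\<close>

definition casimir_X0 :: "(mat2 \<times> mat2 \<Rightarrow> complex) \<Rightarrow> mat2 \<times> mat2 \<Rightarrow> complex" where
  "casimir_X0 u = (\<lambda>p. u p + (-1) *\<^sub>R (\<Sum>k<3. deriv_X0 (su2_basis k) (deriv_X0 (su2_basis k) u) p))"

definition casimir_0X :: "(mat2 \<times> mat2 \<Rightarrow> complex) \<Rightarrow> mat2 \<times> mat2 \<Rightarrow> complex" where
  "casimir_0X u = (\<lambda>p. u p + (-1) *\<^sub>R (\<Sum>k<3. deriv_0X (su2_basis k) (deriv_0X (su2_basis k) u) p))"

lemma smooth_casimir:
  assumes "smooth_fun_on SU2_sq u"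
  shows "smooth_fun_on SU2_sq (casimir_X0 u)" "smooth_fun_on SU2_sq (casimir_0X u)"
  unfolding casimir_X0_def casimir_0X_def
  by (intro smooth_fun_on_add smooth_fun_on_scaleR smooth_fun_on_sum smooth_deriv_X0 smooth_deriv_0X su2_basis_su2 assms; simp add: lessThan_empty_iff)+

lemma continuous_on_section:
  assumes "smooth_fun_on SU2_sq u"
  shows "h \<in> carrier SU2 \<Longrightarrow> continuous_on (carrier SU2) (\<lambda>g. u (g, h))"
    "g \<in> carrier SU2 \<Longrightarrow> continuous_on (carrier SU2) (\<lambda>h. u (g, h))"
  by (auto intro!: continuous_on_compose2[OF smooth_fun_on_continuous[OF assms]] continuous_intros)

section \<open>Smooth functions belong to the Fourier algebra\<close>

context su2_haar
begin

lemma integral_casimir_section: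
  fixes f :: "mat2 \<Rightarrow> complex" and f1 f2 :: "nat \<Rightarrow> mat2 \<Rightarrow> complex"
  assumes f1: "\<And>k. group_derivative (su2_basis k) f (f1 k)" 
    and f2: "\<And>k. group_derivative (su2_basis k) (f1 k) (f2 k)" and A: "A \<in> carrier SU2"
  shows "(LINT c|M. su2_char d (A ** c) * (f c + (-1) *\<^sub>R (\<Sum>k<3. f2 k c))) = of_nat d ^ 2 * (LINT c|M. su2_char d (A ** c) * f c)"
proof -
  have c: "continuous_on (carrier SU2) f" "\<And>k. continuous_on (carrier SU2) (f2 k)"
    using f1 f2 by (auto simp: group_derivative_def)
  have "(LINT c|M. su2_char d (A ** c) * (f c + (-1) *\<^sub>R (\<Sum>k<3. f2 k c)))
    = (LINT c|M. su2_char d (A ** c) * f c - su2_char d (A ** c) * (\<Sum>k<3. f2 k c))"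
    by (simp add: right_diff_distrib)
  also have "\<dots> = (LINT c|M. su2_char d (A ** c) * f c) - (LINT c|M. su2_char d (A ** c) * (\<Sum>k<3. f2 k c))"
    by (intro Bochner_Integration.integral_diff integrable_continuous continuous_intros c)
  also have "\<dots> = of_nat d ^ 2 * (LINT c|M. su2_char d (A ** c) * f c)"
    unfolding integral_casimir[OF f1 f2 A] by (simp add: algebra_simps)
  finally show ?thesis .
qed

lemma integral_casimir_X0:
  fixes u :: "mat2 \<times> mat2 \<Rightarrow> complex"
  assumes u: "smooth_fun_on SU2_sq u" and A: "A \<in> carrier SU2" and h: "h \<in> carrier SU2"
  shows "(LINT x|M. su2_char n (A ** x) * casimir_X0 (casimir_X0 u) (x, h)) = of_nat n ^ 4 * (LINT x|M. su2_char n (A ** x) * u (x, h))"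
proof -
  have "(LINT x|M. su2_char n (A ** x) * casimir_X0 u (x, h)) = of_nat n ^ 2 * (LINT x|M. su2_char n (A ** x) * u (x, h))"
    if u: "smooth_fun_on SU2_sq u" for u :: "mat2 \<times> mat2 \<Rightarrow> complex"
    unfolding casimir_X0_def
    by (rule integral_casimir_section[OF group_derivative_X0[OF u su2_basis_su2 h] 
          group_derivative_X0[OF smooth_deriv_X0[OF u su2_basis_su2] su2_basis_su2 h] A])
  from this[OF smooth_casimir(1)[OF u]] this[OF u] show ?thesis by (simp add: power2_eq_square power4_eq_xxxx)
qed

lemma integral_casimir_0X:
  fixes u :: "mat2 \<times> mat2 \<Rightarrow> complex"
  assumes u: "smooth_fun_on SU2_sq u" and A: "A \<in> carrier SU2" and g: "g \<in> carrier SU2"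
  shows "(LINT x|M. su2_char n (A ** x) * casimir_0X (casimir_0X u) (g, x)) = of_nat n ^ 4 * (LINT x|M. su2_char n (A ** x) * u (g, x))"
proof -
  have "(LINT x|M. su2_char n (A ** x) * casimir_0X u (g, x)) = of_nat n ^ 2 * (LINT x|M. su2_char n (A ** x) * u (g, x))"
    if u: "smooth_fun_on SU2_sq u" for u :: "mat2 \<times> mat2 \<Rightarrow> complex"
    unfolding casimir_0X_def
    by (rule integral_casimir_section[OF group_derivative_0X[OF u su2_basis_su2 g] 
          group_derivative_0X[OF smooth_deriv_0X[OF u su2_basis_su2] su2_basis_su2 g] A])
  from this[OF smooth_casimir(2)[OF u]] this[OF u] show ?thesis by (simp add: power2_eq_square power4_eq_xxxx)
qed

sublocale sq: prob_haar "SU2 \<times>\<times> SU2" "M \<Otimes>\<^sub>M M"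
  by (rule prob_haar_prod) unfold_locales

lemma carrier_SU2_sq: "carrier (SU2 \<times>\<times> SU2) = SU2_sq"
  by (simp add: DirProd_def)

lemma sets_SU2_sq: "sets (M \<Otimes>\<^sub>M M) = sets (restrict_space borel SU2_sq)"
  using sets_restrict_borel_prod[of "carrier SU2" "carrier SU2"] sets_pair_measure_cong[OF sets_borel sets_borel] by simp

lemma sq_measurable:
  fixes f :: "mat2 \<times> mat2 \<Rightarrow> 'b::topological_space"
  assumes "continuous_on SU2_sq f"
  shows "f \<in> borel_measurable (M \<Otimes>\<^sub>M M)"
  using borel_measurable_continuous_on_restrict[OF assms] sets_SU2_sq by (simp cong: measurable_cong_sets)

lemma sq_integrable:
  fixes f :: "mat2 \<times> mat2 \<Rightarrow> 'b::{banach, second_countable_topology}"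
  assumes "continuous_on SU2_sq f"
  shows "integrable (M \<Otimes>\<^sub>M M) f"
proof -
  have "bounded (f ` SU2_sq)"
    by (intro compact_imp_bounded compact_continuous_image assms compact_Times SU2_compact)
  then obtain B where B: "\<And>p. p \<in> SU2_sq \<Longrightarrow> norm (f p) \<le> B" by (auto simp: bounded_iff)
  show ?thesis using sq_measurable[OF assms] B
    by (intro sq.integrable_const_bound[where B = B]) (auto simp: sq.space_eq carrier_SU2_sq)
qed

lemma
  fixes f :: "mat2 \<times> mat2 \<Rightarrow> complex"
  assumes "continuous_on SU2_sq f"
  shows sq_kernel: "sq.kernel f" and sq_L2: "f \<in> L2 (M \<Otimes>\<^sub>M M)"
proof -
  note m = sq_measurable[OF assms]
  have "bounded (f ` SU2_sq)"
    by (intro compact_imp_bounded compact_continuous_image assms compact_Times SU2_compact)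
  then obtain B where B: "\<And>p. p \<in> SU2_sq \<Longrightarrow> norm (f p) \<le> B" by (auto simp: bounded_iff)
  show "sq.kernel f" unfolding sq.kernel_def carrier_SU2_sq using m B by blast
  show "f \<in> L2 (M \<Otimes>\<^sub>M M)" using m B by (intro sq.L2_bounded) (auto simp: sq.space_eq carrier_SU2_sq)
qed

lemma sq_integral:
  fixes f :: "mat2 \<times> mat2 \<Rightarrow> 'b::{banach, second_countable_topology}"
  assumes "continuous_on SU2_sq f"
  shows "(LINT p|(M \<Otimes>\<^sub>M M). f p) = (LINT h|M. LINT g|M. f (g, h))" "(LINT p|(M \<Otimes>\<^sub>M M). f p) = (LINT g|M. LINT h|M. f (g, h))"
proof -
  interpret P: pair_prob_space M M ..
  have i: "integrable (M \<Otimes>\<^sub>M M) (\<lambda>(g, h). f (g, h))" using sq_integrable[OF assms] by simp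
  show "(LINT p|(M \<Otimes>\<^sub>M M). f p) = (LINT h|M. LINT g|M. f (g, h))" using P.integral_snd[OF i] by simp
  show "(LINT p|(M \<Otimes>\<^sub>M M). f p) = (LINT g|M. LINT h|M. f (g, h))" using P.integral_fst'[OF sq_integrable[OF assms]] by simp
qed

text \<open>Applying the resolvent representation in each variable writes \<open>u (g, h)\<close> as
  an integral of a translate of one fixed continuous function against a continuous function, and
  that is a coefficient of the left regular representation.\<close>

theorem smooth_coefficient:
  assumes u: "smooth_fun_on SU2_sq u"
  obtains \<xi> \<eta> where "\<xi> \<in> L2 (M \<Otimes>\<^sub>M M)" "\<eta> \<in> L2 (M \<Otimes>\<^sub>M M)"
    "\<And>p. p \<in> SU2_sq \<Longrightarrow> u p = L2_inner (M \<Otimes>\<^sub>M M) (left_regular (SU2 \<times>\<times> SU2) p \<xi>) \<eta>"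
proof -
  define u1 where "u1 = casimir_X0 (casimir_X0 u)"
  define u2 where "u2 = casimir_0X (casimir_0X u1)"
  have sm: "smooth_fun_on SU2_sq u1" "smooth_fun_on SU2_sq u2"
    unfolding u2_def u1_def by (intro smooth_casimir u)+
  \<comment> \<open>The tensor square of the resolvent kernel is the vector that is translated; the
    other vector is the conjugate of \<open>u\<close> after two operators 1 + Casimir in each
    variable.\<close>
  define \<xi> where "\<xi> = (\<lambda>p. resolvent_kernel (fst p) * resolvent_kernel (snd p))"
  define \<eta> where "\<eta> = (\<lambda>p. cnj (u2 p))"
  have \<xi>: "continuous_on SU2_sq \<xi>" unfolding \<xi>_def by (intro continuous_intros continuous_on_resolvent_kernel)
  have \<eta>: "continuous_on SU2_sq \<eta>" unfolding \<eta>_def by (intro continuous_intros smooth_fun_on_continuous sm)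
  have "u (g, h) = L2_inner (M \<Otimes>\<^sub>M M) (left_regular (SU2 \<times>\<times> SU2) (g, h) \<xi>) \<eta>" if g: "g \<in> carrier SU2" and h: "h \<in> carrier SU2" for g h
  proof -
    let ?g = "conj_transpose g" and ?h = "conj_transpose h"
    have gh: "?g \<in> carrier SU2" "?h \<in> carrier SU2" using g h by (auto intro: SU2_conj_transpose)
    have "u (g, h) = (LINT x|M. resolvent_kernel (?g ** x) * u1 (x, h))"
      unfolding u1_def
      by (rule resolvent_representation[OF continuous_on_section(1)[OF u h] 
            continuous_on_section(1)[OF smooth_casimir(1)[OF smooth_casimir(1)[OF u]] h] _ g])
        (rule integral_casimir_X0[OF u _ h])
    also have "\<dots> = (LINT x|M. resolvent_kernel (?g ** x) * (LINT y|M. resolvent_kernel (?h ** y) * u2 (x, y)))"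
    proof (intro Bochner_Integration.integral_cong refl)
      fix x assume "x \<in> space M"
      hence x: "x \<in> carrier SU2" by (simp add: space_SU2)
      have "u1 (x, h) = (LINT y|M. resolvent_kernel (?h ** y) * u2 (x, y))"
        unfolding u2_def
        by (rule resolvent_representation[OF continuous_on_section(2)[OF sm(1) x] 
              continuous_on_section(2)[OF smooth_casimir(2)[OF smooth_casimir(2)[OF sm(1)]] x] _ h])
          (rule integral_casimir_0X[OF sm(1) _ x])
      thus "resolvent_kernel (?g ** x) * u1 (x, h) = resolvent_kernel (?g ** x) * (LINT y|M. resolvent_kernel (?h ** y) * u2 (x, y))" by simp
    qed
    also have "\<dots> = (LINT x|M. LINT y|M. \<xi> (?g ** x, ?h ** y) * u2 (x, y))"
      by (simp add: \<xi>_def mult.assoc)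
    also have "\<dots> = (LINT p|(M \<Otimes>\<^sub>M M). \<xi> (?g ** fst p, ?h ** snd p) * u2 p)"
    proof -
      have "continuous_on SU2_sq (\<lambda>p. \<xi> (?g ** fst p, ?h ** snd p) * u2 p)"
        by (intro continuous_intros smooth_fun_on_continuous sm continuous_on_compose2[OF \<xi>]) (auto intro!: SU2_mult_closed gh)
      from sq_integral(2)[OF this] show ?thesis by simp
    qed
    also have "\<dots> = L2_inner (M \<Otimes>\<^sub>M M) (left_regular (SU2 \<times>\<times> SU2) (g, h) \<xi>) \<eta>"
      unfolding L2_inner_def left_regular_def \<eta>_def
      using inv_DirProd[OF SU2_group SU2_group g h] by (simp add: SU2_conj_transpose g h DirProd_def case_prod_unfold)
    finally show ?thesis .
  qed
  thus ?thesis using that[OF sq_L2[OF \<xi>] sq_L2[OF \<eta>]] by auto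
qed

end

section \<open>The operator\<close>

lemma (in prob_haar) conv_cong:
  assumes "\<And>p. p \<in> carrier G \<Longrightarrow> \<kappa> p = \<kappa>' p" "x \<in> carrier G"
  shows "conv \<kappa> \<xi> x = conv \<kappa>' \<xi> x"
  unfolding conv_def using assms by (intro Bochner_Integration.integral_cong) (auto simp: space_eq)

lemma (in prob_haar) L2_inner_conv_cong:
  assumes "\<And>p. p \<in> carrier G \<Longrightarrow> \<kappa> p = \<kappa>' p"
  shows "L2_inner M (conv \<kappa> \<xi>) \<eta> = L2_inner M (conv \<kappa>' \<xi>) \<eta>"
  unfolding L2_inner_def using conv_cong[of \<kappa> \<kappa>' _ \<xi>] assms
  by (intro Bochner_Integration.integral_cong) (auto simp: space_eq)

lemma (in prob_haar) conv_kernel_sum: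
  assumes "\<And>i. i \<in> I \<Longrightarrow> kernel (\<kappa> i)" "\<xi> \<in> L2 M" "x \<in> carrier G"
  shows "conv (\<lambda>p. \<Sum>i\<in>I. c i * \<kappa> i p) \<xi> x = (\<Sum>i\<in>I. c i * conv (\<kappa> i) \<xi> x)"
proof -
  have "conv (\<lambda>p. \<Sum>i\<in>I. c i * \<kappa> i p) \<xi> x = (LINT z|M. (\<Sum>i\<in>I. c i * (\<kappa> i (x \<otimes> inv z) * \<xi> z)))"
    unfolding conv_def by (simp add: sum_distrib_right mult.assoc)
  also have "\<dots> = (\<Sum>i\<in>I. LINT z|M. c i * (\<kappa> i (x \<otimes> inv z) * \<xi> z))"
    by (intro Bochner_Integration.integral_sum integrable_mult_right conv_integrable assms) auto
  finally show ?thesis by (simp add: conv_def)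
qed

lemma L2_norm_sum_le:
  "(\<And>i. i \<in> I \<Longrightarrow> f i \<in> L2 M) \<Longrightarrow> L2_norm M (\<lambda>x. \<Sum>i\<in>I. f i x) \<le> (\<Sum>i\<in>I. L2_norm M (f i))"
proof (induction I rule: infinite_finite_induct)
  case (insert i I)
  have "L2_norm M (\<lambda>x. f i x + (\<Sum>j\<in>I. f j x)) \<le> L2_norm M (f i) + L2_norm M (\<lambda>x. \<Sum>j\<in>I. f j x)"
    using insert.prems by (intro L2_norm_triangle L2_sum) auto
  thus ?case using insert by fastforce
qed (auto simp: L2_norm_def)

lemma (in su2_haar) continuous_on_parametric_integral:
  fixes H :: "mat2 \<Rightarrow> mat2 \<Rightarrow> complex"
  assumes H: "continuous_on SU2_sq (\<lambda>p. H (fst p) (snd p))"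
  shows "continuous_on (carrier SU2) (\<lambda>k. LINT g|M. H g k)"
proof (rule continuous_on_sequentiallyI)
  fix x a assume x: "\<forall>n. x n \<in> carrier SU2" "a \<in> carrier SU2" "x \<longlonglongrightarrow> a"
  have "bounded ((\<lambda>p. H (fst p) (snd p)) ` SU2_sq)"
    by (intro compact_imp_bounded compact_continuous_image H compact_Times SU2_compact)
  then obtain B where B: "\<And>g k. g \<in> carrier SU2 \<Longrightarrow> k \<in> carrier SU2 \<Longrightarrow> norm (H g k) \<le> B" by (auto simp: bounded_iff)
  have sec: "continuous_on (carrier SU2) (\<lambda>g. H g k)" if "k \<in> carrier SU2" for k
  proof -
    have "continuous_on (carrier SU2) (\<lambda>g. (g, k))" by (intro continuous_intros)
    from continuous_on_compose2[OF H this] show ?thesis using that by auto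
  qed
  show "(\<lambda>n. LINT g|M. H g (x n)) \<longlonglongrightarrow> (LINT g|M. H g a)"
  proof (rule integral_dominated_convergence[where w = "\<lambda>_. B"])
    show "(\<lambda>g. H g a) \<in> borel_measurable M" "\<And>n. (\<lambda>g. H g (x n)) \<in> borel_measurable M"
      using x by (auto intro!: borel_measurable_continuous sec)
    show "AE g in M. norm (H g (x n)) \<le> B" for n using B x by (intro AE_I2) (auto simp: space_SU2)
    show "AE g in M. (\<lambda>n. H g (x n)) \<longlonglongrightarrow> H g a"
    proof (intro AE_I2)
      fix g assume "g \<in> space M"
      hence g: "g \<in> carrier SU2" by (simp add: space_SU2)
      have "continuous_on (carrier SU2) (\<lambda>k. H g k)"
      proof -
        have "continuous_on (carrier SU2) (\<lambda>k. (g, k))" by (intro continuous_intros)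
        from continuous_on_compose2[OF H this] show ?thesis using g by auto
      qed
      thus "(\<lambda>n. H g (x n)) \<longlonglongrightarrow> H g a" using x unfolding continuous_on_sequentially by (auto simp: o_def)
    qed
  qed simp
qed

text \<open>The part of the distribution \<open>u \<mapsto> \<integral> \<partial>\<^bsub>(X,0)\<^esub> u(g, g\<^sup>-\<^sup>1) dg\<close> in the \<open>n\<close>-th isotypic component:
  without the derivative the density is \<open>n \<chi>\<^sub>n(h g)\<close>, and integration by parts moves the derivative there.\<close>

definition derivation_kernel :: "mat2 \<Rightarrow> nat \<Rightarrow> mat2 \<times> mat2 \<Rightarrow> complex" where
  "derivation_kernel X n p = of_real (- (real n * su2_char_deriv X n (snd p ** fst p)))"

text \<open>The character of the n-th irreducible representation tensored with itself, times its
  dimension n^2: convolution with it is the orthogonal projection onto that isotypic component. The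
  characters are real, so no conjugate appears.\<close>

definition isotypic_kernel :: "nat \<Rightarrow> mat2 \<times> mat2 \<Rightarrow> complex" where
  "isotypic_kernel n p = of_real ((real n)\<^sup>2 * (su2_char n (fst p) * su2_char n (snd p)))"

lemma continuous_on_kernels:
  "continuous_on S (derivation_kernel X n)" "continuous_on S (isotypic_kernel n)"
  unfolding derivation_kernel_def isotypic_kernel_def by (intro continuous_intros)+

lemma su2_char_deriv_sum:
  fixes g :: mat2
  shows "su2_char_deriv (\<Sum>k\<in>I. x k *\<^sub>R Y k) n g = (\<Sum>k\<in>I. x k * su2_char_deriv (Y k) n g)"
proof -
  have "half_trace (g ** (\<Sum>k\<in>I. x k *\<^sub>R Y k)) = (\<Sum>k\<in>I. x k * half_trace (g ** Y k))"
  proof -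
    have lin: "linear (\<lambda>A :: mat2. half_trace (g ** A))" by (rule linearI) (auto simp: mat2_distribs)
    show ?thesis unfolding linear_sum[OF lin] linear_scale[OF lin] by simp
  qed
  thus ?thesis by (simp add: su2_char_deriv_def sum_distrib_left mult_ac)
qed

section \<open>Orthogonality and bounds of the blocks\<close>

context su2_haar
begin

abbreviation MM :: "(mat2 \<times> mat2) measure" where
  "MM \<equiv> M \<Otimes>\<^sub>M M"

text \<open>Integrating out the second coordinate by the differentiated functional equation splits
  off the character at \<open>h\<close>, and the remaining integral is the orthogonality relation
  for derivatives. For \<open>n \<noteq> m\<close> the blocks are orthogonal.\<close>

lemma derivation_kernel_correlation:
  assumes X: "X \<in> su2" and p: "p \<in> SU2_sq"
  shows "(LINT q|MM. derivation_kernel X n (q \<otimes>\<^bsub>SU2 \<times>\<times> SU2\<^esub> p) * cnj (derivation_kernel X m q))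
    = (if n = m then of_real (- (su2_char n (snd p) * su2_char_deriv2 X n (fst p))) else 0)"
proof -
  obtain g h where p': "p = (g, h)" and g: "g \<in> carrier SU2" and h: "h \<in> carrier SU2" using p by auto
  let ?c = "su2_char_deriv X"
  define R where "R = (\<lambda>q. (real n * ?c n (snd q ** h ** fst q ** g)) * (real m * ?c m (snd q ** fst q)))"
  have "(LINT q|MM. derivation_kernel X n (q \<otimes>\<^bsub>SU2 \<times>\<times> SU2\<^esub> p) * cnj (derivation_kernel X m q)) = (LINT q|MM. complex_of_real (R q))"
    by (simp add: derivation_kernel_def R_def p' DirProd_def case_prod_unfold matrix_mul_assoc)
  also have "\<dots> = of_real (LINT q|MM. R q)" by (rule integral_complex_of_real)
  also have "(LINT q|MM. R q) = (LINT b|M. LINT a|M. R (a, b))"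
    by (rule sq_integral) (unfold R_def, intro continuous_intros)
  \<comment> \<open>The substitution of \<open>conj_transpose b ** c\<close> for the first
    coordinate makes the argument of the second factor \<open>c\<close> and exhibits
    \<open>h\<close> conjugated by \<open>b\<close> in the first.\<close>
  also have "\<dots> = (LINT b|M. LINT c|M. (real n * ?c n (b ** h ** conj_transpose b ** (c ** g))) * (real m * ?c m c))"
  proof (rule Bochner_Integration.integral_cong[OF refl])
    fix b assume "b \<in> space M"
    hence b: "b \<in> carrier SU2" by (simp add: space_SU2)
    have "(\<lambda>a. R (a, b)) \<in> borel_measurable M"
      unfolding R_def by (intro borel_measurable_continuous continuous_intros)
    from integral_left_mult[OF this SU2_conj_transpose(1)[OF b]]
    have "(LINT a|M. R (a, b)) = (LINT c|M. R (conj_transpose b ** c, b))" by simp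
    also have "\<dots> = (LINT c|M. (real n * ?c n (b ** h ** conj_transpose b ** (c ** g))) * (real m * ?c m c))"
      by (simp add: R_def matrix_mul_assoc SU2_conj_transpose[OF b])
    finally show "(LINT a|M. R (a, b)) = (LINT c|M. (real n * ?c n (b ** h ** conj_transpose b ** (c ** g))) * (real m * ?c m c))" .
  qed
  also have "\<dots> = (LINT c|M. LINT b|M. (real n * ?c n (b ** h ** conj_transpose b ** (c ** g))) * (real m * ?c m c))"
    by (rule Fubini_continuous) (intro continuous_intros)
  also have "\<dots> = (LINT c|M. (su2_char n h * real m) * (?c n (c ** g) * ?c m c))"
  proof (rule Bochner_Integration.integral_cong[OF refl])
    fix c assume "c \<in> space M"
    hence cg: "c ** g \<in> carrier SU2" using g by (simp add: space_SU2 SU2_mult_closed)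
    have "(LINT b|M. (real n * ?c n (b ** h ** conj_transpose b ** (c ** g))) * (real m * ?c m c))
      = (real n * (LINT b|M. ?c n (b ** h ** conj_transpose b ** (c ** g)))) * (real m * ?c m c)" by simp
    also have "\<dots> = (su2_char n h * real m) * (?c n (c ** g) * ?c m c)"
      unfolding integral_char_deriv_conjugate[OF X h cg] by simp
    finally show "(LINT b|M. (real n * ?c n (b ** h ** conj_transpose b ** (c ** g))) * (real m * ?c m c)) = (su2_char n h * real m) * (?c n (c ** g) * ?c m c)" .
  qed
  also have "\<dots> = (if n = m then - (su2_char n h * su2_char_deriv2 X n g) else 0)"
    using integral_char_deriv_deriv[OF X g, of n m] by (auto simp: su2_char_def)
  finally show ?thesis by (simp add: p')
qed

lemma isotypic_kernel_correlation:
  assumes p: "p \<in> SU2_sq"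
  shows "(LINT q|MM. isotypic_kernel n (q \<otimes>\<^bsub>SU2 \<times>\<times> SU2\<^esub> p) * cnj (isotypic_kernel m q))
    = (if n = m then isotypic_kernel n p else 0)"
proof -
  obtain g h where p': "p = (g, h)" and g: "g \<in> carrier SU2" and h: "h \<in> carrier SU2" using p by auto
  define R where "R = (\<lambda>q. ((real n)\<^sup>2 * (real m)\<^sup>2) * ((su2_char n (g ** fst q) * su2_char m (fst q)) * (su2_char n (h ** snd q) * su2_char m (snd q))))"
  have "(LINT q|MM. isotypic_kernel n (q \<otimes>\<^bsub>SU2 \<times>\<times> SU2\<^esub> p) * cnj (isotypic_kernel m q)) = (LINT q|MM. complex_of_real (R q))"
    using su2_char_commute[of n _ g] su2_char_commute[of n _ h]
    by (simp add: isotypic_kernel_def R_def p' DirProd_def case_prod_unfold mult_ac)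
  also have "\<dots> = of_real (LINT q|MM. R q)" by (rule integral_complex_of_real)
  also have "(LINT q|MM. R q) = (LINT b|M. LINT a|M. R (a, b))"
    by (rule sq_integral) (unfold R_def, intro continuous_intros)
  also have "\<dots> = ((real n)\<^sup>2 * (real m)\<^sup>2) * ((LINT a|M. su2_char n (g ** a) * su2_char m a) * (LINT b|M. su2_char n (h ** b) * su2_char m b))"
    unfolding R_def by simp
  also have "complex_of_real \<dots> = (if n = m then isotypic_kernel n p else 0)"
    unfolding integral_char_char[OF g] integral_char_char[OF h]
    by (auto simp: isotypic_kernel_def p' power2_eq_square)
  finally show ?thesis .
qed

context
  fixes \<xi> assumes \<xi>: "\<xi> \<in> L2 MM"
begin

lemma conv_kernels_L2: "sq.conv (derivation_kernel X n) \<xi> \<in> L2 MM" "sq.conv (isotypic_kernel n) \<xi> \<in> L2 MM"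
  by (intro sq.conv_L2 sq_kernel continuous_on_kernels \<xi>)+

lemma conv_zero: "L2_inner MM (sq.conv (\<lambda>_. 0) \<xi>) \<eta> = 0"
  by (simp add: sq.conv_def L2_inner_def)

text \<open>The isotypic operators behave as mutually orthogonal self-adjoint idempotents.\<close>

lemma isotypic_inner:
  "L2_inner MM (sq.conv (isotypic_kernel n) \<xi>) (sq.conv (isotypic_kernel m) \<xi>) 
    = (if n = m then L2_inner MM (sq.conv (isotypic_kernel n) \<xi>) \<xi> else 0)"
proof -
  have "L2_inner MM (sq.conv (isotypic_kernel n) \<xi>) (sq.conv (isotypic_kernel m) \<xi>) = 
     L2_inner MM (sq.conv (\<lambda>p. if n = m then isotypic_kernel n p else 0) \<xi>) \<xi>"
    unfolding sq.conv_inner_conv[OF sq_kernel[OF continuous_on_kernels(2)] sq_kernel[OF continuous_on_kernels(2)] \<xi> \<xi>]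
    by (rule sq.L2_inner_conv_cong) (simp add: isotypic_kernel_correlation carrier_SU2_sq)
  thus ?thesis by (cases "n = m") (simp_all add: conv_zero)
qed

lemma derivation_kernel_inner:
  assumes X: "X \<in> su2"
  shows "L2_inner MM (sq.conv (derivation_kernel X n) \<xi>) (sq.conv (derivation_kernel X m) \<xi>) 
    = (if n = m then L2_inner MM (sq.conv (\<lambda>p. of_real (- (su2_char n (snd p) * su2_char_deriv2 X n (fst p)))) \<xi>) \<xi> else 0)"
proof -
  have "L2_inner MM (sq.conv (derivation_kernel X n) \<xi>) (sq.conv (derivation_kernel X m) \<xi>) = 
     L2_inner MM (sq.conv (\<lambda>p. if n = m then of_real (- (su2_char n (snd p) * su2_char_deriv2 X n (fst p))) else 0) \<xi>) \<xi>"
    unfolding sq.conv_inner_conv[OF sq_kernel[OF continuous_on_kernels(1)] sq_kernel[OF continuous_on_kernels(1)] \<xi> \<xi>]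
    by (rule sq.L2_inner_conv_cong) (simp add: derivation_kernel_correlation X carrier_SU2_sq)
  thus ?thesis by (cases "n = m") (simp_all add: conv_zero)
qed

text \<open>Bessel's inequality: subtracting the projections of \<xi> from \<xi> leaves a vector of
  nonnegative squared norm.\<close>

lemma isotypic_bessel: "(\<Sum>n<N. (L2_norm MM (sq.conv (isotypic_kernel n) \<xi>))\<^sup>2) \<le> (L2_norm MM \<xi>)\<^sup>2"
proof -
  define A where "A = (\<lambda>n. sq.conv (isotypic_kernel n) \<xi>)"
  have A: "A n \<in> L2 MM" for n unfolding A_def by (rule conv_kernels_L2)
  have norm: "L2_inner MM (A n) \<xi> = of_real ((L2_norm MM (A n))\<^sup>2)" for n
    using isotypic_inner[of n n] L2_inner_self[of MM "A n"] by (simp add: A_def)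
  have "L2_inner MM \<xi> (\<lambda>x. \<Sum>n<N. A n x) = cnj (\<Sum>n<N. L2_inner MM (A n) \<xi>)"
    by (subst L2_inner_cnj) (simp add: L2_inner_sum_left A \<xi>)
  also have "\<dots> = of_real (\<Sum>n<N. (L2_norm MM (A n))\<^sup>2)" by (simp add: norm)
  finally have "Re (L2_inner MM \<xi> (\<lambda>x. \<Sum>n<N. A n x)) = (\<Sum>n<N. (L2_norm MM (A n))\<^sup>2)" by simp
  moreover have "(L2_norm MM (\<lambda>x. \<Sum>n<N. A n x))\<^sup>2 = (\<Sum>n<N. (L2_norm MM (A n))\<^sup>2)"
    using isotypic_inner by (intro L2_norm_sum_orthogonal A) (auto simp: A_def)
  moreover have "0 \<le> (L2_norm MM (\<lambda>x. \<xi> x - (\<Sum>n<N. A n x)))\<^sup>2" by simp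
  ultimately have "(\<Sum>n<N. (L2_norm MM (A n))\<^sup>2) \<le> (L2_norm MM \<xi>)\<^sup>2"
    using L2_norm_diff_sq[OF \<xi> L2_sum[of "{..<N}" A MM, OF A]] by simp
  thus ?thesis by (simp add: A_def)
qed

text \<open>Summed over the basis of the Lie algebra, the correlations of the kernels give the Casimir
  eigenvalue \<open>n\<^sup>2 - 1\<close>, which the factor \<open>1 / n\<^sup>2\<close> from the functional equation compensates.\<close>

lemma derivation_kernel_bound:
  "(\<Sum>k<3. (L2_norm MM (sq.conv (derivation_kernel (su2_basis k) n) \<xi>))\<^sup>2) \<le> (L2_norm MM (sq.conv (isotypic_kernel n) \<xi>))\<^sup>2"
proof -
  define T where "T = (\<lambda>k p. complex_of_real (- (su2_char n (snd p) * su2_char_deriv2 (su2_basis k) n (fst p))))"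
  define N where "N = (L2_norm MM (sq.conv (isotypic_kernel n) \<xi>))\<^sup>2"
  have T: "sq.kernel (T k)" for k unfolding T_def by (intro sq_kernel continuous_intros)
  have "complex_of_real (\<Sum>k<3. (L2_norm MM (sq.conv (derivation_kernel (su2_basis k) n) \<xi>))\<^sup>2) 
      = (\<Sum>k<3. L2_inner MM (sq.conv (T k) \<xi>) \<xi>)"
    unfolding of_real_sum L2_inner_self[symmetric] derivation_kernel_inner[OF su2_basis_su2] T_def by simp
  also have "\<dots> = L2_inner MM (\<lambda>x. \<Sum>k<3. 1 * sq.conv (T k) \<xi> x) \<xi>"
    by (simp add: L2_inner_sum_left sq.conv_L2 T \<xi>)
  also have "\<dots> = L2_inner MM (sq.conv (\<lambda>p. \<Sum>k<3. 1 * T k p) \<xi>) \<xi>"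
    unfolding L2_inner_def 
    by (rule Bochner_Integration.integral_cong[OF refl], subst sq.conv_kernel_sum[OF T \<xi>]) (simp_all add: sq.space_eq)
  \<comment> \<open>The sum of the correlations is n^2 - 1 times the product of the characters,
    while the isotypic kernel carries the factor n^2; for \<open>n = 0\<close> both sides
    vanish.\<close>
  also have "\<dots> = L2_inner MM (sq.conv (\<lambda>p. of_real (1 - 1 / (real n)\<^sup>2) * isotypic_kernel n p) \<xi>) \<xi>"
  proof (rule sq.L2_inner_conv_cong)
    fix p assume "p \<in> carrier (SU2 \<times>\<times> SU2)"
    hence p: "fst p \<in> carrier SU2" by (auto simp: carrier_SU2_sq)
    have "(\<Sum>k<3. 1 * T k p) = of_real (- su2_char n (snd p) * (\<Sum>k<3. su2_char_deriv2 (su2_basis k) n (fst p)))"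
      by (simp add: T_def sum_distrib_left sum_negf)
    also have "\<dots> = of_real (1 - 1 / (real n)\<^sup>2) * isotypic_kernel n p"
      unfolding su2_char_casimir[OF p] isotypic_kernel_def of_real_mult[symmetric]
      by (cases "n = 0") (simp_all add: su2_char_def field_simps)
    finally show "(\<Sum>k<3. 1 * T k p) = of_real (1 - 1 / (real n)\<^sup>2) * isotypic_kernel n p" .
  qed
  also have "\<dots> = of_real (1 - 1 / (real n)\<^sup>2) * L2_inner MM (sq.conv (isotypic_kernel n) \<xi>) \<xi>"
    unfolding sq.conv_def by (simp add: mult.assoc L2_inner_scale_left del: of_real_diff)
  also have "L2_inner MM (sq.conv (isotypic_kernel n) \<xi>) \<xi> = of_real N"
    using isotypic_inner[of n n] L2_inner_self[of MM "sq.conv (isotypic_kernel n) \<xi>"] by (simp add: N_def)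
  finally have "(\<Sum>k<3. (L2_norm MM (sq.conv (derivation_kernel (su2_basis k) n) \<xi>))\<^sup>2) = (1 - 1 / (real n)\<^sup>2) * N"
    unfolding of_real_mult[symmetric] of_real_eq_iff .
  also have "\<dots> \<le> 1 * N" by (intro mult_right_mono) (auto simp: N_def)
  finally show ?thesis by (simp add: N_def)
qed

end

text \<open>Each block is dominated by the projection onto its isotypic component with a constant
  independent of n, so Bessel's inequality bounds the orthogonal sum. The scalar \<open>a\<close>
  leaves room for the normalization of the Haar measure in the final integral.\<close>

lemma derivation_operator_exists:
  assumes X: "X \<in> su2"
  shows "\<exists>S\<in>VN (SU2 \<times>\<times> SU2) MM. \<forall>\<xi>\<in>L2 MM. \<forall>\<eta>\<in>L2 MM.
    summable (\<lambda>n. cmod (L2_inner MM (sq.conv (\<lambda>p. of_real a * derivation_kernel X n p) \<xi>) \<eta>)) \<and>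
    L2_inner MM (S \<xi>) \<eta> = (\<Sum>n. L2_inner MM (sq.conv (\<lambda>p. of_real a * derivation_kernel X n p) \<xi>) \<eta>)"
proof -
  obtain x where x: "X = (\<Sum>k<3. x k *\<^sub>R su2_basis k)" using su2_expand[OF X] by blast
  \<comment> \<open>The bound is available for the basis elements only, so the coordinates of
    \<open>X\<close> enter as an l1 norm through the triangle inequality.\<close>
  define C where "C = (\<Sum>k<3. \<bar>a * x k\<bar>)"
  have C0: "C \<ge> 0" by (simp add: C_def sum_nonneg)
  have scale: "sq.conv (\<lambda>p. of_real a * derivation_kernel X n p) \<xi> = (\<lambda>z. of_real a * sq.conv (derivation_kernel X n) \<xi> z)" for n \<xi>
    unfolding sq.conv_def by (simp add: mult.assoc)
  have kernel_eq: "of_real a * derivation_kernel X n p = (\<Sum>k<3. of_real (a * x k) * derivation_kernel (su2_basis k) n p)" for n p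
    unfolding derivation_kernel_def x su2_char_deriv_sum of_real_mult[symmetric] of_real_sum[symmetric]
    by (simp add: sum_distrib_left sum_negf mult_ac)
  show ?thesis
  proof (rule sq.VN_orthogonal_series[OF _ C0])
    show "sq.kernel (\<lambda>p. of_real a * derivation_kernel X n p)" for n
      by (intro sq_kernel continuous_intros continuous_on_kernels)
    show "L2_inner MM (sq.conv (\<lambda>p. of_real a * derivation_kernel X m p) \<xi>) (sq.conv (\<lambda>p. of_real a * derivation_kernel X n p) \<xi>) = 0"
      if "\<xi> \<in> L2 MM" "m \<noteq> n" for m n \<xi>
      unfolding scale L2_inner_scale_left L2_inner_scale_right using derivation_kernel_inner[OF that(1) X] that(2) by simp
    fix N \<xi> assume \<xi>: "\<xi> \<in> L2 MM"
    have "(L2_norm MM (sq.conv (\<lambda>p. of_real a * derivation_kernel X n p) \<xi>))\<^sup>2 \<le> C\<^sup>2 * (L2_norm MM (sq.conv (isotypic_kernel n) \<xi>))\<^sup>2" for n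
    proof -
      let ?c = "\<lambda>k. sq.conv (derivation_kernel (su2_basis k) n) \<xi>"
      let ?e = "L2_norm MM (sq.conv (isotypic_kernel n) \<xi>)"
      have le: "L2_norm MM (?c k) \<le> ?e" if "k < 3" for k
      proof (rule power2_le_imp_le)
        have "(L2_norm MM (?c k))\<^sup>2 \<le> (\<Sum>k<3. (L2_norm MM (?c k))\<^sup>2)"
          using that by (intro member_le_sum) auto
        thus "(L2_norm MM (?c k))\<^sup>2 \<le> ?e\<^sup>2" using derivation_kernel_bound[OF \<xi>, of n] by linarith
      qed simp
      have L: "(\<lambda>z. complex_of_real (a * x k) * ?c k z) \<in> L2 MM" for k by (intro L2_scale conv_kernels_L2 \<xi>)
      have "L2_norm MM (sq.conv (\<lambda>p. of_real a * derivation_kernel X n p) \<xi>) = L2_norm MM (\<lambda>z. \<Sum>k<3. of_real (a * x k) * ?c k z)"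
        unfolding kernel_eq L2_norm_def
        by (intro arg_cong[where f = sqrt] Bochner_Integration.integral_cong refl)
          (simp add: sq.conv_kernel_sum[OF sq_kernel[OF continuous_on_kernels(1)] \<xi>] sq.space_eq del: of_real_mult)
      also have "\<dots> \<le> (\<Sum>k<3. L2_norm MM (\<lambda>z. of_real (a * x k) * ?c k z))" by (intro L2_norm_sum_le L)
      also have "\<dots> \<le> (\<Sum>k<3. \<bar>a * x k\<bar> * ?e)"
        unfolding L2_norm_scale norm_of_real by (intro sum_mono mult_left_mono le) auto
      also have "\<dots> = C * ?e" by (simp add: C_def sum_distrib_right)
      finally show ?thesis unfolding power_mult_distrib[symmetric] by (intro power_mono) auto
    qed
    hence "(\<Sum>n<N. (L2_norm MM (sq.conv (\<lambda>p. of_real a * derivation_kernel X n p) \<xi>))\<^sup>2) \<le> C\<^sup>2 * (\<Sum>n<N. (L2_norm MM (sq.conv (isotypic_kernel n) \<xi>))\<^sup>2)"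
      unfolding sum_distrib_left by (intro sum_mono)
    also have "\<dots> \<le> C\<^sup>2 * (L2_norm MM \<xi>)\<^sup>2" by (intro mult_left_mono isotypic_bessel \<xi>) auto
    finally show "(\<Sum>n<N. (L2_norm MM (sq.conv (\<lambda>p. of_real a * derivation_kernel X n p) \<xi>))\<^sup>2) \<le> (C * L2_norm MM \<xi>)\<^sup>2"
      by (simp add: power_mult_distrib)
  qed
qed

text \<open>After integration by parts in \<open>g\<close> and the substitution
  \<open>h = k ** conj_transpose g\<close>, the character depends on \<open>k\<close> alone. The
  block is thus a character coefficient of a single function of \<open>k\<close>, whose value at the
  identity is the desired functional.\<close>

lemma derivation_kernel_integral:
  assumes u: "smooth_fun_on SU2_sq u" and X: "X \<in> su2"
  shows "(LINT p|MM. derivation_kernel X n p * u p) = 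
    (LINT k|M. of_real (real n * su2_char n k) * (LINT g|M. deriv_X0 X u (g, k ** conj_transpose g)))"
proof -
  define w where "w = deriv_X0 X u"
  have w: "continuous_on SU2_sq w" unfolding w_def by (intro smooth_fun_on_continuous smooth_deriv_X0 u X)
  have cu: "continuous_on SU2_sq u" by (intro smooth_fun_on_continuous u)
  have "(LINT p|MM. derivation_kernel X n p * u p) = (LINT h|M. LINT g|M. derivation_kernel X n (g, h) * u (g, h))"
    by (rule sq_integral) (intro continuous_intros continuous_on_kernels cu)
  also have "\<dots> = (LINT h|M. LINT g|M. of_real (real n * su2_char n (h ** g)) * w (g, h))"
  proof (rule Bochner_Integration.integral_cong[OF refl])
    fix h assume "h \<in> space M"
    hence h: "h \<in> carrier SU2" by (simp add: space_SU2)
    from integral_by_parts[OF X group_derivative_of_real[OF group_derivative_scaleR[OF group_derivative_char(1)[OF X, where A = h and d = n], of "real n"]] group_derivative_X0[OF u X h]]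
    have "(LINT g|M. of_real (real n * su2_char n (h ** g)) * w (g, h)) = - (LINT g|M. of_real (real n * su2_char_deriv X n (h ** g)) * u (g, h))"
      by (simp add: w_def)
    thus "(LINT g|M. derivation_kernel X n (g, h) * u (g, h)) = (LINT g|M. of_real (real n * su2_char n (h ** g)) * w (g, h))"
      by (simp add: derivation_kernel_def)
  qed
  also have "\<dots> = (LINT g|M. LINT h|M. of_real (real n * su2_char n (h ** g)) * w (g, h))"
    by (rule Fubini_continuous) (intro continuous_intros continuous_on_compose2[OF w], auto)
  also have "\<dots> = (LINT g|M. LINT k|M. of_real (real n * su2_char n k) * w (g, k ** conj_transpose g))"
  proof (rule Bochner_Integration.integral_cong[OF refl])
    fix g assume "g \<in> space M"
    hence g: "g \<in> carrier SU2" by (simp add: space_SU2)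
    have "(\<lambda>h. of_real (real n * su2_char n (h ** g)) * w (g, h)) \<in> borel_measurable M"
      by (intro borel_measurable_continuous continuous_intros continuous_on_compose2[OF w]) (use g in auto)
    from integral_right_mult[OF this SU2_conj_transpose(1)[OF g]]
    show "(LINT h|M. of_real (real n * su2_char n (h ** g)) * w (g, h)) = (LINT k|M. of_real (real n * su2_char n k) * w (g, k ** conj_transpose g))"
      by (simp add: matrix_mul_assoc[symmetric] SU2_conj_transpose[OF g])
  qed
  also have "\<dots> = (LINT k|M. LINT g|M. of_real (real n * su2_char n k) * w (g, k ** conj_transpose g))"
    by (rule Fubini_continuous) (intro continuous_intros continuous_on_compose2[OF w], auto intro!: SU2_mult_closed SU2_conj_transpose(1))
  finally show ?thesis by (simp add: w_def)
qed

text \<open>The value is asserted for every pair \<open>\<xi>\<close>, \<open>\<eta>\<close> with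
  coefficient function \<open>u\<close>, which is what well-definedness of the pairing
  demands.\<close>

theorem derivation_operator:
  assumes X: "X \<in> su2"
  shows "\<exists>S\<in>VN (SU2 \<times>\<times> SU2) MM. \<forall>u \<xi> \<eta>. smooth_fun_on SU2_sq u \<longrightarrow> \<xi> \<in> L2 MM \<longrightarrow> \<eta> \<in> L2 MM \<longrightarrow>
    (\<forall>p\<in>SU2_sq. u p = L2_inner MM (left_regular (SU2 \<times>\<times> SU2) p \<xi>) \<eta>) \<longrightarrow>
    L2_inner MM (S \<xi>) \<eta> = of_real a * (LINT g|M. deriv_X0 X u (g, conj_transpose g))"
proof -
  from derivation_operator_exists[OF X, of a]
  obtain S where S: "S \<in> VN (SU2 \<times>\<times> SU2) MM" and "\<forall>\<xi>\<in>L2 MM. \<forall>\<eta>\<in>L2 MM.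
      summable (\<lambda>n. cmod (L2_inner MM (sq.conv (\<lambda>p. of_real a * derivation_kernel X n p) \<xi>) \<eta>)) \<and>
      L2_inner MM (S \<xi>) \<eta> = (\<Sum>n. L2_inner MM (sq.conv (\<lambda>p. of_real a * derivation_kernel X n p) \<xi>) \<eta>)"
    by (rule bexE)
  note S_eq = this(2)[rule_format]
  have "L2_inner MM (S \<xi>) \<eta> = of_real a * (LINT g|M. deriv_X0 X u (g, conj_transpose g))"
    if u: "smooth_fun_on SU2_sq u" and \<xi>: "\<xi> \<in> L2 MM" and \<eta>: "\<eta> \<in> L2 MM"
      and coeff: "\<forall>p\<in>SU2_sq. u p = L2_inner MM (left_regular (SU2 \<times>\<times> SU2) p \<xi>) \<eta>" for u \<xi> \<eta>
  proof -
    define w where "w = deriv_X0 X u"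
    have w: "continuous_on SU2_sq w" unfolding w_def by (intro smooth_fun_on_continuous smooth_deriv_X0 u X)
    \<comment> \<open>The pairing with the n-th block is the n-th character coefficient of
      \<open>f\<close>, so the sum of the series is \<open>f (mat 1)\<close>; absolute summability
      comes with the operator and not from smoothness of \<open>f\<close>.\<close>
    define f where "f = (\<lambda>k. of_real a * (LINT g|M. w (g, k ** conj_transpose g)))"
    have "continuous_on SU2_sq (\<lambda>p. w (fst p, snd p ** conj_transpose (fst p)))"
      by (intro continuous_on_compose2[OF w] continuous_intros) (auto intro!: SU2_mult_closed SU2_conj_transpose(1))
    hence f: "continuous_on (carrier SU2) f"
      unfolding f_def by (intro continuous_intros continuous_on_parametric_integral)
    have inner: "L2_inner MM (sq.conv (\<lambda>p. of_real a * derivation_kernel X n p) \<xi>) \<eta> = (LINT k|M. of_real (real n * su2_char n k) * f k)" for n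
    proof -
      have k: "sq.kernel (\<lambda>p. of_real a * derivation_kernel X n p)"
        by (intro sq_kernel continuous_intros continuous_on_kernels)
      have "L2_inner MM (sq.conv (\<lambda>p. of_real a * derivation_kernel X n p) \<xi>) \<eta> = (LINT p|MM. of_real a * (derivation_kernel X n p * u p))"
        unfolding sq.conv_inner[OF k \<xi> \<eta>] using coeff
        by (intro Bochner_Integration.integral_cong refl) (auto simp: sq.space_eq carrier_SU2_sq)
      also have "\<dots> = of_real a * (LINT p|MM. derivation_kernel X n p * u p)" by simp
      also have "\<dots> = (LINT k|M. of_real (real n * su2_char n k) * f k)"
        unfolding derivation_kernel_integral[OF u X] f_def w_def
        by (subst integral_mult_right_zero[symmetric]) (simp add: mult_ac)
      finally show ?thesis .
    qed
    have "L2_inner MM (S \<xi>) \<eta> = f (mat 1)"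
      using S_eq[OF \<xi> \<eta>] char_expansion[OF f] unfolding inner by simp
    thus ?thesis by (simp add: f_def w_def)
  qed
  thus ?thesis by (intro bexI[OF _ S]) simp
qed

end

section \<open>Arbitrary Haar measures on the group and on its square\<close>

lemma SU2_mult_measurable:
  "(\<lambda>(x, y). x \<otimes>\<^bsub>SU2\<^esub> y) \<in> restrict_space borel (carrier SU2) \<Otimes>\<^sub>M restrict_space borel (carrier SU2) \<rightarrow>\<^sub>M restrict_space borel (carrier SU2)"
proof (rule measurable_restrict_space2)
  have "continuous_on SU2_sq (\<lambda>p. fst p ** snd p)" by (intro continuous_intros)
  from borel_measurable_continuous_on_restrict[OF this]
  show "(\<lambda>(x, y). x \<otimes>\<^bsub>SU2\<^esub> y) \<in> restrict_space borel (carrier SU2) \<Otimes>\<^sub>M restrict_space borel (carrier SU2) \<rightarrow>\<^sub>M borel"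
    by (simp add: case_prod_unfold cong: measurable_cong_sets add: sets_restrict_borel_prod)
qed (auto simp: space_pair_measure space_restrict_space SU2_mult_closed)

lemma SU2_inv_measurable:
  "(\<lambda>x. inv\<^bsub>SU2\<^esub> x) \<in> restrict_space borel (carrier SU2) \<rightarrow>\<^sub>M restrict_space borel (carrier SU2)"
proof (rule measurable_restrict_space2)
  have "continuous_on (carrier SU2) (\<lambda>x. conj_transpose x)" by (intro continuous_intros)
  from borel_measurable_continuous_on_restrict[OF this]
  show "(\<lambda>x. inv\<^bsub>SU2\<^esub> x) \<in> restrict_space borel (carrier SU2) \<rightarrow>\<^sub>M borel"
    by (subst measurable_cong[where g = conj_transpose]) (auto simp: space_restrict_space SU2_conj_transpose)
qed (auto simp: space_restrict_space)

text \<open>The two Haar measures may be normalized independently. The mass of \<mu> scales the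
  integral and is built into the operator as the scalar; the mass of \<nu> scales only the inner
  product and cancels, since it multiplies both the coefficient function and the pairing.\<close>

theorem proposition2p4:
  fixes X :: mat2 and \<mu> :: "mat2 measure" and \<nu> :: "(mat2 \<times> mat2) measure"
  assumes haar: "haar_measure SU2 \<mu>"
    and haar2: "haar_measure (SU2 \<times>\<times> SU2) \<nu>"
    and X: "X \<in> su2" "X \<noteq> 0"
  shows "\<exists>S\<in>VN (SU2 \<times>\<times> SU2) \<nu>. \<forall>u\<in>test_functions (carrier (SU2 \<times>\<times> SU2)).
           VN_dual (SU2 \<times>\<times> SU2) \<nu> S u = (LINT g|\<mu>. deriv_X0 X u (g, inv\<^bsub>SU2\<^esub> g))"
proof -
  obtain M c where M: "prob_haar SU2 M" and c: "c > 0" and sM: "sets M = sets (restrict_space borel (carrier SU2))" 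
    and \<mu>: "\<mu> = density M (\<lambda>_. ennreal c)"
    by (rule haar_measure_normalize[OF haar SU2_compact SU2_group refl SU2_mult_measurable SU2_inv_measurable])
  interpret prob_haar SU2 M by fact
  interpret su2_haar M by unfold_locales (rule sM)
  obtain N c' where N: "prob_haar (SU2 \<times>\<times> SU2) N" and c': "c' > 0" and sN: "sets N = sets MM"
    and \<nu>: "\<nu> = density N (\<lambda>_. ennreal c')"
  proof (rule haar_measure_normalize[OF haar2 _ DirProd_group[OF SU2_group SU2_group] _ sq.mult_measurable sq.inv_measurable])
    show "compact (carrier (SU2 \<times>\<times> SU2))" unfolding carrier_SU2_sq by (intro compact_Times SU2_compact)
    show "sets MM = sets (restrict_space borel (carrier (SU2 \<times>\<times> SU2)))" unfolding carrier_SU2_sq by (rule sets_SU2_sq)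
  qed
  \<comment> \<open>Uniqueness of Haar measure identifies the normalized measure on the product
    group with the product measure, for which the operator was built.\<close>
  have NM: "N = MM" by (rule sq.haar_unique[OF N sN])
  note \<nu> = \<nu>[unfolded NM]
  from derivation_operator[OF X(1), of c]
  obtain S where S: "S \<in> VN (SU2 \<times>\<times> SU2) MM" and "\<forall>u \<xi> \<eta>. smooth_fun_on SU2_sq u \<longrightarrow> \<xi> \<in> L2 MM \<longrightarrow> \<eta> \<in> L2 MM \<longrightarrow>
    (\<forall>p\<in>SU2_sq. u p = L2_inner MM (left_regular (SU2 \<times>\<times> SU2) p \<xi>) \<eta>) \<longrightarrow>
    L2_inner MM (S \<xi>) \<eta> = of_real c * (LINT g|M. deriv_X0 X u (g, conj_transpose g))"
    by (rule bexE)
  note S_eq = this(2)[rule_format]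
  have SL: "S \<xi> \<in> L2 MM" if "\<xi> \<in> L2 MM" for \<xi>
    using S that by (auto simp: VN_def commutant_def L2_operators_def)
  \<comment> \<open>The factor \<open>c'\<close> is absorbed into the second vector, so that the
    pairing formula for the product measure applies verbatim.\<close>
  have inner: "L2_inner \<nu> \<xi> \<eta> = L2_inner MM \<xi> (\<lambda>x. of_real c' * \<eta> x)" if "\<xi> \<in> L2 MM" "\<eta> \<in> L2 MM" for \<xi> \<eta>
    unfolding \<nu> using L2_inner_density_const[OF c' that] by (simp add: L2_inner_scale_right)
  have L2: "L2 \<nu> = L2 MM" unfolding \<nu> by (rule L2_density_const[OF c'])
  have "VN_dual (SU2 \<times>\<times> SU2) \<nu> S u = (LINT g|\<mu>. deriv_X0 X u (g, inv\<^bsub>SU2\<^esub> g))"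
    if "u \<in> test_functions (carrier (SU2 \<times>\<times> SU2))" for u
  proof -
    have u: "smooth_fun_on SU2_sq u" using that by (simp add: test_functions_def carrier_SU2_sq)
    have rhs: "(LINT g|\<mu>. deriv_X0 X u (g, inv\<^bsub>SU2\<^esub> g)) = of_real c * (LINT g|M. deriv_X0 X u (g, conj_transpose g))"
    proof -
      have "continuous_on (carrier SU2) (\<lambda>g. deriv_X0 X u (g, conj_transpose g))"
        by (intro continuous_on_compose2[OF smooth_fun_on_continuous[OF smooth_deriv_X0[OF u X(1)]]] continuous_intros)
          (auto intro: SU2_conj_transpose(1))
      note meas = borel_measurable_continuous[OF this]
      have "(LINT g|\<mu>. deriv_X0 X u (g, inv\<^bsub>SU2\<^esub> g)) = (LINT g|\<mu>. deriv_X0 X u (g, conj_transpose g))"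
        by (intro Bochner_Integration.integral_cong refl) (simp add: \<mu> space_SU2 SU2_conj_transpose)
      also have "\<dots> = of_real c * (LINT g|M. deriv_X0 X u (g, conj_transpose g))"
        unfolding \<mu> using meas c by (subst integral_density) (auto simp: scaleR_conv_of_real)
      finally show ?thesis .
    qed
    obtain \<xi> \<eta> where \<xi>\<eta>: "\<xi> \<in> L2 MM" "\<eta> \<in> L2 MM" 
      "\<And>p. p \<in> SU2_sq \<Longrightarrow> u p = L2_inner MM (left_regular (SU2 \<times>\<times> SU2) p \<xi>) \<eta>"
      using smooth_coefficient[OF u] by blast
    show ?thesis unfolding rhs
    proof (rule VN_dual_eqI)
      \<comment> \<open>Dividing the second vector by \<open>c'\<close> keeps the coefficient
        function equal to \<open>u\<close> for the rescaled inner product.\<close>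
      show "\<xi> \<in> L2 \<nu>" "(\<lambda>x. of_real (1 / c') * \<eta> x) \<in> L2 \<nu>" unfolding L2 by (intro \<xi>\<eta> L2_scale)+
      show "u p = L2_inner \<nu> (left_regular (SU2 \<times>\<times> SU2) p \<xi>) (\<lambda>x. of_real (1 / c') * \<eta> x)" 
        if "p \<in> carrier (SU2 \<times>\<times> SU2)" for p
        using that c' \<xi>\<eta> inner[OF sq.left_regular_L2[OF \<xi>\<eta>(1) that] L2_scale[OF \<xi>\<eta>(2), of "of_real (1 / c')"]]
        by (simp add: carrier_SU2_sq)
    next
      fix \<xi> \<eta> assume "\<xi> \<in> L2 \<nu>" "\<eta> \<in> L2 \<nu>" 
        and coeff: "\<And>p. p \<in> carrier (SU2 \<times>\<times> SU2) \<Longrightarrow> u p = L2_inner \<nu> (left_regular (SU2 \<times>\<times> SU2) p \<xi>) \<eta>"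
      hence \<xi>\<eta>: "\<xi> \<in> L2 MM" "\<eta> \<in> L2 MM" unfolding L2 by auto
      have "L2_inner \<nu> (S \<xi>) \<eta> = L2_inner MM (S \<xi>) (\<lambda>x. of_real c' * \<eta> x)" by (rule inner[OF SL[OF \<xi>\<eta>(1)] \<xi>\<eta>(2)])
      also have "\<dots> = of_real c * (LINT g|M. deriv_X0 X u (g, conj_transpose g))"
        using coeff by (intro S_eq[OF u \<xi>\<eta>(1) L2_scale[OF \<xi>\<eta>(2)]]) (simp add: inner \<xi>\<eta> sq.left_regular_L2 carrier_SU2_sq)
      finally show "L2_inner \<nu> (S \<xi>) \<eta> = of_real c * (LINT g|M. deriv_X0 X u (g, conj_transpose g))" .
    qed
  qed
  moreover have "S \<in> VN (SU2 \<times>\<times> SU2) \<nu>" unfolding \<nu> VN_density_const[OF c'] by (rule S)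
  ultimately show ?thesis by blast
qed

end
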